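(* Let $X$ be a nonempty metrizable compactum, let $\mathbf{Z}=(|T_i|,g_i^{i+1})$ be an induced inverse sequence for $X$ (with $X\subset I^\infty$ via the chosen embedding), and let $Z=\lim\mathbf{Z}$. For each thread $w=(a_1,a_2,\dots)\in Z$, where $a_i\in |T_i|\subset I^\infty$, put $\pi(w)=\lim_{i\to\infty}a_i$. Then this limit exists in $I^\infty$ and lies in $X$, and the resulting function $\pi:Z\to X$ is a cell-like map from the metrizable compactum $Z$. Moreover, for each CW-complex $K_0$ with $X\tau K_0$, one has $Z\tau K_0$.
   Context: A map is a continuous function. For spaces $Y,K$, write $Y\tau K$ if for every closed $A\subset Y$, every map $A\to K$ extends to a map $Y\to K$. A compact metrizable space is cell-like (has trivial shape) if it has the shape of a point; such a space is a nonempty continuum. A cell-like map is a proper map all of whose fibers are cell-like. Hilbert cube. $I=[0,1]$, $I^\infty=\prod_{i\in\mathbb{N}}I$, with metric $\rho(x,y)=\sum_{i\ge1}|x_i-y_i|/2^i$. For $j\in\mathbb{N}$, $I^\infty=I^j\times I^\infty_j$, with $I^\infty_j$ the product of the factors of index $>j$. A point $x\in I^j$ is identified with $(x,0,0,\dots)\in I^\infty$, so $I^j\subset I^\infty$ and $\rho$ applies to $I^j$. $p_{k,\infty}:I^\infty\to I^k$ and $p_j^k:I^k\to I^j$ ($j\le k$) are the projections to the first $k$, resp. $j$, coordinates. $N(A,r)$ is the open $r$-neighborhood of $A$, and $\overline N(y,r)=\{z:\rho(y,z)\le r\}$. Simplicial notions. $|T|$ is the polyhedron of a simplicial complex $T$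 (weak topology) and $T^{(0)}$ its vertex set; $\overline{\mathrm{st}}(v,T)$ is the closed star of a vertex $v$. A triangulation of a compact polyhedron $P$ is a finite simplicial complex $T$ with $|T|=P$; $\operatorname{mesh}T$ is the maximum $\rho$-diameter of its simplexes. For $D\subset|T|$, the simplicial neighborhood of $D$ in $T$ is the subcomplex consisting of all simplexes of $T$ meeting $D$ and all their faces. For functions $f,g:Y\to|T|$, $g$ is a $T$-modification of $f$ if $f(x)\in\sigma\in T$ implies $g(x)\in\sigma$. A simplicial approximation of a map $f:|S|\to|T|$ is a simplicial map $|S|\to|T|$ that is a $T$-modification of $f$. Fixed countable collections. For each compact metrizable $Y$, $\mathcal{B}(Y)$ is a fixed countable collection of nonempty closed subsets of $Y$ such that for each nonempty closed $C\subset Y$ and each neighborhood $U$ of $C$ there is $A\in\mathcal{B}(Y)$ with $C\subset\operatorname{int}A\subset A\subset U$. For compact metrizable $Y$ and a compact polyhedron $P$, $\mathcal{H}(Y,P)$ is a fixed (countable) set consisting of one map from each homotopy class of maps $Y\to P$. For a nonempty simplicial complex $K$, $\mathcal{F}(K)$ is a fixed countable set of finite simplicial complexes, each simplicially isomorphic to a subcomplex of $K$, such that each finite subcomplex of $K$ is simplicially isomorphic to an element of $\mathcal{F}(K)$. Extension dimension. $\mathcal{C}$ is the class of metrizable compacta, $\mathcal{T}$ the class of CW-complexes. For $K,L\in\mathcal{T}$ put $[K]\le[L]$ if $Y\tau K$ implies $Y\tau L$ for all $Y\in\mathcal{C}$; the extension type $[K]_{(\mathcal{C},\mathcal{T})}$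 is the class of $L$ with $[K]\le[L]\le[K]$. $\operatorname{extdim}_{(\mathcal{C},\mathcal{T})}X$ is the least extension type $[K]$ with $X\tau K$. Thus $[|K|]_{(\mathcal{C},\mathcal{T})}=\operatorname{extdim}_{(\mathcal{C},\mathcal{T})}X$ means $X\tau|K|$ and, whenever $X\tau L$ with $L\in\mathcal{T}$, every $Y\in\mathcal{C}$ with $Y\tau|K|$ satisfies $Y\tau L$. Induced inverse sequence for a nonempty metrizable compactum $X$. Embed $X$ in $I^\infty$ (and regard $X\subset I^\infty$), let $K$ be a simplicial complex with $[|K|]_{(\mathcal{C},\mathcal{T})}=\operatorname{extdim}_{(\mathcal{C},\mathcal{T})}X$, let $\eta:\mathbb{N}\to\mathbb{N}\times\mathbb{N}$, $\eta(j)=(s_j,t_j)$, be a bijection with $s_j\le j$ for all $j$, and choose a sequence $\mathcal{S}_j=(n_j,P_j,\epsilon_j,\widetilde T_j,f_j^{j+1},\delta_j,T_j,\varphi_j,g_j^{j+1})$, $j\in\mathbb{N}$, where $(n_j)$ is increasing in $\mathbb{N}$; $P_j\subset I^{n_j}$ is a compact polyhedron; $X\subset\operatorname{int}_{I^\infty}(P_j\times I^\infty_{n_j})\subset N(X,\tfrac2j)$ and $p_{n_j}^{n_{j+1}}(P_{j+1})\subset\operatorname{int}_{I^{n_j}}P_j$; $\epsilon_j,\delta_j>0$; $\widetilde T_j$ and $T_j$ are triangulations of $P_j$ with $T_j$ a subdivision of $\widetilde T_j$; $f_j^{j+1}:|\widetilde T_{j+1}|\to|T_j|$ is a simplicial approximation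 of $p_{n_j}^{n_{j+1}}|P_{j+1}:P_{j+1}\to P_j$; $\varphi_j:|T_j|\to|\widetilde T_j|$ is a simplicial approximation of the identity of $P_j$; $g_j^{j+1}=f_j^{j+1}\circ\varphi_{j+1}:|T_{j+1}|\to|T_j|$, with $g_s^j=g_s^{s+1}\circ\cdots\circ g_{j-1}^j$ for $s<j$ and $g_j^j=\mathrm{id}$; the countable set $\bigcup\{\mathcal{H}(D,|N|)\,|\,(D,N)\in\mathcal{B}(P_j)\times\mathcal{F}(K)\}$ is indexed as $\{f_{j,k}\,|\,k\in\mathbb{N}\}$, $f_{j,k}:D_{j,k}\to|N_{j,k}|$; and for all $j$: (1) if $j>1$, $u,v\in I^\infty$ and $\rho(u,v)<\epsilon_j$, then $\rho(p_{n_s,\infty}(u),p_{n_s,\infty}(v))<\delta_s$ for all $1\le s<j$; (2) $5\cdot2^{-n_j}<\epsilon_j$; (3) $\delta_j<2^{1-n_j}$; (4) $\operatorname{mesh}T_j<\delta_j/2$; (5) the map $f_{s_j,t_j}\circ g_{s_j}^j|(g_{s_j}^j)^{-1}(D_{s_j,t_j})$ into $|N_{s_j,t_j}|$ extends to a map $|E_{s_j,t_j}|\to|N_{s_j,t_j}|$, where $E_{s_j,t_j}$ is the simplicial neighborhood of $(g_{s_j}^j)^{-1}(D_{s_j,t_j})$ in $T_j$; (6) $|E^*_{s_j,t_j}|$ is a regular neighborhood of $|E_{s_j,t_j}|$ in $|T_j|$, where $E^*_{s_j,t_j}$ is the simplicial neighborhood of $|E_{s_j,t_j}|$ in $T_j$;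 (7) for each $x\in X$ there is $v_{x,j}\in\widetilde T_j^{(0)}$ with $\overline N(p_{n_j,\infty}(x),2\delta_j)\cap P_j\subset\overline{\mathrm{st}}(v_{x,j},\widetilde T_j)\subset\overline N(p_{n_j,\infty}(x),\epsilon_j)\cap P_j$; (8) if $j>1$ and $1\le s<j$, the simplicial map $g_s^j:|T_j|\to|T_s|$ is a simplicial approximation of $p_{n_s}^{n_j}|P_j:P_j\to P_s$. Then $\mathbf{Z}=(|T_j|,g_j^{j+1})$ is called an induced inverse sequence for $X$. *)

theory Defs
  imports "HOL-Analysis.Analysis" "HOL-Library.Function_Algebras"
begin

text \<open>
  Sequences \<open>(x\<^sub>1, x\<^sub>2, \<dots>)\<close> and \<open>(\<S>\<^sub>j)\<close> are indexed from \<open>0\<close>: coordinate \<open>i\<close> of a point of the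
  Hilbert cube is the classical coordinate \<open>i + 1\<close>, and stage \<open>j\<close> is the classical stage \<open>j + 1\<close>.
  A ``map'' with domain a set is a total function whose values outside the domain are irrelevant.
\<close>

text \<open>Pointwise vector space structure, so that \<^const>\<open>convex\<close> hulls and
  \<^const>\<open>affine_dependent\<close> make sense in \<^typ>\<open>nat \<Rightarrow> real\<close>.\<close>

instantiation "fun" :: (type, real_vector) real_vector
begin

definition scaleR_fun :: "real \<Rightarrow> ('a \<Rightarrow> 'b) \<Rightarrow> 'a \<Rightarrow> 'b"
  where "scaleR_fun r f = (\<lambda>x. r *\<^sub>R f x)"

instance
  by standard (auto simp: scaleR_fun_def plus_fun_def fun_eq_iff scaleR_add_right scaleR_add_left)

end


section \<open>Absolute extension, CW-complexes, extension dimension\<close>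

definition tau_ext :: "'a topology \<Rightarrow> 'b topology \<Rightarrow> bool"
  where "tau_ext Y K \<longleftrightarrow>
    (\<forall>A f. closedin Y A \<and> continuous_map (subtopology Y A) K f \<longrightarrow>
       (\<exists>h. continuous_map Y K h \<and> (\<forall>x\<in>A. h x = f x)))"

definition disc :: "nat \<Rightarrow> (nat \<Rightarrow> real) topology"
  where "disc n = subtopology (Euclidean_space n) {x. (\<Sum>i<n. (x i)\<^sup>2) \<le> 1}"

definition disc_interior :: "nat \<Rightarrow> (nat \<Rightarrow> real) set"
  where "disc_interior n = {x \<in> topspace (Euclidean_space n). (\<Sum>i<n. (x i)\<^sup>2) < 1}"

definition disc_boundary :: "nat \<Rightarrow> (nat \<Rightarrow> real) set"
  where "disc_boundary n = {x \<in> topspace (Euclidean_space n). (\<Sum>i<n. (x i)\<^sup>2) = 1}"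

text \<open>A CW-structure is given as its set \<open>\<Phi>\<close> of pairs (dimension, characteristic map).\<close>

definition CW_structure :: "'a topology \<Rightarrow> (nat \<times> ((nat \<Rightarrow> real) \<Rightarrow> 'a)) set \<Rightarrow> bool"
  where "CW_structure X \<Phi> \<longleftrightarrow>
    Hausdorff_space X \<and>
    (\<forall>(n, c)\<in>\<Phi>. continuous_map (disc n) X c \<and>
                embedding_map (subtopology (disc n) (disc_interior n)) X c) \<and>
    (\<forall>p\<in>\<Phi>. \<forall>q\<in>\<Phi>. p \<noteq> q \<longrightarrow>
        snd p ` disc_interior (fst p) \<inter> snd q ` disc_interior (fst q) = {}) \<and>
    topspace X = (\<Union>(n, c)\<in>\<Phi>. c ` disc_interior n) \<and>
    (\<forall>(n, c)\<in>\<Phi>. \<exists>\<Psi>. finite \<Psi> \<and> \<Psi> \<subseteq> {p \<in> \<Phi>. fst p < n} \<and>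
        c ` disc_boundary n \<subseteq> (\<Union>(m, d)\<in>\<Psi>. d ` disc_interior m)) \<and>
    (\<forall>A. A \<subseteq> topspace X \<and>
        (\<forall>(n, c)\<in>\<Phi>. closedin X (A \<inter> X closure_of (c ` disc_interior n)))
        \<longrightarrow> closedin X A)"

definition CW_complex :: "'a topology \<Rightarrow> bool"
  where "CW_complex X \<longleftrightarrow> (\<exists>\<Phi>. CW_structure X \<Phi>)"

text \<open>\<open>[M] \<le> [L]\<close>. Every metrizable compactum is homeomorphic to a subspace of the Hilbert cube,
  so the class of metrizable compacta is represented by topologies on sets of elements of
  \<^typ>\<open>nat \<Rightarrow> real\<close>.\<close>

definition ext_le :: "'a topology \<Rightarrow> 'b topology \<Rightarrow> bool"
  where "ext_le M L \<longleftrightarrow>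
    (\<forall>Y :: (nat \<Rightarrow> real) topology.
        compact_space Y \<and> metrizable_space Y \<and> tau_ext Y M \<longrightarrow> tau_ext Y L)"

text \<open>\<open>[M]\<close> is the extension dimension of \<open>X\<close>. HOL cannot quantify over the proper class of
  CW-complexes; the competitors \<open>L\<close> range over all CW-complexes with points in the type \<open>'c\<close>,
  which is a parameter. The property for all types \<open>'c\<close> together is the classical notion, so as
  an assumption the property for one type \<open>'c\<close> is at most as strong as the classical one.\<close>

definition is_extdim :: "'c itself \<Rightarrow> 'a topology \<Rightarrow> 'b topology \<Rightarrow> bool"
  where "is_extdim _ X M \<longleftrightarrow>
    tau_ext X M \<and> (\<forall>L :: 'c topology. CW_complex L \<and> tau_ext X L \<longrightarrow> ext_le M L)"


section \<open>Abstract simplicial complexes and their polyhedra\<close>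

definition abs_complex :: "'v set set \<Rightarrow> bool"
  where "abs_complex K \<longleftrightarrow>
    (\<forall>\<sigma>\<in>K. finite \<sigma> \<and> \<sigma> \<noteq> {} \<and> (\<forall>\<tau>. \<tau> \<subseteq> \<sigma> \<and> \<tau> \<noteq> {} \<longrightarrow> \<tau> \<in> K))"

definition subcomplex :: "'v set set \<Rightarrow> 'v set set \<Rightarrow> bool"
  where "subcomplex L K \<longleftrightarrow> abs_complex L \<and> L \<subseteq> K"

definition simplicially_isomorphic :: "'v set set \<Rightarrow> 'w set set \<Rightarrow> bool"
  where "simplicially_isomorphic K L \<longleftrightarrow>
    (\<exists>h. inj_on h (\<Union>K) \<and> (\<lambda>\<sigma>. h ` \<sigma>) ` K = L)"

text \<open>The simplex spanned by \<open>\<sigma>\<close>, points being given by their barycentric coordinates.\<close>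

definition bary_simplex :: "'v set \<Rightarrow> ('v \<Rightarrow> real) set"
  where "bary_simplex \<sigma> = {b. (\<forall>v. 0 \<le> b v) \<and> (\<forall>v. v \<notin> \<sigma> \<longrightarrow> b v = 0) \<and> sum b \<sigma> = 1}"

definition bary_open :: "'v set set \<Rightarrow> ('v \<Rightarrow> real) set \<Rightarrow> bool"
  where "bary_open K U \<longleftrightarrow> U \<subseteq> \<Union>(bary_simplex ` K) \<and>
    (\<forall>\<sigma>\<in>K. openin (top_of_set (bary_simplex \<sigma>)) (U \<inter> bary_simplex \<sigma>))"

text \<open>\<open>|K|\<close> with the weak topology.\<close>

definition polyhedron_top :: "'v set set \<Rightarrow> ('v \<Rightarrow> real) topology"
  where "polyhedron_top K = topology (bary_open K)"

lemma istopology_bary_open: "istopology (bary_open K)"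
  unfolding istopology_def
proof (intro conjI allI impI)
  fix S T assume "bary_open K S" "bary_open K T"
  moreover have "(S \<inter> T) \<inter> bary_simplex \<sigma> = (S \<inter> bary_simplex \<sigma>) \<inter> (T \<inter> bary_simplex \<sigma>)" for \<sigma>
    by blast
  ultimately show "bary_open K (S \<inter> T)"
    unfolding bary_open_def by (auto intro: openin_Int)
next
  fix \<U> assume *: "\<forall>U\<in>\<U>. bary_open K U"
  have "openin (top_of_set (bary_simplex \<sigma>)) (\<Union>\<U> \<inter> bary_simplex \<sigma>)" if "\<sigma> \<in> K" for \<sigma>
  proof -
    have "openin (top_of_set (bary_simplex \<sigma>)) (\<Union>U\<in>\<U>. U \<inter> bary_simplex \<sigma>)"
      using * that by (intro openin_Union) (auto simp: bary_open_def)
    then show ?thesis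
      by (metis Int_Union2)
  qed
  then show "bary_open K (\<Union>\<U>)"
    using * by (simp add: bary_open_def Sup_le_iff)
qed

lemma openin_polyhedron_top: "openin (polyhedron_top K) U \<longleftrightarrow> bary_open K U"
  by (simp add: polyhedron_top_def istopology_bary_open topology_inverse')


section \<open>The Hilbert cube\<close>

definition hcube :: "(nat \<Rightarrow> real) set"
  where "hcube = {x. \<forall>i. 0 \<le> x i \<and> x i \<le> 1}"

definition hdist :: "(nat \<Rightarrow> real) \<Rightarrow> (nat \<Rightarrow> real) \<Rightarrow> real"
  where "hdist x y = (\<Sum>i. \<bar>x i - y i\<bar> / 2 ^ Suc i)"

text \<open>\<open>I\<^sup>n\<close> as a subset of the Hilbert cube.\<close>

definition fcube :: "nat \<Rightarrow> (nat \<Rightarrow> real) set"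
  where "fcube n = {x \<in> hcube. \<forall>i\<ge>n. x i = 0}"

text \<open>Under this inclusion, one function serves for all the projections onto \<open>I\<^sup>n\<close>, from the Hilbert
  cube and from each \<open>I\<^sup>k\<close> with \<open>n \<le> k\<close>.\<close>

definition hproj :: "nat \<Rightarrow> (nat \<Rightarrow> real) \<Rightarrow> nat \<Rightarrow> real"
  where "hproj n x = (\<lambda>i. if i < n then x i else 0)"

definition hnbhd :: "(nat \<Rightarrow> real) set \<Rightarrow> real \<Rightarrow> (nat \<Rightarrow> real) set"
  where "hnbhd A r = {z \<in> hcube. \<exists>x\<in>A. hdist x z < r}"

definition hcball :: "(nat \<Rightarrow> real) \<Rightarrow> real \<Rightarrow> (nat \<Rightarrow> real) set"
  where "hcball y r = {z \<in> hcube. hdist y z \<le> r}"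

definition hdiameter :: "(nat \<Rightarrow> real) set \<Rightarrow> real"
  where "hdiameter S = Sup {hdist x y | x y. x \<in> S \<and> y \<in> S}"


section \<open>Shape and cell-like maps\<close>

text \<open>Borsuk's definition of shape for compacta in the Hilbert cube, by fundamental sequences.\<close>

definition fseq_homotopic ::
  "(nat \<Rightarrow> (nat \<Rightarrow> real) \<Rightarrow> nat \<Rightarrow> real) \<Rightarrow> (nat \<Rightarrow> (nat \<Rightarrow> real) \<Rightarrow> nat \<Rightarrow> real)
    \<Rightarrow> (nat \<Rightarrow> real) set \<Rightarrow> (nat \<Rightarrow> real) set \<Rightarrow> bool"
  where "fseq_homotopic f g A B \<longleftrightarrow>
    (\<forall>V. openin (top_of_set hcube) V \<and> B \<subseteq> V \<longrightarrow>
       (\<exists>U. openin (top_of_set hcube) U \<and> A \<subseteq> U \<and>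
          (\<forall>\<^sub>F k in sequentially.
             homotopic_with (\<lambda>_. True) (top_of_set U) (top_of_set V) (f k) (g k))))"

definition fundamental_sequence ::
  "(nat \<Rightarrow> (nat \<Rightarrow> real) \<Rightarrow> nat \<Rightarrow> real) \<Rightarrow> (nat \<Rightarrow> real) set \<Rightarrow> (nat \<Rightarrow> real) set \<Rightarrow> bool"
  where "fundamental_sequence f A B \<longleftrightarrow>
    (\<forall>k. continuous_map (top_of_set hcube) (top_of_set hcube) (f k)) \<and>
    fseq_homotopic f (\<lambda>k. f (Suc k)) A B"

definition same_shape :: "(nat \<Rightarrow> real) set \<Rightarrow> (nat \<Rightarrow> real) set \<Rightarrow> bool"
  where "same_shape A B \<longleftrightarrow>
    (\<exists>f g. fundamental_sequence f A B \<and> fundamental_sequence g B A \<and>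
       fseq_homotopic (\<lambda>k. g k \<circ> f k) (\<lambda>_. id) A A \<and>
       fseq_homotopic (\<lambda>k. f k \<circ> g k) (\<lambda>_. id) B B)"

text \<open>The shape of a metrizable compactum is that of any of its copies in the Hilbert cube.\<close>

definition cell_like :: "'a topology \<Rightarrow> bool"
  where "cell_like Y \<longleftrightarrow> compact_space Y \<and> metrizable_space Y \<and>
    (\<exists>e. embedding_map Y (top_of_set hcube) e \<and> same_shape (e ` topspace Y) {\<lambda>_. 0})"

definition cell_like_map :: "'a topology \<Rightarrow> 'b topology \<Rightarrow> ('a \<Rightarrow> 'b) \<Rightarrow> bool"
  where "cell_like_map Z X f \<longleftrightarrow> continuous_map Z X f \<and> proper_map Z X f \<and>
    (\<forall>x\<in>topspace X. cell_like (subtopology Z {z \<in> topspace Z. f z = x}))"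


section \<open>Finite geometric simplicial complexes\<close>

text \<open>A complex is represented by the family of vertex sets of its simplexes; the (closed) simplex
  with vertex set \<open>\<sigma>\<close> is \<open>convex hull \<sigma>\<close>.\<close>

definition geom_complex :: "'a::real_vector set set \<Rightarrow> bool"
  where "geom_complex T \<longleftrightarrow> finite T \<and> abs_complex T \<and>
    (\<forall>\<sigma>\<in>T. \<not> affine_dependent \<sigma>) \<and>
    (\<forall>\<sigma>\<in>T. \<forall>\<tau>\<in>T. convex hull \<sigma> \<inter> convex hull \<tau> = convex hull (\<sigma> \<inter> \<tau>))"

definition polyhedron_of :: "'a::real_vector set set \<Rightarrow> 'a set"
  where "polyhedron_of T = (\<Union>\<sigma>\<in>T. convex hull \<sigma>)"

definition triangulates :: "'a::real_vector set set \<Rightarrow> 'a set \<Rightarrow> bool"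
  where "triangulates T P \<longleftrightarrow> geom_complex T \<and> polyhedron_of T = P"

definition subdivision_of :: "'a::real_vector set set \<Rightarrow> 'a set set \<Rightarrow> bool"
  where "subdivision_of T' T \<longleftrightarrow> geom_complex T' \<and> geom_complex T \<and> polyhedron_of T' = polyhedron_of T \<and>
    (\<forall>\<sigma>\<in>T'. \<exists>\<tau>\<in>T. convex hull \<sigma> \<subseteq> convex hull \<tau>)"

definition closed_star :: "'a::real_vector \<Rightarrow> 'a set set \<Rightarrow> 'a set"
  where "closed_star v T = (\<Union>\<sigma>\<in>{\<sigma> \<in> T. v \<in> \<sigma>}. convex hull \<sigma>)"

definition simplicial_nbhd :: "'a::real_vector set \<Rightarrow> 'a set set \<Rightarrow> 'a set set"
  where "simplicial_nbhd D T =
    {\<tau>. \<tau> \<noteq> {} \<and> (\<exists>\<sigma>\<in>T. \<tau> \<subseteq> \<sigma> \<and> convex hull \<sigma> \<inter> D \<noteq> {})}"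

definition mesh :: "(nat \<Rightarrow> real) set set \<Rightarrow> real"
  where "mesh T = Max ((\<lambda>\<sigma>. hdiameter (convex hull \<sigma>)) ` T)"

definition simplicial_map ::
  "'a::real_vector set set \<Rightarrow> 'b::real_vector set set \<Rightarrow> ('a \<Rightarrow> 'b) \<Rightarrow> bool"
  where "simplicial_map S T f \<longleftrightarrow>
    (\<forall>\<sigma>\<in>S. f ` \<sigma> \<in> T \<and>
       (\<forall>u. (\<forall>v\<in>\<sigma>. 0 \<le> u v) \<and> sum u \<sigma> = 1 \<longrightarrow>
          f (\<Sum>v\<in>\<sigma>. u v *\<^sub>R v) = (\<Sum>v\<in>\<sigma>. u v *\<^sub>R f v)))"

definition modification ::
  "'a set \<Rightarrow> 'b::real_vector set set \<Rightarrow> ('a \<Rightarrow> 'b) \<Rightarrow> ('a \<Rightarrow> 'b) \<Rightarrow> bool"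
  where "modification Y T f g \<longleftrightarrow>
    (\<forall>x\<in>Y. \<forall>\<sigma>\<in>T. f x \<in> convex hull \<sigma> \<longrightarrow> g x \<in> convex hull \<sigma>)"

text \<open>\<open>g\<close> is a simplicial approximation of \<open>f : |S| \<rightarrow> |T|\<close>.\<close>

definition simplicial_approx ::
  "'a::real_vector set set \<Rightarrow> 'b::real_vector set set \<Rightarrow> ('a \<Rightarrow> 'b) \<Rightarrow> ('a \<Rightarrow> 'b) \<Rightarrow> bool"
  where "simplicial_approx S T f g \<longleftrightarrow> f ` polyhedron_of S \<subseteq> polyhedron_of T \<and>
    simplicial_map S T g \<and> modification (polyhedron_of S) T f g"

definition full_subcomplex :: "'v set set \<Rightarrow> 'v set set \<Rightarrow> bool"
  where "full_subcomplex L K \<longleftrightarrow> subcomplex L K \<and> (\<forall>\<sigma>\<in>K. \<sigma> \<subseteq> \<Union>L \<longrightarrow> \<sigma> \<in> L)"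

definition open_simplex :: "'a::real_vector set \<Rightarrow> 'a set"
  where "open_simplex \<sigma> = {\<Sum>v\<in>\<sigma>. u v *\<^sub>R v | u. (\<forall>v\<in>\<sigma>. 0 < u v) \<and> sum u \<sigma> = 1}"

text \<open>\<open>K'\<close> is a derived of \<open>K\<close> near the full subcomplex \<open>L\<close>: the simplexes of \<open>K\<close> that meet \<open>|L|\<close>
  without belonging to \<open>L\<close> are starred at interior points \<open>c \<sigma>\<close>, in order of decreasing dimension.
  A simplex of the result is the join of a (possibly empty) simplex \<open>\<rho>\<close> that is not starred
  with the points \<open>c \<sigma>\<close> for a (possibly empty) chain of starred simplexes having \<open>\<rho>\<close> as a face.\<close>

definition derived_near :: "'a::real_vector set set \<Rightarrow> 'a set set \<Rightarrow> 'a set set \<Rightarrow> bool"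
  where "derived_near K L K' \<longleftrightarrow>
    (let S = {\<sigma> \<in> K. \<sigma> \<inter> \<Union>L \<noteq> {} \<and> \<sigma> \<notin> L} in
      \<exists>c. (\<forall>\<sigma>\<in>S. c \<sigma> \<in> open_simplex \<sigma>) \<and>
        K' = {\<rho> \<union> c ` C | \<rho> C. (\<rho> = {} \<or> \<rho> \<in> K - S) \<and> C \<subseteq> S \<and>
                (\<forall>\<sigma>\<in>C. \<forall>\<tau>\<in>C. \<sigma> \<subseteq> \<tau> \<or> \<tau> \<subseteq> \<sigma>) \<and> (\<forall>\<sigma>\<in>C. \<rho> \<subseteq> \<sigma>) \<and> \<rho> \<union> c ` C \<noteq> {}})"

text \<open>\<open>N\<close> is a regular neighborhood of the compact polyhedron \<open>A\<close> in the compact polyhedron \<open>Y\<close>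
  (Rourke and Sanderson, Introduction to Piecewise-Linear Topology, Chapter 3).\<close>

definition regular_nbhd :: "'a::real_vector set \<Rightarrow> 'a set \<Rightarrow> 'a set \<Rightarrow> bool"
  where "regular_nbhd N A Y \<longleftrightarrow>
    (\<exists>K L K'. triangulates K Y \<and> full_subcomplex L K \<and> polyhedron_of L = A \<and>
       derived_near K L K' \<and> N = polyhedron_of (simplicial_nbhd A K'))"


section \<open>The fixed countable collections\<close>

definition nbhd_collection :: "'a::topological_space set \<Rightarrow> 'a set set \<Rightarrow> bool"
  where "nbhd_collection Y B \<longleftrightarrow> countable B \<and>
    (\<forall>A\<in>B. A \<noteq> {} \<and> closedin (top_of_set Y) A) \<and>
    (\<forall>C U. C \<noteq> {} \<and> closedin (top_of_set Y) C \<and> openin (top_of_set Y) U \<and> C \<subseteq> U \<longrightarrow>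
       (\<exists>A\<in>B. C \<subseteq> (top_of_set Y) interior_of A \<and> A \<subseteq> U))"

definition homotopy_representatives :: "'a topology \<Rightarrow> 'b topology \<Rightarrow> ('a \<Rightarrow> 'b) set \<Rightarrow> bool"
  where "homotopy_representatives Y P H \<longleftrightarrow> countable H \<and>
    (\<forall>h\<in>H. continuous_map Y P h) \<and>
    (\<forall>f. continuous_map Y P f \<longrightarrow> (\<exists>!h. h \<in> H \<and> homotopic_with (\<lambda>_. True) Y P f h))"

definition finite_subcomplex_collection :: "'v set set \<Rightarrow> 'w set set set \<Rightarrow> bool"
  where "finite_subcomplex_collection K F \<longleftrightarrow> countable F \<and>
    (\<forall>N\<in>F. finite N \<and> abs_complex N \<and> (\<exists>L. subcomplex L K \<and> simplicially_isomorphic N L)) \<and>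
    (\<forall>L. subcomplex L K \<and> finite L \<longrightarrow> (\<exists>N\<in>F. simplicially_isomorphic L N))"


section \<open>Induced inverse sequences\<close>

text \<open>\<open>bond g s j\<close> is the composite \<open>g s \<circ> \<dots> \<circ> g (j - 1)\<close>, where \<open>g i\<close> goes from stage \<open>i + 1\<close> to
  stage \<open>i\<close>, and the identity if \<open>j = s\<close>.\<close>

primrec bond :: "(nat \<Rightarrow> 'a \<Rightarrow> 'a) \<Rightarrow> nat \<Rightarrow> nat \<Rightarrow> 'a \<Rightarrow> 'a"
  where
    "bond g s 0 = id"
  | "bond g s (Suc j) = (if s \<le> j then bond g s j \<circ> g j else id)"

definition inverse_limit :: "(nat \<Rightarrow> 'a topology) \<Rightarrow> (nat \<Rightarrow> 'a \<Rightarrow> 'a) \<Rightarrow> (nat \<Rightarrow> 'a) topology"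
  where "inverse_limit Y g =
    subtopology (product_topology Y UNIV) {a. \<forall>i. g i (a (Suc i)) = a i}"

text \<open>
  The fixed collections \<open>\<B>(Y)\<close>, \<open>\<H>(Y, |N|)\<close> and \<open>\<F>(K)\<close> are \<open>\<B> Y\<close>, \<open>\<H> Y N\<close> and \<open>\<F>\<close>, where \<open>Y\<close>
  ranges over the compacta in the Hilbert cube. \<open>Tt\<close> is \<open>\<T>\<close> with the tilde, and
  \<open>q j k : D j k \<rightarrow> |N j k|\<close> is the enumeration of \<open>\<Union>\<H>(D, |N|)\<close>.
\<close>

locale induced_inverse_sequence =
  fixes cw_type :: "'c itself"
    and X :: "'x topology"
    and e :: "'x \<Rightarrow> nat \<Rightarrow> real"
    and K :: "'v set set"
    and \<B> :: "(nat \<Rightarrow> real) set \<Rightarrow> (nat \<Rightarrow> real) set set"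
    and \<H> :: "(nat \<Rightarrow> real) set \<Rightarrow> 'w set set \<Rightarrow> ((nat \<Rightarrow> real) \<Rightarrow> 'w \<Rightarrow> real) set"
    and \<F> :: "'w set set set"
    and \<eta> :: "nat \<Rightarrow> nat \<times> nat"
    and n :: "nat \<Rightarrow> nat"
    and P :: "nat \<Rightarrow> (nat \<Rightarrow> real) set"
    and \<epsilon> :: "nat \<Rightarrow> real"
    and Tt :: "nat \<Rightarrow> (nat \<Rightarrow> real) set set"
    and f :: "nat \<Rightarrow> (nat \<Rightarrow> real) \<Rightarrow> nat \<Rightarrow> real"
    and \<delta> :: "nat \<Rightarrow> real"
    and T :: "nat \<Rightarrow> (nat \<Rightarrow> real) set set"
    and \<phi> :: "nat \<Rightarrow> (nat \<Rightarrow> real) \<Rightarrow> nat \<Rightarrow> real"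
    and g :: "nat \<Rightarrow> (nat \<Rightarrow> real) \<Rightarrow> nat \<Rightarrow> real"
    and D :: "nat \<Rightarrow> nat \<Rightarrow> (nat \<Rightarrow> real) set"
    and N :: "nat \<Rightarrow> nat \<Rightarrow> 'w set set"
    and q :: "nat \<Rightarrow> nat \<Rightarrow> (nat \<Rightarrow> real) \<Rightarrow> 'w \<Rightarrow> real"
  assumes embedding: "embedding_map X (top_of_set hcube) e"
    and K_complex: "abs_complex K"
    and K_nonempty: "K \<noteq> {}"
    and K_extdim: "is_extdim cw_type X (polyhedron_top K)"
    and \<B>: "\<And>Y. compact Y \<Longrightarrow> Y \<subseteq> hcube \<Longrightarrow> nbhd_collection Y (\<B> Y)"
    and \<H>: "\<And>Y M. compact Y \<Longrightarrow> Y \<subseteq> hcube \<Longrightarrow> finite M \<Longrightarrow> abs_complex M \<Longrightarrow>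
              homotopy_representatives (top_of_set Y) (polyhedron_top M) (\<H> Y M)"
    and \<F>: "finite_subcomplex_collection K \<F>"
    and \<eta>_bij: "bij \<eta>"
    and \<eta>_le: "\<And>j. fst (\<eta> j) \<le> j"
    and n_pos: "\<And>j. 0 < n j"
    and n_increasing: "strict_mono n"
    and P_sub: "\<And>j. P j \<subseteq> fcube (n j)"
    and P_nbhd: "\<And>j. e ` topspace X \<subseteq> (top_of_set hcube) interior_of {z \<in> hcube. hproj (n j) z \<in> P j}"
    and P_small: "\<And>j. (top_of_set hcube) interior_of {z \<in> hcube. hproj (n j) z \<in> P j}
                        \<subseteq> hnbhd (e ` topspace X) (2 / real (j + 1))"
    and P_proj: "\<And>j. hproj (n j) ` P (Suc j) \<subseteq> (top_of_set (fcube (n j))) interior_of P j"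
    and \<epsilon>_pos: "\<And>j. 0 < \<epsilon> j"
    and \<delta>_pos: "\<And>j. 0 < \<delta> j"
    and Tt_triangulates: "\<And>j. triangulates (Tt j) (P j)"
    and T_triangulates: "\<And>j. triangulates (T j) (P j)"
    and T_subdivision: "\<And>j. subdivision_of (T j) (Tt j)"
    and f_approx: "\<And>j. simplicial_approx (Tt (Suc j)) (T j) (hproj (n j)) (f j)"
    and \<phi>_approx: "\<And>j. simplicial_approx (T j) (Tt j) id (\<phi> j)"
    and g_eq: "\<And>j x. x \<in> polyhedron_of (T (Suc j)) \<Longrightarrow> g j x = f j (\<phi> (Suc j) x)"
    and q_enum: "\<And>j. range (\<lambda>k. (D j k, N j k, q j k))
                      = {(A, M, h). A \<in> \<B> (P j) \<and> M \<in> \<F> \<and> h \<in> \<H> A M}"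
    and cond1: "\<And>j s u v. s < j \<Longrightarrow> u \<in> hcube \<Longrightarrow> v \<in> hcube \<Longrightarrow> hdist u v < \<epsilon> j \<Longrightarrow>
                  hdist (hproj (n s) u) (hproj (n s) v) < \<delta> s"
    and cond2: "\<And>j. 5 / 2 ^ n j < \<epsilon> j"
    and cond3: "\<And>j. \<delta> j < 2 / 2 ^ n j"
    and cond4: "\<And>j. mesh (T j) < \<delta> j / 2"
    and cond5: "\<And>j s t A. \<eta> j = (s, t) \<Longrightarrow> A = {x \<in> polyhedron_of (T j). bond g s j x \<in> D s t} \<Longrightarrow>
                  \<exists>h. continuous_map (top_of_set (polyhedron_of (simplicial_nbhd A (T j))))
                         (polyhedron_top (N s t)) h \<and>
                      (\<forall>x\<in>A. h x = q s t (bond g s j x))"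
    and cond6: "\<And>j s t E. \<eta> j = (s, t) \<Longrightarrow>
                  E = simplicial_nbhd {x \<in> polyhedron_of (T j). bond g s j x \<in> D s t} (T j) \<Longrightarrow>
                  regular_nbhd (polyhedron_of (simplicial_nbhd (polyhedron_of E) (T j)))
                    (polyhedron_of E) (polyhedron_of (T j))"
    and cond7: "\<And>j x. x \<in> e ` topspace X \<Longrightarrow>
                  \<exists>v\<in>\<Union>(Tt j). hcball (hproj (n j) x) (2 * \<delta> j) \<inter> P j \<subseteq> closed_star v (Tt j) \<and>
                    closed_star v (Tt j) \<subseteq> hcball (hproj (n j) x) (\<epsilon> j) \<inter> P j"
    and cond8: "\<And>j s. s < j \<Longrightarrow> simplicial_approx (T j) (T s) (hproj (n s)) (bond g s j)"

end

theory Submission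
  imports Defs
begin

text \<open>
  Along a thread \<open>w\<close> the bonding maps differ from the projections by less than the mesh, so \<open>w\<close>
  converges and each \<open>w j\<close> stays close to the limit. Assumptions \<open>cond1\<close> and \<open>cond7\<close> then identify the
  fibre over \<open>x\<close> with the inverse limit of closed stars of vertices. A closed star contracts linearly to
  its vertex; after the bonding maps into the earlier stages have been extended over the cube by Tietze,
  this contraction at stage \<open>k\<close> becomes a homotopy of a whole product of cubes, which contracts the fibre
  inside any prescribed neighbourhood once \<open>k\<close> is large.

  A map \<open>A \<rightarrow> |K|\<close> on a closed subset of \<open>Z\<close> has image in a finite subcomplex and is homotopic to
  \<open>q s t\<close> composed with the projection to some stage \<open>s\<close>. At the stage \<open>j\<close> with \<open>\<eta> j = (s, t)\<close> this map
  extends over \<open>|E|\<close>. The extension, composed with \<open>hproj (n j)\<close>, extends further over \<open>X\<close>, because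
  \<open>X \<tau> |K|\<close>, hence over \<open>P k\<close> for some \<open>k > j\<close>. On \<open>A\<close> the bonding map from stage \<open>k\<close> to stage \<open>j\<close> is
  joined to \<open>hproj (n j)\<close> by segments in \<open>|E|\<close>, so the map obtained on \<open>Z\<close> restricts on \<open>A\<close> to a map
  homotopic to the given one, and homotopy extension finishes the proof of \<open>Z \<tau> |K|\<close>. Finally
  \<open>[|K|] \<le> [K\<^sub>0]\<close>.
\<close>

section \<open>Extension of maps into polyhedra\<close>

lemma continuous_map_euclidean_UNIV:
  fixes f :: "'a \<Rightarrow> 'v \<Rightarrow> 'b::topological_space"
  shows "continuous_map X euclidean f \<longleftrightarrow> (\<forall>v. continuous_map X euclidean (\<lambda>x. f x v))"
  unfolding continuous_map_componentwise_UNIV[symmetric] euclidean_product_topology ..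

lemma continuous_map_top_of_set_UNIV:
  fixes f :: "'a \<Rightarrow> 'v \<Rightarrow> 'b::topological_space"
  shows "continuous_map X (top_of_set S) f \<longleftrightarrow>
    (\<forall>v. continuous_map X euclidean (\<lambda>x. f x v)) \<and> f \<in> topspace X \<rightarrow> S"
  by (auto simp: continuous_map_in_subtopology continuous_map_euclidean_UNIV image_subset_iff_funcset)

lemma continuous_map_Max:
  fixes h :: "'i \<Rightarrow> 'a \<Rightarrow> real"
  assumes "finite I" "I \<noteq> {}" "\<And>i. i \<in> I \<Longrightarrow> continuous_map X euclideanreal (h i)"
  shows "continuous_map X euclideanreal (\<lambda>x. Max ((\<lambda>i. h i x) ` I))"
  using assms
proof (induction I rule: finite_ne_induct)
  case (insert i I)
  have "(\<lambda>x. Max ((\<lambda>i. h i x) ` insert i I)) = (\<lambda>x. max (h i x) (Max ((\<lambda>i. h i x) ` I)))"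
    using insert by auto
  with insert show ?case
    by (auto intro!: continuous_map_real_max)
qed auto

lemma continuous_map_Min:
  fixes h :: "'i \<Rightarrow> 'a \<Rightarrow> real"
  assumes "finite I" "I \<noteq> {}" "\<And>i. i \<in> I \<Longrightarrow> continuous_map X euclideanreal (h i)"
  shows "continuous_map X euclideanreal (\<lambda>x. Min ((\<lambda>i. h i x) ` I))"
  using assms
proof (induction I rule: finite_ne_induct)
  case (insert i I)
  have "(\<lambda>x. Min ((\<lambda>i. h i x) ` insert i I)) = (\<lambda>x. min (h i x) (Min ((\<lambda>i. h i x) ` I)))"
    using insert by auto
  with insert show ?case
    by (auto intro!: continuous_map_real_min)
qed auto

section \<open>Simplices and finite polyhedra in barycentric coordinates\<close>

definition bary_poly :: "'v set set \<Rightarrow> ('v \<Rightarrow> real) set"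
  where "bary_poly L = \<Union>(bary_simplex ` L)"

lemma bary_simplex_le_1:
  assumes "b \<in> bary_simplex \<sigma>" "finite \<sigma>"
  shows "0 \<le> b v" "b v \<le> 1"
proof -
  show "0 \<le> b v" using assms by (auto simp: bary_simplex_def)
  show "b v \<le> 1"
  proof (cases "v \<in> \<sigma>")
    case True
    have "b v \<le> sum b \<sigma>"
      by (rule member_le_sum) (use assms True in \<open>auto simp: bary_simplex_def\<close>)
    then show ?thesis using assms by (auto simp: bary_simplex_def)
  qed (use assms in \<open>auto simp: bary_simplex_def\<close>)
qed

lemma bary_simplex_mono:
  assumes "\<sigma> \<subseteq> \<tau>" "finite \<tau>"
  shows "bary_simplex \<sigma> \<subseteq> bary_simplex \<tau>"
proof
  fix b assume b: "b \<in> bary_simplex \<sigma>"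
  have "sum b \<tau> = sum b \<sigma>"
    by (rule sum.mono_neutral_right) (use assms b in \<open>auto simp: bary_simplex_def\<close>)
  with assms b show "b \<in> bary_simplex \<tau>"
    by (auto simp: bary_simplex_def)
qed

text \<open>Tychonoff's theorem for a cube with coordinates in an arbitrary type.\<close>

lemma compact_Pi_Icc: "compact {b :: 'v \<Rightarrow> real. \<forall>v. b v \<in> {l..u}}"
proof -
  have "compactin (product_topology (\<lambda>v::'v. euclideanreal) UNIV) (\<Pi>\<^sub>E v\<in>UNIV. {l..u})"
    by (subst compactin_PiE) auto
  then show ?thesis
    by (simp add: euclidean_product_topology PiE_UNIV_domain Pi_def)
qed

lemma closed_bary_simplex: "closed (bary_simplex (\<sigma> :: 'v set))"
proof -
  have *: "continuous_on UNIV (\<lambda>b :: 'v \<Rightarrow> real. b v)" for v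
    by (rule continuous_on_product_then_coordinatewise) (rule continuous_on_id)
  have **: "continuous_on UNIV (\<lambda>b :: 'v \<Rightarrow> real. sum b \<sigma>)"
    by (intro continuous_on_sum *)
  have "bary_simplex \<sigma> = (\<Inter>v. {b. 0 \<le> b v}) \<inter> (\<Inter>v\<in>-\<sigma>. {b. b v = 0}) \<inter> {b. sum b \<sigma> = 1}"
    by (auto simp: bary_simplex_def)
  then show ?thesis
    by (auto intro!: closed_Int closed_INT closed_Collect_le closed_Collect_eq * **)
qed

lemma compact_bary_simplex:
  assumes "finite \<sigma>"
  shows "compact (bary_simplex \<sigma>)"
proof -
  have "bary_simplex \<sigma> = {b. \<forall>v. b v \<in> {0..1}} \<inter> bary_simplex \<sigma>"
    using bary_simplex_le_1[OF _ assms] by auto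
  then show ?thesis
    using compact_Int_closed[OF compact_Pi_Icc closed_bary_simplex] by metis
qed

lemma abs_complex_finite: "abs_complex L \<Longrightarrow> \<sigma> \<in> L \<Longrightarrow> finite \<sigma>"
  by (simp add: abs_complex_def)

lemma abs_complex_face: "abs_complex L \<Longrightarrow> \<sigma> \<in> L \<Longrightarrow> \<tau> \<subseteq> \<sigma> \<Longrightarrow> \<tau> \<noteq> {} \<Longrightarrow> \<tau> \<in> L"
  unfolding abs_complex_def by blast

lemma bary_poly_le_1:
  assumes "b \<in> bary_poly L" "abs_complex L"
  shows "0 \<le> b v" "b v \<le> 1"
proof -
  obtain \<sigma> where "\<sigma> \<in> L" "b \<in> bary_simplex \<sigma>"
    using assms by (auto simp: bary_poly_def)
  then show "0 \<le> b v" "b v \<le> 1"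
    using bary_simplex_le_1 abs_complex_finite[OF assms(2)] by metis+
qed

lemma bary_poly_mono: "L \<subseteq> M \<Longrightarrow> bary_poly L \<subseteq> bary_poly M"
  by (auto simp: bary_poly_def)

lemma bary_poly_sum:
  assumes "b \<in> bary_poly L" "finite L" "abs_complex L"
  shows "sum b (\<Union>L) = 1"
proof -
  obtain \<sigma> where \<sigma>: "\<sigma> \<in> L" "b \<in> bary_simplex \<sigma>"
    using assms by (auto simp: bary_poly_def)
  have "b \<in> bary_simplex (\<Union>L)"
    using bary_simplex_mono[of \<sigma> "\<Union>L"] \<sigma> assms abs_complex_finite by blast
  then show ?thesis by (simp add: bary_simplex_def)
qed

text \<open>A finite polyhedron is an absolute neighbourhood extensor for normal spaces. Tietze
  extends each barycentric coordinate separately; the results need not sum to 1 or be supported on a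
  simplex, so they are truncated and normalised near \<open>A\<close>, which changes nothing on
  \<open>A\<close>.\<close>

lemma polyhedron_neighbourhood_extension:
  fixes L :: "'v set set" and f :: "'a \<Rightarrow> 'v \<Rightarrow> real"
  assumes Y: "normal_space Y" "closedin Y A" and L: "finite L" "abs_complex L"
    and f: "continuous_map (subtopology Y A) (top_of_set (bary_poly L)) f"
  obtains U F where "openin Y U" "A \<subseteq> U"
    "continuous_map (subtopology Y U) (top_of_set (bary_poly L)) F" "\<And>x. x \<in> A \<Longrightarrow> F x = f x"
proof -
  have A: "A \<subseteq> topspace Y" using Y(2) closedin_subset by blast
  have fim: "f x \<in> bary_poly L" if "x \<in> A" for x
    using f that A by (auto simp: continuous_map_top_of_set_UNIV)
  have "\<exists>G. continuous_map Y euclideanreal G \<and> (\<forall>x\<in>A. G x = f x v) \<and> G ` topspace Y \<subseteq> {0..1}" for v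
  proof -
    have "(\<lambda>x. f x v) ` A \<subseteq> {0..1}"
      using fim bary_poly_le_1[OF _ L(2)] by auto
    moreover have "continuous_map (subtopology Y A) euclideanreal (\<lambda>x. f x v)"
      using f by (auto simp: continuous_map_top_of_set_UNIV)
    ultimately show ?thesis
      using Tietze_extension_closed_real_interval[OF Y, of "\<lambda>x. f x v" 0 1]
      by (metis zero_less_one_class.zero_le_one)
  qed
  then obtain G where G: "\<And>v. continuous_map Y euclideanreal (G v)"
    "\<And>v x. x \<in> A \<Longrightarrow> G v x = f x v" "\<And>v. G v ` topspace Y \<subseteq> {0..1}"
    by metis
  define V where "V = \<Union>L"
  have finV: "finite V" using L abs_complex_finite by (auto simp: V_def)
  define NF where "NF = {\<tau>. \<tau> \<subseteq> V \<and> \<tau> \<noteq> {} \<and> \<tau> \<notin> L}"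
  have NF: "finite NF" unfolding NF_def using finV by auto
  \<comment> \<open>Subtracting \<open>c\<close> from all coordinates and truncating at \<open>0\<close> pushes a point off every nonface.\<close>
  define h where "h = (\<lambda>\<tau> x. if \<tau> = {} then 0 else Min ((\<lambda>v. G v x) ` \<tau>))"
  define c where "c = (\<lambda>x. Max ((\<lambda>\<tau>. h \<tau> x) ` insert {} NF))"
  have fin: "finite \<tau>" if "\<tau> \<in> NF" for \<tau>
    using that finV by (auto simp: NF_def intro: finite_subset)
  have conth: "continuous_map Y euclideanreal (h \<tau>)" if "\<tau> \<in> insert {} NF" for \<tau>
    unfolding h_def using that fin G(1) by (cases "\<tau> = {}") (auto intro!: continuous_map_Min)
  have contc: "continuous_map Y euclideanreal c"
    unfolding c_def using NF conth by (intro continuous_map_Max) auto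
  have c_ge: "h \<tau> x \<le> c x" if "\<tau> \<in> insert {} NF" for \<tau> x
    unfolding c_def using that NF by (intro Max_ge) auto
  \<comment> \<open>The empty set, with value 0, was added to the index set so that the maximum
    exists and is nonnegative even when there are no nonfaces.\<close>
  have c0: "0 \<le> c x" for x using c_ge[of "{}"] by (auto simp: h_def)
  have cA: "c x = 0" if x: "x \<in> A" for x
  proof -
    obtain \<rho> where \<rho>: "\<rho> \<in> L" "f x \<in> bary_simplex \<rho>"
      using fim[OF x] by (auto simp: bary_poly_def)
    have "h \<tau> x \<le> 0" if \<tau>: "\<tau> \<in> NF" for \<tau>
    proof -
      \<comment> \<open>A nonface is no subset of the simplex \<open>\<rho>\<close> carrying
        \<open>f x\<close>, so one of its coordinates vanishes there; hence nothing is subtracted on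
        \<open>A\<close>.\<close>
      have "\<not> \<tau> \<subseteq> \<rho>" using \<tau> \<rho> abs_complex_face[OF L(2)] by (auto simp: NF_def)
      then obtain v where v: "v \<in> \<tau>" "v \<notin> \<rho>" by auto
      have "Min ((\<lambda>v. G v x) ` \<tau>) \<le> G v x" using v fin[OF \<tau>] by auto
      also have "\<dots> = 0" using v \<rho> x G(2) by (auto simp: bary_simplex_def)
      finally show ?thesis by (auto simp: h_def)
    qed
    moreover have "h {} x = 0" by (simp add: h_def)
    ultimately have "c x \<le> 0"
      unfolding c_def using NF by auto
    with c0[of x] show ?thesis by simp
  qed
  define S where "S = (\<lambda>x. \<Sum>v\<in>V. max 0 (G v x - c x))"
  have contm: "continuous_map Y euclideanreal (\<lambda>x. max 0 (G v x - c x))" for v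
    by (intro continuous_map_real_max continuous_map_diff G contc) auto
  have contS: "continuous_map Y euclideanreal S"
    unfolding S_def by (intro continuous_map_sum contm finV)
  \<comment> \<open>Normalisation is possible exactly where some mass is left, that is, where
    \<open>S\<close> is positive; on \<open>A\<close> it is 1.\<close>
  define U where "U = {x \<in> topspace Y. S x \<in> {0<..}}"
  define F where "F = (\<lambda>x v. if v \<in> V then max 0 (G v x - c x) / S x else 0)"
  have SA: "S x = 1" if "x \<in> A" for x
  proof -
    have "S x = sum (f x) V"
      unfolding S_def using that cA G(2) bary_poly_le_1[OF fim L(2)] by (intro sum.cong) auto
    then show ?thesis using bary_poly_sum[OF fim L] that by (simp add: V_def)
  qed
  show ?thesis
  proof
    show "openin Y U"
      unfolding U_def by (rule openin_continuous_map_preimage[OF contS]) auto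
    show "A \<subseteq> U" using A SA by (auto simp: U_def)
    show "F x = f x" if "x \<in> A" for x
    proof
      fix v
      have "f x v = 0" if "v \<notin> V"
        using fim[OF \<open>x \<in> A\<close>] that by (auto simp: bary_poly_def bary_simplex_def V_def)
      then show "F x v = f x v"
        using that SA cA G(2) bary_poly_le_1[OF fim L(2)] by (auto simp: F_def)
    qed
    show "continuous_map (subtopology Y U) (top_of_set (bary_poly L)) F"
      unfolding continuous_map_top_of_set_UNIV
    proof (intro conjI allI)
      fix v
      show "continuous_map (subtopology Y U) euclidean (\<lambda>x. F x v)"
      proof (cases "v \<in> V")
        case True
        have "continuous_map (subtopology Y U) euclidean (\<lambda>x. max 0 (G v x - c x) / S x)"
          by (rule continuous_map_real_divide)
            (auto intro: continuous_map_from_subtopology contm contS simp: U_def)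
        with True show ?thesis by (simp add: F_def)
      qed (simp add: F_def)
    next
      show "F \<in> topspace (subtopology Y U) \<rightarrow> bary_poly L"
      proof
        fix x assume x: "x \<in> topspace (subtopology Y U)"
        then have S: "S x > 0" by (auto simp: U_def)
        define \<sigma> where "\<sigma> = {v \<in> V. G v x > c x}"
        have "\<sigma> \<noteq> {}"
        proof
          assume "\<sigma> = {}"
          then have "S x = 0" unfolding S_def \<sigma>_def by (intro sum.neutral) (auto simp: not_less)
          with S show False by simp
        qed
        have fin\<sigma>: "finite \<sigma>" using finV by (auto simp: \<sigma>_def)
        \<comment> \<open>If the coordinates exceeding \<open>c x\<close> formed a nonface, their
          minimum would exceed \<open>c x\<close>, although \<open>c x\<close> is the maximum of
          such minima.\<close>
        have "\<sigma> \<in> L"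
        proof (rule ccontr)
          assume "\<sigma> \<notin> L"
          then have NF\<sigma>: "\<sigma> \<in> NF" using \<open>\<sigma> \<noteq> {}\<close> by (auto simp: NF_def \<sigma>_def)
          have "Min ((\<lambda>v. G v x) ` \<sigma>) \<in> (\<lambda>v. G v x) ` \<sigma>"
            using fin\<sigma> \<open>\<sigma> \<noteq> {}\<close> by (intro Min_in) auto
          then have "Min ((\<lambda>v. G v x) ` \<sigma>) > c x" by (auto simp: \<sigma>_def)
          with c_ge[of \<sigma> x] NF\<sigma> \<open>\<sigma> \<noteq> {}\<close> show False by (auto simp: h_def)
        qed
        moreover have "F x \<in> bary_simplex \<sigma>"
        proof -
          have "sum (F x) \<sigma> = (\<Sum>v\<in>\<sigma>. max 0 (G v x - c x)) / S x"
            unfolding sum_divide_distrib by (intro sum.cong) (auto simp: F_def \<sigma>_def)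
          also have "(\<Sum>v\<in>\<sigma>. max 0 (G v x - c x)) = S x"
            unfolding S_def by (intro sum.mono_neutral_left finV) (auto simp: \<sigma>_def)
          finally show ?thesis
            using S by (auto simp: bary_simplex_def F_def \<sigma>_def)
        qed
        ultimately show "F x \<in> bary_poly L" by (auto simp: bary_poly_def)
      qed
    qed
  qed
qed

lemma continuous_map_glue_closed:
  assumes "closedin X S" "closedin X T" "topspace X \<subseteq> S \<union> T"
    and "continuous_map (subtopology X S) Y f" "continuous_map (subtopology X T) Y f"
  shows "continuous_map X Y f"
  by (rule pasting_lemma_closed[of "{S, T}" X "\<lambda>U. U" Y "\<lambda>_. f"]) (use assms in auto)

text \<open>The tube lemma: the complement is the projection of a closed set along a compact factor,
  hence closed.\<close>

lemma openin_tube: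
  assumes "compact_space I" "openin (prod_topology I X) W"
  shows "openin X {x \<in> topspace X. \<forall>t\<in>topspace I. (t, x) \<in> W}"
proof -
  have "closedin (prod_topology I X) (topspace (prod_topology I X) - W)"
    using assms(2) by blast
  then have "closedin X (snd ` (topspace (prod_topology I X) - W))"
    using closed_map_snd[OF assms(1), of X] unfolding closed_map_def by blast
  then have "openin X (topspace X - snd ` (topspace (prod_topology I X) - W))"
    by (rule openin_diff[OF openin_topspace])
  also have "topspace X - snd ` (topspace (prod_topology I X) - W)
      = {x \<in> topspace X. \<forall>t\<in>topspace I. (t, x) \<in> W}"
    by force
  finally show ?thesis .
qed

section \<open>The weak topology of a complex and its finite subcomplexes\<close>

lemma topspace_polyhedron_top [simp]: "topspace (polyhedron_top K) = bary_poly K"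
proof -
  have "openin (top_of_set (bary_simplex \<sigma>)) (bary_poly K \<inter> bary_simplex \<sigma>)" if "\<sigma> \<in> K" for \<sigma>
  proof -
    have "bary_poly K \<inter> bary_simplex \<sigma> = bary_simplex \<sigma>"
      using that by (auto simp: bary_poly_def)
    then show ?thesis by simp
  qed
  then have "openin (polyhedron_top K) (bary_poly K)"
    by (auto simp: openin_polyhedron_top bary_open_def bary_poly_def)
  then show ?thesis
    using openin_subset[of "polyhedron_top K" "topspace (polyhedron_top K)"] openin_subset
    by (metis bary_open_def bary_poly_def openin_polyhedron_top openin_topspace subset_antisym)
qed

text \<open>Closedness of the traces can be tested in the whole function space, since every simplex
  is closed there.\<close>

lemma closedin_polyhedron_top:
  "closedin (polyhedron_top K) C \<longleftrightarrow>
    C \<subseteq> bary_poly K \<and> (\<forall>\<sigma>\<in>K. closed (C \<inter> bary_simplex \<sigma>))"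
proof -
  have "openin (top_of_set (bary_simplex \<sigma>)) ((bary_poly K - C) \<inter> bary_simplex \<sigma>)
      \<longleftrightarrow> closed (C \<inter> bary_simplex \<sigma>)" if "\<sigma> \<in> K" for \<sigma>
  proof -
    have "(bary_poly K - C) \<inter> bary_simplex \<sigma> = bary_simplex \<sigma> - C \<inter> bary_simplex \<sigma>"
      using that by (auto simp: bary_poly_def)
    moreover have "closedin (top_of_set (bary_simplex \<sigma>)) (C \<inter> bary_simplex \<sigma>)
        \<longleftrightarrow> openin (top_of_set (bary_simplex \<sigma>)) (bary_simplex \<sigma> - C \<inter> bary_simplex \<sigma>)"
      by (auto simp: closedin_def)
    ultimately show ?thesis
      using closedin_closed_eq[OF closed_bary_simplex, of \<sigma> "C \<inter> bary_simplex \<sigma>"] by simp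
  qed
  then have "(\<forall>\<sigma>\<in>K. openin (top_of_set (bary_simplex \<sigma>)) ((bary_poly K - C) \<inter> bary_simplex \<sigma>))
      \<longleftrightarrow> (\<forall>\<sigma>\<in>K. closed (C \<inter> bary_simplex \<sigma>))"
    by blast
  then show ?thesis
    by (auto simp: closedin_def openin_polyhedron_top bary_open_def bary_poly_def)
qed

lemma finite_imp_closed_fun:
  fixes S :: "('v \<Rightarrow> real) set"
  assumes "finite S"
  shows "closed S"
proof -
  have *: "continuous_on UNIV (\<lambda>b :: 'v \<Rightarrow> real. b v)" for v
    by (rule continuous_on_product_then_coordinatewise) (rule continuous_on_id)
  have "closed {b}" for b :: "'v \<Rightarrow> real"
  proof -
    have "closed (\<Inter>v. {c. c v = b v})"
      by (intro closed_INT ballI closed_Collect_eq * continuous_on_const)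
    also have "(\<Inter>v. {c. c v = b v}) = {b}" by auto
    finally show ?thesis .
  qed
  then have "closed (\<Union>b\<in>S. {b})"
    using assms by (intro closed_UN) auto
  then show ?thesis by simp
qed

text \<open>A subset of a finite union of simplices is the finite union of its traces on them, so
  closed traces make it closed in the product topology.\<close>

lemma subtopology_polyhedron_top:
  assumes "abs_complex K" "subcomplex L K" "finite L"
  shows "subtopology (polyhedron_top K) (bary_poly L) = top_of_set (bary_poly L)"
proof -
  have LK: "L \<subseteq> K" and L: "abs_complex L" using assms by (auto simp: subcomplex_def)
  have cl: "closed (bary_poly L)" 
    unfolding bary_poly_def using assms(3) closed_bary_simplex by (intro closed_UN) auto
  have iff: "closedin (polyhedron_top K) C \<longleftrightarrow> closed C" if C: "C \<subseteq> bary_poly L" for C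
  proof
    assume "closedin (polyhedron_top K) C"
    then have "\<forall>\<sigma>\<in>L. closed (C \<inter> bary_simplex \<sigma>)"
      using LK by (auto simp: closedin_polyhedron_top)
    then have "closed (\<Union>\<sigma>\<in>L. C \<inter> bary_simplex \<sigma>)"
      using assms(3) by (intro closed_UN) auto
    also have "(\<Union>\<sigma>\<in>L. C \<inter> bary_simplex \<sigma>) = C"
      using C by (auto simp: bary_poly_def)
    finally show "closed C" .
  next
    assume "closed C"
    then show "closedin (polyhedron_top K) C"
      using C bary_poly_mono[OF LK] by (auto simp: closedin_polyhedron_top closed_bary_simplex)
  qed
  have "closedin (subtopology (polyhedron_top K) (bary_poly L)) C \<longleftrightarrow> closedin (top_of_set (bary_poly L)) C" for C
  proof -
    have "closedin (polyhedron_top K) (bary_poly L)" using iff[of "bary_poly L"] cl by simp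
    then show ?thesis
      using iff[of C] closedin_closed_eq[OF cl, of C]
      by (auto simp: closedin_closed_subtopology)
  qed
  moreover have "topspace (subtopology (polyhedron_top K) (bary_poly L)) = bary_poly L"
    using bary_poly_mono[OF LK] by auto
  ultimately show ?thesis
    unfolding topology_eq openin_closedin_eq by simp
qed

lemma polyhedron_top_finite:
  assumes "finite L" "abs_complex L"
  shows "polyhedron_top L = top_of_set (bary_poly L)"
  using subtopology_polyhedron_top[of L L] assms
  by (metis subcomplex_def subset_refl subtopology_topspace topspace_polyhedron_top)

lemma continuous_map_polyhedron_top_iff:
  assumes "abs_complex K" "subcomplex L K" "finite L"
  shows "continuous_map Y (top_of_set (bary_poly L)) f
    \<longleftrightarrow> continuous_map Y (polyhedron_top K) f \<and> f \<in> topspace Y \<rightarrow> bary_poly L"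
  unfolding subtopology_polyhedron_top[OF assms, symmetric]
  by (auto simp: continuous_map_in_subtopology image_subset_iff_funcset)

text \<open>Choosing one point of \<open>C\<close> for each support that occurs yields a closed discrete subset of \<open>C\<close>.\<close>

lemma compactin_polyhedron_top_imp_finite:
  assumes K: "abs_complex K" and C: "compactin (polyhedron_top K) C"
  obtains L where "finite L" "subcomplex L K" "C \<subseteq> bary_poly L"
proof -
  define supp where "supp = (\<lambda>b :: 'a \<Rightarrow> real. {v. b v \<noteq> 0})"
  have CK: "C \<subseteq> bary_poly K" using compactin_subset_topspace[OF C] by simp
  have supp_sub: "supp b \<subseteq> \<sigma>" if "b \<in> bary_simplex \<sigma>" for b \<sigma>
    using that by (auto simp: supp_def bary_simplex_def)
  have supp: "supp b \<in> K \<and> b \<in> bary_simplex (supp b)" if "b \<in> bary_poly K" for b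
  proof -
    obtain \<sigma> where \<sigma>: "\<sigma> \<in> K" "b \<in> bary_simplex \<sigma>" using \<open>b \<in> bary_poly K\<close> by (auto simp: bary_poly_def)
    have "sum b (supp b) = sum b \<sigma>"
      using supp_sub[OF \<sigma>(2)] abs_complex_finite[OF K \<sigma>(1)]
      by (intro sum.mono_neutral_left) (auto simp: supp_def)
    then have s1: "sum b (supp b) = 1" using \<sigma> by (simp add: bary_simplex_def)
    then have "supp b \<noteq> {}" by auto
    then show ?thesis
      using abs_complex_face[OF K \<sigma>(1) supp_sub[OF \<sigma>(2)]] \<sigma>(2) s1
      by (auto simp: bary_simplex_def supp_def)
  qed
  have "\<forall>s\<in>supp ` C. \<exists>b. b \<in> C \<and> supp b = s" by blast
  from bchoice[OF this] obtain pt where pt_all: "\<forall>s\<in>supp ` C. pt s \<in> C \<and> supp (pt s) = s" ..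
  have pt: "pt s \<in> C \<and> supp (pt s) = s" if "s \<in> supp ` C" for s
    using pt_all that by (rule bspec)
  define P where "P = pt ` supp ` C"
  have PC: "P \<subseteq> C" using pt by (auto simp: P_def)
  \<comment> \<open>A simplex contains only chosen points whose support is one of its finitely many
    faces, so it meets any subset of \<open>P\<close> in a finite set.\<close>
  have clo: "closedin (polyhedron_top K) P'" if P': "P' \<subseteq> P" for P'
    unfolding closedin_polyhedron_top
  proof (intro conjI ballI)
    show "P' \<subseteq> bary_poly K" using P' PC CK by auto
    fix \<sigma> assume \<sigma>: "\<sigma> \<in> K"
    have "P' \<inter> bary_simplex \<sigma> \<subseteq> pt ` Pow \<sigma>"
    proof
      fix b assume b: "b \<in> P' \<inter> bary_simplex \<sigma>"
      then obtain s where "b = pt s" "s \<in> supp ` C" using P' by (auto simp: P_def)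
      with pt[of s] supp_sub[of b \<sigma>] b show "b \<in> pt ` Pow \<sigma>" by auto
    qed
    then have "finite (P' \<inter> bary_simplex \<sigma>)"
      using abs_complex_finite[OF K \<sigma>] by (meson finite_Pow_iff finite_imageI finite_subset)
    then show "closed (P' \<inter> bary_simplex \<sigma>)" by (rule finite_imp_closed_fun)
  qed
  have "compactin (polyhedron_top K) P"
    using closed_compactin[OF C PC clo] by simp
  \<comment> \<open>Since all subsets of \<open>P\<close> are closed, \<open>P\<close> is discrete;
    being compact as well, it is finite, and so is the set of supports.\<close>
  moreover have "subtopology (polyhedron_top K) P = discrete_topology P"
  proof -
    have "topspace (subtopology (polyhedron_top K) P) = P" using PC CK by auto
    moreover have "openin (subtopology (polyhedron_top K) P) {x}" if "x \<in> P" for x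
    proof -
      have "closedin (subtopology (polyhedron_top K) P) (P - {x})"
        by (rule closedin_subset_topspace[OF clo]) auto
      then have "openin (subtopology (polyhedron_top K) P) (P - (P - {x}))"
        using \<open>topspace (subtopology (polyhedron_top K) P) = P\<close> by (metis openin_diff openin_topspace)
      moreover have "P - (P - {x}) = {x}" using that by auto
      ultimately show ?thesis by simp
    qed
    ultimately show ?thesis using discrete_topology_unique by metis
  qed
  ultimately have "finite P"
    by (metis compact_space_subtopology compact_space_discrete_topology)
  moreover have "supp ` C \<subseteq> supp ` P"
    using pt by (auto simp: P_def image_iff)
  ultimately have fin: "finite (supp ` C)" by (meson finite_imageI finite_subset)
  define L where "L = {\<tau>. \<tau> \<noteq> {} \<and> (\<exists>\<sigma>\<in>supp ` C. \<tau> \<subseteq> \<sigma>)}"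
  have suppC: "\<sigma> \<in> K" if "\<sigma> \<in> supp ` C" for \<sigma> using that supp CK by auto
  have LK: "L \<subseteq> K" using abs_complex_face[OF K suppC] by (auto simp: L_def)
  show ?thesis
  proof
    have "finite (\<Union>(supp ` C))"
      using fin abs_complex_finite[OF K suppC] by auto
    moreover have "L \<subseteq> Pow (\<Union>(supp ` C))" by (auto simp: L_def)
    ultimately show "finite L" by (meson finite_Pow_iff finite_subset)
    have "abs_complex L"
      unfolding abs_complex_def
    proof (intro ballI conjI allI impI)
      fix \<sigma> assume \<sigma>: "\<sigma> \<in> L"
      then show "finite \<sigma>" using LK abs_complex_finite[OF K] by blast
      from \<sigma> show "\<sigma> \<noteq> {}" by (simp add: L_def)
      fix \<tau> assume "\<tau> \<subseteq> \<sigma> \<and> \<tau> \<noteq> {}"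
      with \<sigma> show "\<tau> \<in> L" unfolding L_def by blast
    qed
    then show "subcomplex L K" using LK by (simp add: subcomplex_def)
    show "C \<subseteq> bary_poly L"
    proof
      fix b assume b: "b \<in> C"
      with supp[of b] CK have "supp b \<in> K" "b \<in> bary_simplex (supp b)" by auto
      moreover from this(1) have "supp b \<noteq> {}" using K by (auto simp: abs_complex_def)
      ultimately show "b \<in> bary_poly L" using b by (auto simp: bary_poly_def L_def)
    qed
  qed
qed

text \<open>Barycentric coordinates are carried along the vertex bijection and back. The left
  inverse recovers a map into \<open>|L|\<close> from its composite into \<open>|M|\<close>.\<close>

lemma simplicially_isomorphic_maps:
  assumes "simplicially_isomorphic L M"
  obtains i j where
    "continuous_map (top_of_set (bary_poly L)) (top_of_set (bary_poly M)) i"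
    "continuous_map (top_of_set (bary_poly M)) (top_of_set (bary_poly L)) j"
    "\<And>b. b \<in> bary_poly L \<Longrightarrow> j (i b) = b"
proof -
  obtain h where h: "inj_on h (\<Union>L)" and M: "M = (\<lambda>\<sigma>. h ` \<sigma>) ` L"
    using assms by (auto simp: simplicially_isomorphic_def)
  define i where "i = (\<lambda>b :: 'a \<Rightarrow> real. \<lambda>w. if w \<in> h ` \<Union>L then b (inv_into (\<Union>L) h w) else 0)"
  define j where "j = (\<lambda>c :: 'b \<Rightarrow> real. \<lambda>v. if v \<in> \<Union>L then c (h v) else 0)"
  have inv: "inv_into (\<Union>L) h (h v) = v" if "v \<in> \<sigma>" "\<sigma> \<in> L" for v \<sigma>
    by (rule inv_into_f_f[OF h]) (use that in blast)
  have i_mem: "i b \<in> bary_simplex (h ` \<sigma>)" if b: "b \<in> bary_simplex \<sigma>" and \<sigma>: "\<sigma> \<in> L" for b \<sigma>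
  proof -
    have inj: "inj_on h \<sigma>" using h \<sigma> by (meson Union_upper inj_on_subset)
    have ib: "i b (h v) = b v" if "v \<in> \<tau>" "\<tau> \<in> L" for v \<tau>
      using inv[OF that] that by (auto simp: i_def)
    have "sum (i b) (h ` \<sigma>) = sum b \<sigma>"
      unfolding sum.reindex[OF inj] by (rule sum.cong) (use ib \<sigma> in auto)
    moreover have "i b w = 0" if "w \<notin> h ` \<sigma>" for w
    proof (cases "w \<in> h ` \<Union>L")
      case True
      then obtain v \<tau> where "w = h v" "v \<in> \<tau>" "\<tau> \<in> L" by auto
      with ib that b show ?thesis by (auto simp: bary_simplex_def)
    qed (auto simp: i_def)
    ultimately show ?thesis using b by (auto simp: bary_simplex_def i_def)
  qed
  have j_mem: "j c \<in> bary_simplex \<sigma>" if c: "c \<in> bary_simplex (h ` \<sigma>)" and \<sigma>: "\<sigma> \<in> L" for c \<sigma>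
  proof -
    have inj: "inj_on h \<sigma>" using h \<sigma> by (meson Union_upper inj_on_subset)
    have "sum (j c) \<sigma> = sum c (h ` \<sigma>)"
      unfolding sum.reindex[OF inj] by (rule sum.cong) (use \<sigma> in \<open>auto simp: j_def\<close>)
    moreover have "j c v = 0" if "v \<notin> \<sigma>" for v
    proof (cases "v \<in> \<Union>L")
      case True
      then have "h v \<notin> h ` \<sigma>" using that \<sigma> h unfolding inj_on_def by blast
      with c show ?thesis by (auto simp: bary_simplex_def j_def)
    qed (simp add: j_def)
    ultimately show ?thesis using c by (auto simp: bary_simplex_def j_def)
  qed
  have coord: "continuous_map (top_of_set S) euclidean (\<lambda>b. b v)" for v and S :: "('c \<Rightarrow> real) set"
    using continuous_on_product_then_coordinatewise[of S "\<lambda>b. b" v] by simp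
  show ?thesis
  proof
    show "continuous_map (top_of_set (bary_poly L)) (top_of_set (bary_poly M)) i"
      unfolding continuous_map_top_of_set_UNIV
    proof (intro conjI allI)
      show "continuous_map (top_of_set (bary_poly L)) euclidean (\<lambda>x. i x v)" for v
        by (cases "v \<in> h ` \<Union>L") (simp_all add: i_def coord del: continuous_map_iff_continuous continuous_map_iff_continuous2)
      show "i \<in> topspace (top_of_set (bary_poly L)) \<rightarrow> bary_poly M"
        using i_mem by (auto simp: bary_poly_def M)
    qed
    show "continuous_map (top_of_set (bary_poly M)) (top_of_set (bary_poly L)) j"
      unfolding continuous_map_top_of_set_UNIV
    proof (intro conjI allI)
      show "continuous_map (top_of_set (bary_poly M)) euclidean (\<lambda>x. j x v)" for v
        by (cases "v \<in> \<Union>L") (simp_all add: j_def coord del: continuous_map_iff_continuous continuous_map_iff_continuous2)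
      show "j \<in> topspace (top_of_set (bary_poly M)) \<rightarrow> bary_poly L"
        using j_mem by (auto simp: bary_poly_def M)
    qed
    show "j (i b) = b" if "b \<in> bary_poly L" for b
    proof
      fix v
      show "j (i b) v = b v"
      proof (cases "v \<in> \<Union>L")
        case True
        then show ?thesis using inv by (auto simp: j_def i_def)
      next
        case False
        then show ?thesis using that by (auto simp: j_def bary_poly_def bary_simplex_def)
      qed
    qed
  qed
qed

text \<open>Borsuk's homotopy extension theorem. A map on
  \<open>{0} \<times> Z \<union> I \<times> A\<close> extends to a neighbourhood of that set, which
  contains the graph of a Urysohn function that is 1 on \<open>A\<close> and 0 outside a
  neighbourhood of \<open>A\<close>; on the graph the extension is the required map.\<close>

lemma polyhedron_homotopy_extension:
  fixes L :: "'v set set" and F G :: "'a \<Rightarrow> 'v \<Rightarrow> real"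
  assumes Z: "compact_space Z" "Hausdorff_space Z" "closedin Z A" and L: "finite L" "abs_complex L"
    and G: "continuous_map Z (top_of_set (bary_poly L)) G"
    and hom: "homotopic_with (\<lambda>_. True) (subtopology Z A) (top_of_set (bary_poly L)) G F"
  obtains F' where "continuous_map Z (top_of_set (bary_poly L)) F'" "\<And>x. x \<in> A \<Longrightarrow> F' x = F x"
proof -
  let ?I = "top_of_set {0..1::real}"
  let ?P = "prod_topology ?I Z"
  let ?L = "top_of_set (bary_poly L)"
  have A: "A \<subseteq> topspace Z" using Z(3) closedin_subset by blast
  have I: "compact_space ?I" "Hausdorff_space ?I" 
    by (auto simp: compact_space_subtopology Hausdorff_space_subtopology)
  have "compact_space ?P" "Hausdorff_space ?P"
    using Z I by (simp_all add: compact_space_prod_topology Hausdorff_space_prod_topology)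
  then have norm: "normal_space ?P"
    by (simp add: compact_Hausdorff_or_regular_imp_normal_space)
  obtain h where h: "continuous_map (prod_topology ?I (subtopology Z A)) ?L h"
    "\<And>x. h (0, x) = G x" "\<And>x. h (1, x) = F x"
    using hom unfolding homotopic_with_def by blast
  define W where "W = (\<lambda>(t, x). if x \<in> A then h (t, x) else G x)"
  define B1 where "B1 = {0::real} \<times> topspace Z"
  define B2 where "B2 = {0..1::real} \<times> A"
  have cB: "closedin ?P B1" "closedin ?P B2"
    unfolding B1_def B2_def using Z(3) by (auto simp: closedin_prod_Times_iff closed_subset)
  have "continuous_map (subtopology ?P B1) ?L (G \<circ> snd)"
    by (rule continuous_map_compose[OF continuous_map_from_subtopology[OF continuous_map_snd] G])
  then have W1: "continuous_map (subtopology ?P B1) ?L W"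
    by (rule continuous_map_eq) (auto simp: W_def B1_def h)
  have P2: "subtopology ?P B2 = prod_topology ?I (subtopology Z A)"
    unfolding B2_def by (simp add: prod_topology_subtopology subtopology_subtopology)
  have W2: "continuous_map (subtopology ?P B2) ?L W"
    unfolding P2 by (rule continuous_map_eq[OF h(1)]) (auto simp: W_def)
  have s: "subtopology (subtopology ?P (B1 \<union> B2)) B1 = subtopology ?P B1"
    "subtopology (subtopology ?P (B1 \<union> B2)) B2 = subtopology ?P B2"
    by (simp_all add: subtopology_subtopology Int_absorb1)
  have W: "continuous_map (subtopology ?P (B1 \<union> B2)) ?L W"
  proof (rule continuous_map_glue_closed)
    show "closedin (subtopology ?P (B1 \<union> B2)) B1"
      by (rule closedin_subset_topspace[OF cB(1)]) simp
    show "closedin (subtopology ?P (B1 \<union> B2)) B2"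
      by (rule closedin_subset_topspace[OF cB(2)]) simp
    show "topspace (subtopology ?P (B1 \<union> B2)) \<subseteq> B1 \<union> B2" by simp
  qed (unfold s, fact W1, fact W2)
  have cB12: "closedin ?P (B1 \<union> B2)" using cB by (rule closedin_Un)
  then obtain U \<Phi> where U: "openin ?P U" "B1 \<union> B2 \<subseteq> U" "continuous_map (subtopology ?P U) ?L \<Phi>"
    "\<And>p. p \<in> B1 \<union> B2 \<Longrightarrow> \<Phi> p = W p"
    using polyhedron_neighbourhood_extension[OF norm cB12 L W] by metis
  \<comment> \<open>By compactness of the interval, the whole segment over each point of a
    neighbourhood of \<open>A\<close> lies in \<open>U\<close>.\<close>
  define V where "V = {x \<in> topspace Z. \<forall>t\<in>topspace ?I. (t, x) \<in> U}"
  have V: "openin Z V" unfolding V_def by (rule openin_tube[OF I(1) U(1)])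
  have AV: "A \<subseteq> V" using A U(2) by (auto simp: V_def B2_def)
  have "normal_space Z" using Z by (simp add: compact_Hausdorff_or_regular_imp_normal_space)
  then obtain u where u: "continuous_map Z (top_of_set {0..1::real}) u"
    "u ` (topspace Z - V) \<subseteq> {0}" "u ` A \<subseteq> {1}"
    by (rule Urysohn_lemma[of Z "topspace Z - V" A 0 1]) (use V AV Z in \<open>auto simp: disjnt_def\<close>)
  define F' where "F' = \<Phi> \<circ> (\<lambda>x. (u x, x))"
  have uim: "u x \<in> {0..1}" if "x \<in> topspace Z" for x
    using continuous_map_image_subset_topspace[OF u(1)] that by auto
  \<comment> \<open>Off \<open>V\<close> the graph lies in the bottom \<open>B1\<close>, over
    \<open>V\<close> in the tube.\<close>
  have mem: "(u x, x) \<in> U" if x: "x \<in> topspace Z" for x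
  proof (cases "x \<in> V")
    case True
    then show ?thesis using uim[OF x] by (auto simp: V_def)
  next
    case False
    then have "u x = 0" using u(2) x by auto
    then show ?thesis using U(2) x by (auto simp: B1_def)
  qed
  show ?thesis
  proof
    have "continuous_map Z (subtopology ?P U) (\<lambda>x. (u x, x))"
      by (rule continuous_map_into_subtopology) (auto intro: continuous_map_pairedI u mem)
    then show "continuous_map Z ?L F'"
      unfolding F'_def by (rule continuous_map_compose[OF _ U(3)])
    show "F' x = F x" if "x \<in> A" for x
    proof -
      have "u x = 1" using u(3) that by auto
      moreover have "(1, x) \<in> B2" using that by (auto simp: B2_def)
      ultimately show ?thesis using U(4)[of "(1, x)"] that by (auto simp: F'_def W_def h)
    qed
  qed
qed

section \<open>Geometry of the Hilbert cube\<close>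

lemma tendsto_fun_iff:
  fixes l :: "'i \<Rightarrow> 'b::topological_space"
  shows "(f \<longlongrightarrow> l) F \<longleftrightarrow> (\<forall>i. ((\<lambda>x. f x i) \<longlongrightarrow> l i) F)"
proof -
  have "(f \<longlongrightarrow> l) F \<longleftrightarrow> limitin (product_topology (\<lambda>i. euclidean) UNIV) f l F"
    unfolding euclidean_product_topology by simp
  then show ?thesis
    by (simp add: limitin_componentwise)
qed

lemma continuous_on_fun_iff:
  fixes f :: "'a::topological_space \<Rightarrow> 'i \<Rightarrow> 'b::topological_space"
  shows "continuous_on S f \<longleftrightarrow> (\<forall>i. continuous_on S (\<lambda>x. f x i))"
  by (intro iffI allI)
    (erule continuous_on_product_then_coordinatewise,
      rule continuous_on_coordinatewise_then_product, erule spec)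

lemma continuous_on_apply: "continuous_on S (\<lambda>x :: 'i \<Rightarrow> 'b::topological_space. x i)"
  by (rule continuous_on_product_then_coordinatewise) (rule continuous_on_id)

lemma sum_fun_apply: "(\<Sum>v\<in>A. (f v :: 'i \<Rightarrow> 'b::comm_monoid_add)) i = (\<Sum>v\<in>A. f v i)"
  by (induction A rule: infinite_finite_induct) auto

definition lerp :: "real \<Rightarrow> ('i \<Rightarrow> real) \<Rightarrow> ('i \<Rightarrow> real) \<Rightarrow> 'i \<Rightarrow> real"
  where "lerp t x y = (\<lambda>i. (1 - t) * x i + t * y i)"

lemma lerp_0 [simp]: "lerp 0 x y = x" and lerp_1 [simp]: "lerp 1 x y = y"
  and lerp_same [simp]: "lerp t x x = x"
  by (auto simp: lerp_def fun_eq_iff algebra_simps)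

lemma lerp_convex:
  assumes "convex S" "x \<in> S" "y \<in> S" "0 \<le> t" "t \<le> 1"
  shows "lerp t x y \<in> S"
proof -
  have "(1 - t) *\<^sub>R x + t *\<^sub>R y \<in> S"
    using assms by (intro convexD) auto
  also have "(1 - t) *\<^sub>R x + t *\<^sub>R y = lerp t x y"
    by (simp add: lerp_def fun_eq_iff scaleR_fun_def)
  finally show ?thesis .
qed

lemma continuous_on_lerp:
  assumes "continuous_on S a" "continuous_on S f" "continuous_on S g"
  shows "continuous_on S (\<lambda>x. lerp (a x) (f x) (g x))"
  using assms unfolding lerp_def continuous_on_fun_iff
  by (auto intro!: continuous_intros)

section \<open>The Hilbert cube and its metric\<close>

lemma hcube_eq: "hcube = {x. \<forall>i. x i \<in> {0..1}}"
  by (auto simp: hcube_def)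

lemma compact_hcube: "compact hcube"
  unfolding hcube_eq by (rule compact_Pi_Icc)

lemma closed_hcube: "closed hcube"
  by (rule compact_imp_closed[OF compact_hcube])

lemma convex_hcube: "convex hcube"
  unfolding convex_def
proof (intro ballI allI impI)
  fix x y and u v :: real
  assume a: "x \<in> hcube" "y \<in> hcube" "0 \<le> u" "0 \<le> v" "u + v = 1"
  have "u * x i + v * y i \<le> 1" for i
    using a by (intro convex_bound_le) (auto simp: hcube_def)
  then show "u *\<^sub>R x + v *\<^sub>R y \<in> hcube"
    using a by (auto simp: hcube_def scaleR_fun_def)
qed

text \<open>Tietze's theorem in each coordinate.\<close>

lemma hcube_Tietze:
  assumes "normal_space Y" "closedin Y A" "continuous_map (subtopology Y A) (top_of_set hcube) f"
  obtains F where "continuous_map Y (top_of_set hcube) F" "\<And>x. x \<in> A \<Longrightarrow> F x = f x"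
proof -
  have A: "A \<subseteq> topspace Y" using assms(2) closedin_subset by blast
  have f: "continuous_map (subtopology Y A) euclideanreal (\<lambda>x. f x i)" for i
    using assms(3) by (simp add: continuous_map_top_of_set_UNIV)
  have "f x \<in> hcube" if "x \<in> A" for x
    using assms(3) that A by (auto simp: continuous_map_top_of_set_UNIV)
  then have im: "(\<lambda>x. f x i) ` A \<subseteq> {0..1}" for i
    by (auto simp: hcube_def)
  have "\<exists>G. continuous_map Y euclideanreal G \<and> (\<forall>x\<in>A. G x = f x i) \<and> G ` topspace Y \<subseteq> {0..1}" for i
    using Tietze_extension_closed_real_interval[OF assms(1,2) f im] by (metis zero_less_one_class.zero_le_one)
  then obtain G where G: "\<And>i. continuous_map Y euclideanreal (G i)"
    "\<And>i x. x \<in> A \<Longrightarrow> G i x = f x i" "\<And>i. G i ` topspace Y \<subseteq> {0..1}"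
    by metis
  show ?thesis
  proof
    show "continuous_map Y (top_of_set hcube) (\<lambda>x i. G i x)"
      using G(1,3) by (fastforce simp: continuous_map_top_of_set_UNIV hcube_def image_subset_iff)
  qed (use G in auto)
qed

lemma summable_half_powers: "summable (\<lambda>i. 1 / 2 ^ Suc i :: real)"
  using power_half_series by (auto simp: sums_iff power_divide)

text \<open>Bounds how far a point of the cube moves when its coordinates from \<open>n\<close> on
  are changed; \<open>n = 0\<close> bounds the metric by 1.\<close>

lemma suminf_half_powers_tail: "(\<Sum>i. if i < n then 0 else 1 / 2 ^ Suc i :: real) = 1 / 2 ^ n"
proof -
  have s: "summable (\<lambda>i. if i < n then 0 else 1 / 2 ^ Suc i :: real)"
    by (rule summable_comparison_test[OF _ summable_half_powers]) auto
  have "(\<lambda>i. (1 / 2) ^ n * (1 / 2) ^ Suc i :: real) sums ((1 / 2) ^ n * 1)"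
    by (intro sums_mult power_half_series)
  also have "(\<lambda>i. (1 / 2) ^ n * (1 / 2) ^ Suc i :: real) = (\<lambda>i. if i + n < n then 0 else 1 / 2 ^ Suc (i + n))"
    by (auto simp: power_add power_divide)
  finally have "(\<Sum>i. if i + n < n then 0 else 1 / 2 ^ Suc (i + n) :: real) = 1 / 2 ^ n"
    by (simp add: sums_iff power_divide)
  moreover have "(\<Sum>i<n. if i < n then 0 else 1 / 2 ^ Suc i :: real) = 0"
    by (intro sum.neutral) auto
  ultimately show ?thesis
    using suminf_split_initial_segment[OF s, of n] by simp
qed

lemma hdist_term_le:
  assumes "x \<in> hcube" "y \<in> hcube"
  shows "\<bar>x i - y i\<bar> / 2 ^ Suc i \<le> 1 / 2 ^ Suc i"
proof -
  have "0 \<le> x i" "x i \<le> 1" "0 \<le> y i" "y i \<le> 1" using assms by (auto simp: hcube_def)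
  then have "\<bar>x i - y i\<bar> \<le> 1" by linarith
  then show ?thesis by (intro divide_right_mono) auto
qed

lemma hdist_summable:
  assumes "x \<in> hcube" "y \<in> hcube"
  shows "summable (\<lambda>i. \<bar>x i - y i\<bar> / 2 ^ Suc i)"
  by (rule summable_comparison_test'[OF summable_half_powers, of 0])
    (use hdist_term_le[OF assms] in auto)

lemma hdist_nonneg: "x \<in> hcube \<Longrightarrow> y \<in> hcube \<Longrightarrow> 0 \<le> hdist x y"
  unfolding hdist_def by (intro suminf_nonneg hdist_summable) auto

lemma hdist_commute: "hdist x y = hdist y x"
  by (simp add: hdist_def abs_minus_commute)

lemma hdist_le_1:
  assumes "x \<in> hcube" "y \<in> hcube"
  shows "hdist x y \<le> 1"
proof -
  have "hdist x y \<le> (\<Sum>i. 1 / 2 ^ Suc i)"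
    unfolding hdist_def
    by (intro suminf_le hdist_term_le assms hdist_summable summable_half_powers)
  also have "\<dots> = 1" using suminf_half_powers_tail[of 0] by simp
  finally show ?thesis .
qed

lemma hdist_triangle:
  assumes "x \<in> hcube" "y \<in> hcube" "z \<in> hcube"
  shows "hdist x z \<le> hdist x y + hdist y z"
proof -
  have "hdist x z \<le> (\<Sum>i. \<bar>x i - y i\<bar> / 2 ^ Suc i + \<bar>y i - z i\<bar> / 2 ^ Suc i)"
    unfolding hdist_def
  proof (intro suminf_le hdist_summable summable_add assms)
    fix i
    show "\<bar>x i - z i\<bar> / 2 ^ Suc i \<le> \<bar>x i - y i\<bar> / 2 ^ Suc i + \<bar>y i - z i\<bar> / 2 ^ Suc i"
      unfolding add_divide_distrib[symmetric] by (intro divide_right_mono) auto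
  qed
  also have "\<dots> = hdist x y + hdist y z"
    unfolding hdist_def by (intro suminf_add[symmetric] hdist_summable assms)
  finally show ?thesis .
qed

lemma coord_le_hdist:
  assumes "x \<in> hcube" "y \<in> hcube"
  shows "\<bar>x i - y i\<bar> \<le> 2 ^ Suc i * hdist x y"
proof -
  have "(\<Sum>i\<in>{i}. \<bar>x i - y i\<bar> / 2 ^ Suc i) \<le> hdist x y"
    unfolding hdist_def by (rule sum_le_suminf[OF hdist_summable[OF assms]]) auto
  then show ?thesis by (simp add: field_simps)
qed

text \<open>A form of lower semicontinuity: finite partial sums are continuous and at most the
  distance, so the bound passes to the limit in each of them.\<close>

lemma hdist_le_limit:
  assumes "\<And>k. a k \<in> hcube" "b \<in> hcube" "a \<longlonglongrightarrow> x" "x \<in> hcube" "\<And>k. k \<ge> m \<Longrightarrow> hdist b (a k) \<le> r"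
  shows "hdist b x \<le> r"
  unfolding hdist_def
proof (rule suminf_le_const[OF hdist_summable[OF assms(2,4)]])
  fix M
  have "(\<lambda>k. \<Sum>i<M. \<bar>b i - a k i\<bar> / 2 ^ Suc i) \<longlonglongrightarrow> (\<Sum>i<M. \<bar>b i - x i\<bar> / 2 ^ Suc i)"
    using assms(3) by (intro tendsto_intros) (auto simp: tendsto_fun_iff)
  moreover have "\<forall>\<^sub>F k in sequentially. (\<Sum>i<M. \<bar>b i - a k i\<bar> / 2 ^ Suc i) \<le> r"
  proof (rule eventually_sequentiallyI[of m])
    fix k assume "m \<le> k"
    have "(\<Sum>i<M. \<bar>b i - a k i\<bar> / 2 ^ Suc i) \<le> hdist b (a k)"
      unfolding hdist_def by (intro sum_le_suminf hdist_summable assms) auto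
    with assms(5)[OF \<open>m \<le> k\<close>] show "(\<Sum>i<M. \<bar>b i - a k i\<bar> / 2 ^ Suc i) \<le> r" by simp
  qed
  ultimately show "(\<Sum>i<M. \<bar>b i - x i\<bar> / 2 ^ Suc i) \<le> r"
    by (rule tendsto_upperbound) simp
qed

text \<open>Passes from the metric to the product topology, in which limits are taken: each
  coordinate difference is at most a constant times the distance.\<close>

lemma hdist_tendsto_0_imp:
  assumes "\<And>k. a k \<in> hcube" "\<And>k. b k \<in> hcube" "(\<lambda>k. hdist (a k) (b k)) \<longlonglongrightarrow> 0" "a \<longlonglongrightarrow> x"
  shows "b \<longlonglongrightarrow> x"
  unfolding tendsto_fun_iff
proof
  fix i
  have "(\<lambda>k. a k i - b k i) \<longlonglongrightarrow> 0"
  proof (rule Lim_null_comparison)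
    show "\<forall>\<^sub>F k in sequentially. norm (a k i - b k i) \<le> 2 ^ Suc i * hdist (a k) (b k)"
      using coord_le_hdist[OF assms(1,2)] by (intro always_eventually) (simp only: real_norm_def, blast)
    show "(\<lambda>k. 2 ^ Suc i * hdist (a k) (b k)) \<longlonglongrightarrow> 0"
      using tendsto_mult_right_zero[OF assms(3)] .
  qed
  moreover have "(\<lambda>k. a k i) \<longlonglongrightarrow> x i" using assms(4) by (simp add: tendsto_fun_iff)
  ultimately have "(\<lambda>k. a k i - (a k i - b k i)) \<longlonglongrightarrow> x i - 0"
    by (intro tendsto_diff)
  then show "(\<lambda>k. b k i) \<longlonglongrightarrow> x i" by simp
qed

lemma hdist_lerp:
  assumes "x \<in> hcube" "y \<in> hcube" "0 \<le> t"
  shows "hdist x (lerp t x y) = t * hdist x y"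
proof -
  have "hdist x (lerp t x y) = (\<Sum>i. t * (\<bar>x i - y i\<bar> / 2 ^ Suc i))"
    unfolding hdist_def
  proof (rule suminf_cong)
    fix i
    have "x i - lerp t x y i = t * (x i - y i)" by (simp add: lerp_def algebra_simps)
    then show "\<bar>x i - lerp t x y i\<bar> / 2 ^ Suc i = t * (\<bar>x i - y i\<bar> / 2 ^ Suc i)"
      using assms(3) by (simp add: abs_mult)
  qed
  also have "\<dots> = t * hdist x y"
    unfolding hdist_def by (rule suminf_mult[OF hdist_summable[OF assms(1,2)]])
  finally show ?thesis .
qed

section \<open>Projections onto finite-dimensional cubes\<close>

lemma hproj_hcube: "x \<in> hcube \<Longrightarrow> hproj n x \<in> hcube"
  by (auto simp: hproj_def hcube_def)

lemma hproj_fcube: "x \<in> hcube \<Longrightarrow> hproj n x \<in> fcube n"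
  by (auto simp: hproj_def hcube_def fcube_def)

lemma hproj_hproj: "m \<le> n \<Longrightarrow> hproj m (hproj n x) = hproj m x"
  by (auto simp: hproj_def)

lemma hproj_lerp: "hproj n (lerp t x y) = lerp t (hproj n x) (hproj n y)"
  by (auto simp: hproj_def lerp_def)

lemma continuous_on_hproj: "continuous_on S (hproj n)"
  unfolding continuous_on_fun_iff
proof
  fix i
  show "continuous_on S (\<lambda>x. hproj n x i)"
    by (cases "i < n") (simp_all add: hproj_def continuous_on_apply)
qed

lemma hdist_hproj_self:
  assumes "x \<in> hcube"
  shows "hdist (hproj n x) x \<le> 1 / 2 ^ n"
proof -
  have "hdist (hproj n x) x \<le> (\<Sum>i. if i < n then 0 else 1 / 2 ^ Suc i)"
    unfolding hdist_def
  proof (rule suminf_le)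
    show "\<bar>hproj n x i - x i\<bar> / 2 ^ Suc i \<le> (if i < n then 0 else 1 / 2 ^ Suc i)" for i
      using hdist_term_le[OF hproj_hcube[OF assms, of n] assms, of i] by (auto simp: hproj_def)
    show "summable (\<lambda>i. if i < n then 0 else 1 / 2 ^ Suc i :: real)"
      by (rule summable_comparison_test[OF _ summable_half_powers]) auto
  qed (rule hdist_summable[OF hproj_hcube[OF assms] assms])
  then show ?thesis by (simp add: suminf_half_powers_tail)
qed

section \<open>Geometric simplices: mesh, compactness, continuity of simplicial maps\<close>

lemma hdist_le_mesh:
  assumes "finite T" "\<sigma> \<in> T" "convex hull \<sigma> \<subseteq> hcube" "x \<in> convex hull \<sigma>" "y \<in> convex hull \<sigma>"
  shows "hdist x y \<le> mesh T"
proof -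
  have "hdist x y \<le> hdiameter (convex hull \<sigma>)"
    unfolding hdiameter_def
  proof (rule cSup_upper)
    show "bdd_above {hdist x y |x y. x \<in> convex hull \<sigma> \<and> y \<in> convex hull \<sigma>}"
      by (rule bdd_aboveI[of _ 1]) (use assms(3) hdist_le_1 in auto)
  qed (use assms in auto)
  also have "\<dots> \<le> mesh T"
    unfolding mesh_def using assms by (intro Max_ge) auto
  finally show ?thesis .
qed

lemma bary_combination_continuous:
  fixes c :: "'v \<Rightarrow> 'i \<Rightarrow> real"
  shows "continuous_on S (\<lambda>u. \<Sum>v\<in>\<sigma>. u v *\<^sub>R c v)"
  unfolding continuous_on_fun_iff sum_fun_apply scaleR_fun_def
  by (intro allI continuous_on_sum continuous_on_scaleR continuous_on_apply continuous_on_const)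

text \<open>Presents a geometric simplex as a continuous image of a compact set of coefficient
  functions; compactness of hulls and continuity of simplicial maps rest on this.\<close>

lemma bary_combination_image:
  assumes "finite \<sigma>"
  shows "(\<lambda>u. \<Sum>v\<in>\<sigma>. u v *\<^sub>R v) ` bary_simplex \<sigma> = convex hull (\<sigma> :: 'a::real_vector set)"
proof
  show "(\<lambda>u. \<Sum>v\<in>\<sigma>. u v *\<^sub>R v) ` bary_simplex \<sigma> \<subseteq> convex hull \<sigma>"
    unfolding convex_hull_finite[OF assms] by (auto simp: bary_simplex_def)
  show "convex hull \<sigma> \<subseteq> (\<lambda>u. \<Sum>v\<in>\<sigma>. u v *\<^sub>R v) ` bary_simplex \<sigma>"
  proof
    fix y assume "y \<in> convex hull \<sigma>"
    then obtain u where u: "\<forall>x\<in>\<sigma>. 0 \<le> u x" "sum u \<sigma> = 1" "(\<Sum>x\<in>\<sigma>. u x *\<^sub>R x) = y"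
      unfolding convex_hull_finite[OF assms] by auto
    \<comment> \<open>\<open>convex_hull_finite\<close> leaves the coefficients off
      \<open>\<sigma>\<close> arbitrary, whereas \<open>bary_simplex\<close> wants them 0.\<close>
    have mem: "(\<lambda>v. if v \<in> \<sigma> then u v else 0) \<in> bary_simplex \<sigma>"
      using u by (auto simp: bary_simplex_def)
    have sum: "(\<Sum>v\<in>\<sigma>. (if v \<in> \<sigma> then u v else 0) *\<^sub>R v) = y"
      unfolding u(3)[symmetric] by (rule sum.cong) auto
    show "y \<in> (\<lambda>u. \<Sum>v\<in>\<sigma>. u v *\<^sub>R v) ` bary_simplex \<sigma>"
      by (rule image_eqI[rotated, OF mem]) (rule sum[symmetric])
  qed
qed

lemma compact_convex_hull_fun:
  fixes \<sigma> :: "(nat \<Rightarrow> real) set"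
  assumes "finite \<sigma>"
  shows "compact (convex hull \<sigma>)"
  unfolding bary_combination_image[OF assms, symmetric]
  by (rule compact_continuous_image[OF bary_combination_continuous compact_bary_simplex[OF assms]])

lemma compact_polyhedron_of:
  fixes T :: "(nat \<Rightarrow> real) set set"
  assumes "finite T" "\<And>\<sigma>. \<sigma> \<in> T \<Longrightarrow> finite \<sigma>"
  shows "compact (polyhedron_of T)"
  unfolding polyhedron_of_def using assms compact_convex_hull_fun by (intro compact_UN) auto

text \<open>On each simplex the parametrisation by coefficients is a quotient map (compact onto
  Hausdorff), and \<open>f\<close> composed with it is linear in the coefficients; the finitely many
  closed simplices are then pasted.\<close>

lemma continuous_on_simplicial_map:
  fixes f :: "(nat \<Rightarrow> real) \<Rightarrow> nat \<Rightarrow> real"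
  assumes fin: "finite S" "\<And>\<sigma>. \<sigma> \<in> S \<Longrightarrow> finite \<sigma>" and f: "simplicial_map S T f"
  shows "continuous_on (polyhedron_of S) f"
  unfolding polyhedron_of_def
proof (rule continuous_on_closed_Union)
  fix \<sigma> assume \<sigma>: "\<sigma> \<in> S"
  let ?r = "\<lambda>u :: (nat \<Rightarrow> real) \<Rightarrow> real. \<Sum>v\<in>\<sigma>. u v *\<^sub>R v"
  show "closed (convex hull \<sigma>)"
    using compact_convex_hull_fun[OF fin(2)[OF \<sigma>]] by (rule compact_imp_closed)
  have "quotient_map (top_of_set (bary_simplex \<sigma>)) (top_of_set (convex hull \<sigma>)) ?r"
  proof (rule T1_Spaces.continuous_imp_quotient_map)
    show "continuous_map (top_of_set (bary_simplex \<sigma>)) (top_of_set (convex hull \<sigma>)) ?r"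
      using bary_combination_continuous bary_combination_image[OF fin(2)[OF \<sigma>]]
      by (auto simp: continuous_map_in_subtopology)
    show "compact_space (top_of_set (bary_simplex \<sigma>))"
      using compact_bary_simplex[OF fin(2)[OF \<sigma>]] by (simp add: compact_space_subtopology)
    show "Hausdorff_space (top_of_set (convex hull \<sigma>))"
      by (simp add: Hausdorff_space_subtopology)
    show "?r ` topspace (top_of_set (bary_simplex \<sigma>)) = topspace (top_of_set (convex hull \<sigma>))"
      using bary_combination_image[OF fin(2)[OF \<sigma>]] by simp
  qed
  moreover have "continuous_map (top_of_set (bary_simplex \<sigma>)) euclidean (f \<circ> ?r)"
  proof (rule continuous_map_eq)
    show "continuous_map (top_of_set (bary_simplex \<sigma>)) euclidean (\<lambda>u. \<Sum>v\<in>\<sigma>. u v *\<^sub>R f v)"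
      using bary_combination_continuous by simp
    show "(\<Sum>v\<in>\<sigma>. u v *\<^sub>R f v) = (f \<circ> ?r) u" if "u \<in> topspace (top_of_set (bary_simplex \<sigma>))" for u
      using f \<sigma> that by (auto simp: simplicial_map_def bary_simplex_def)
  qed
  ultimately have "continuous_map (top_of_set (convex hull \<sigma>)) euclidean f"
    by (rule continuous_compose_quotient_map)
  then show "continuous_on (convex hull \<sigma>) f" by simp
qed (rule fin(1))

section \<open>Trivial shape of inverse limits of starlike compacta\<close>

text \<open>Once \<open>F\<close> can be contracted inside \<open>V\<close> by a homotopy defined on all of the cube, so can a
  neighbourhood of \<open>F\<close>: there the straight line from \<open>y\<close> to \<open>h (0, y)\<close> stays in \<open>V\<close> as well.\<close>

lemma fseq_homotopic_const_id:
  assumes p: "p \<in> F" and F: "F \<subseteq> hcube"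
    and contr: "\<And>V. openin (top_of_set hcube) V \<Longrightarrow> F \<subseteq> V \<Longrightarrow>
      \<exists>h c. continuous_on ({0..1} \<times> hcube) h \<and> h ` ({0..1} \<times> hcube) \<subseteq> hcube \<and>
        (\<forall>y\<in>F. h (0, y) = y) \<and> (\<forall>t\<in>{0..1}. \<forall>y\<in>F. h (t, y) \<in> V) \<and> (\<forall>y\<in>hcube. h (1::real, y) = c)"
  shows "fseq_homotopic (\<lambda>k _. p) (\<lambda>_. id) F F"
  unfolding fseq_homotopic_def
proof (intro allI impI)
  fix V assume V: "openin (top_of_set hcube) V \<and> F \<subseteq> V"
  then obtain h c where h: "continuous_on ({0..1} \<times> hcube) h" "h ` ({0..1} \<times> hcube) \<subseteq> hcube"
    "\<And>y. y \<in> F \<Longrightarrow> h (0, y) = y" "\<And>t y. t \<in> {0..1} \<Longrightarrow> y \<in> F \<Longrightarrow> h (t, y) \<in> V"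
    "\<And>y. y \<in> hcube \<Longrightarrow> h (1::real, y) = c"
    using contr[of V] by blast
  let ?I = "top_of_set {0..1::real}" and ?Q = "top_of_set hcube"
  let ?P = "prod_topology ?I ?Q"
  define l where "l = (\<lambda>(t, y). lerp t y (h (0, y)))"
  have P: "?P = top_of_set ({0..1} \<times> hcube)" by simp
  have contl: "continuous_on ({0..1} \<times> hcube) l"
    unfolding l_def case_prod_unfold
    by (intro continuous_on_lerp continuous_intros continuous_on_compose2[OF h(1)]) auto
  have l_im: "l ` ({0..1} \<times> hcube) \<subseteq> hcube"
    unfolding l_def using h(2) by (auto intro!: lerp_convex[OF convex_hcube])
  have ope: "openin ?P {z \<in> topspace ?P. k z \<in> V}"
    if "continuous_on ({0..1::real} \<times> hcube) k" "k ` ({0..1} \<times> hcube) \<subseteq> hcube" for k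
    by (rule openin_continuous_map_preimage[where Y = ?Q]) (use that V in \<open>auto simp: continuous_map_in_subtopology\<close>)
  define W where "W = {z \<in> topspace ?P. l z \<in> V} \<inter> {z \<in> topspace ?P. h z \<in> V}"
  have W: "openin ?P W"
    unfolding W_def by (intro openin_Int ope contl l_im h)
  \<comment> \<open>The points whose whole track under both homotopies stays in \<open>V\<close>;
    compactness of the interval makes this set open.\<close>
  define U where "U = {x \<in> topspace ?Q. \<forall>t\<in>topspace ?I. (t, x) \<in> W}"
  have U: "openin ?Q U"
    unfolding U_def by (rule openin_tube[OF _ W]) (simp add: compact_space_subtopology)
  have Uc: "U \<subseteq> hcube" by (auto simp: U_def)
  have U_mem: "l (t, y) \<in> V" "h (t, y) \<in> V" if "y \<in> U" "t \<in> {0..1}" for t y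
    using that by (auto simp: U_def W_def)
  have FU: "F \<subseteq> U"
  proof
    fix y assume y: "y \<in> F"
    have "l (t, y) \<in> V" for t using h(3)[OF y] V y by (auto simp: l_def)
    then show "y \<in> U" using y F h(4) by (auto simp: U_def W_def)
  qed
  have hom: "homotopic_with (\<lambda>_. True) (top_of_set U) (top_of_set V) (\<lambda>y. k (0, y)) (\<lambda>y. k (1, y))"
    if k: "continuous_on ({0..1::real} \<times> hcube) k" and im: "\<And>t y. t \<in> {0..1} \<Longrightarrow> y \<in> U \<Longrightarrow> k (t, y) \<in> V" for k
    unfolding homotopic_with_def
  proof (intro exI[of _ k] conjI)
    show "continuous_map (prod_topology ?I (top_of_set U)) (top_of_set V) k"
      using continuous_on_subset[OF k, of "{0..1} \<times> U"] Uc im by (auto simp: continuous_map_in_subtopology)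
  qed auto
  \<comment> \<open>Four homotopies on \<open>U\<close> inside \<open>V\<close> are chained:
    \<open>id\<close> to \<open>h (0, _)\<close> along \<open>l\<close>, then to
    \<open>h (1, _)\<close>, which on the cube is the constant \<open>h (1, p)\<close>, and back
    along the track of \<open>p\<close> to the constant \<open>h (0, p) = p\<close>.\<close>
  have 1: "homotopic_with (\<lambda>_. True) (top_of_set U) (top_of_set V) (\<lambda>y. l (0, y)) (\<lambda>y. l (1, y))"
    by (rule hom[OF contl U_mem(1)])
  have 2: "homotopic_with (\<lambda>_. True) (top_of_set U) (top_of_set V) (\<lambda>y. h (0, y)) (\<lambda>y. h (1, y))"
    by (rule hom[OF h(1) U_mem(2)])
  have pU: "p \<in> U" using p FU by auto
  have 3: "homotopic_with (\<lambda>_. True) (top_of_set U) (top_of_set V) (\<lambda>y. h (0, p)) (\<lambda>y. h (1, p))"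
  proof -
    have "continuous_on ({0..1} \<times> hcube) (\<lambda>z. h (fst z, p))"
      by (intro continuous_on_compose2[OF h(1)] continuous_intros) (use pU Uc in auto)
    from hom[OF this] U_mem(2)[OF pU] show ?thesis by simp
  qed
  have 4: "homotopic_with (\<lambda>_. True) (top_of_set U) (top_of_set V) (\<lambda>y. h (1, y)) (\<lambda>y. h (1, p))"
    by (rule homotopic_with_equal)
      (use homotopic_with_imp_continuous_maps[OF 2] h(5) pU Uc in auto)
  have "homotopic_with (\<lambda>_. True) (top_of_set U) (top_of_set V) id (\<lambda>_. p)"
  proof -
    have e: "(\<lambda>y. l (0, y)) = id" "(\<lambda>y. l (1, y)) = (\<lambda>y. h (0, y))" "h (0, p) = p"
      using h(3) p by (auto simp: l_def)
    note 1 = 1[unfolded e(1,2)] and 3 = 3[unfolded e(3)]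
    show ?thesis
      by (rule homotopic_with_trans[OF 1 homotopic_with_trans[OF 2
            homotopic_with_trans[OF 4 homotopic_with_symD[OF 3]]]])
  qed
  then have "homotopic_with (\<lambda>_. True) (top_of_set U) (top_of_set V) (\<lambda>_. p) id"
    by (rule homotopic_with_symD)
  then show "\<exists>U. openin ?Q U \<and> F \<subseteq> U \<and>
      (\<forall>\<^sub>F k in sequentially. homotopic_with (\<lambda>_. True) (top_of_set U) (top_of_set V) (\<lambda>_. p) id)"
    using U FU by (intro exI[of _ U]) auto
qed

lemma fundamental_sequence_const:
  assumes "p \<in> B" "B \<subseteq> hcube" "A \<subseteq> hcube"
  shows "fundamental_sequence (\<lambda>k _. p) A B"
  unfolding fundamental_sequence_def fseq_homotopic_def
proof (intro conjI allI impI)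
  show "continuous_map (top_of_set hcube) (top_of_set hcube) (\<lambda>_. p)"
    using assms by auto
  fix V assume "openin (top_of_set hcube) V \<and> B \<subseteq> V"
  then show "\<exists>U. openin (top_of_set hcube) U \<and> A \<subseteq> U \<and>
      (\<forall>\<^sub>F k in sequentially. homotopic_with (\<lambda>_. True) (top_of_set U) (top_of_set V) (\<lambda>_. p) (\<lambda>_. p))"
    using assms by (intro exI[of _ hcube]) (auto intro!: always_eventually)
qed

text \<open>Both fundamental sequences can be taken constant. Their composites are constant maps,
  which \<open>fseq_homotopic_const_id\<close> joins to the identity; for the one-point set the
  contraction is the straight line to 0.\<close>

lemma same_shape_pointI:
  assumes "F \<noteq> {}" and F: "F \<subseteq> hcube"
    and contr: "\<And>V. openin (top_of_set hcube) V \<Longrightarrow> F \<subseteq> V \<Longrightarrow>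
      \<exists>h c. continuous_on ({0..1} \<times> hcube) h \<and> h ` ({0..1} \<times> hcube) \<subseteq> hcube \<and>
        (\<forall>y\<in>F. h (0, y) = y) \<and> (\<forall>t\<in>{0..1}. \<forall>y\<in>F. h (t, y) \<in> V) \<and> (\<forall>y\<in>hcube. h (1::real, y) = c)"
  shows "same_shape F {\<lambda>_. 0}"
proof -
  let ?z = "\<lambda>_ :: nat. 0 :: real"
  have z: "?z \<in> hcube" by (simp add: hcube_def)
  obtain p where p: "p \<in> F" using assms(1) by auto
  have "fseq_homotopic (\<lambda>k _. ?z) (\<lambda>_. id) {?z} {?z}"
  proof (rule fseq_homotopic_const_id)
    fix V assume V: "openin (top_of_set hcube) V" "{?z} \<subseteq> V"
    define h where "h = (\<lambda>(t, y). lerp t y ?z)"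
    have "continuous_on ({0..1} \<times> hcube) h"
      unfolding h_def case_prod_unfold by (intro continuous_on_lerp continuous_intros)
    moreover have "h ` ({0..1} \<times> hcube) \<subseteq> hcube"
      using z by (auto simp: h_def intro!: lerp_convex[OF convex_hcube])
    moreover have "\<forall>y\<in>hcube. h (1, y) = ?z" "\<forall>y\<in>{?z}. h (0, y) = y" "\<forall>t\<in>{0..1}. \<forall>y\<in>{?z}. h (t, y) \<in> V"
      using V by (auto simp: h_def)
    ultimately show "\<exists>h c. continuous_on ({0..1} \<times> hcube) h \<and> h ` ({0..1} \<times> hcube) \<subseteq> hcube \<and>
        (\<forall>y\<in>{?z}. h (0, y) = y) \<and> (\<forall>t\<in>{0..1}. \<forall>y\<in>{?z}. h (t, y) \<in> V) \<and> (\<forall>y\<in>hcube. h (1::real, y) = c)"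
      by (intro exI[of _ h] exI[of _ ?z] conjI)
  qed (use z in auto)
  moreover have "fseq_homotopic (\<lambda>k _. p) (\<lambda>_. id) F F"
    by (rule fseq_homotopic_const_id[OF p F contr])
  ultimately show ?thesis
    unfolding same_shape_def
    using fundamental_sequence_const[of ?z "{?z}" F] fundamental_sequence_const[of p F "{?z}"] p F z
    by (intro exI[of _ "\<lambda>k _. ?z"] exI[of _ "\<lambda>k _. p"] conjI) (simp_all add: comp_def)
qed

text \<open>A pairing of indices codes a sequence of points as a single point. It brings inverse
  limits, which live in a product of Hilbert cubes, into the type \<open>nat => real\<close> in
  which \<open>same_shape\<close> and \<open>ext_le\<close> are stated.\<close>

definition reindex :: "(nat \<Rightarrow> nat \<Rightarrow> real) \<Rightarrow> nat \<Rightarrow> real"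
  where "reindex a = (\<lambda>i. a (fst (prod_decode i)) (snd (prod_decode i)))"

definition unindex :: "(nat \<Rightarrow> real) \<Rightarrow> nat \<Rightarrow> nat \<Rightarrow> real"
  where "unindex y = (\<lambda>j i. y (prod_encode (j, i)))"

lemma unindex_reindex [simp]: "unindex (reindex a) = a"
  by (simp add: reindex_def unindex_def)

lemma reindex_unindex [simp]: "reindex (unindex y) = y"
  by (simp add: reindex_def unindex_def)

lemma continuous_on_reindex: "continuous_on S reindex"
  unfolding continuous_on_fun_iff
proof
  fix i
  have "continuous_on S (\<lambda>a :: nat \<Rightarrow> nat \<Rightarrow> real. a j k)" for j k
    using continuous_on_apply[of S j] by (auto simp: continuous_on_fun_iff)
  then show "continuous_on S (\<lambda>x. reindex x i)" by (simp add: reindex_def)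
qed

lemma continuous_on_unindex: "continuous_on S (\<lambda>y. unindex y j)"
  unfolding continuous_on_fun_iff by (simp add: unindex_def continuous_on_apply)

lemma unindex_hcube: "y \<in> hcube \<Longrightarrow> unindex y j \<in> hcube"
  by (simp add: unindex_def hcube_def)

lemma reindex_hcube: "(\<And>j. a j \<in> hcube) \<Longrightarrow> reindex a \<in> hcube"
  by (simp add: reindex_def hcube_def)

lemma homeomorphic_maps_reindex: "homeomorphic_maps (top_of_set S) (top_of_set (reindex ` S)) reindex unindex"
proof -
  have "continuous_on T unindex" for T
    by (rule continuous_on_coordinatewise_then_product) (rule continuous_on_unindex)
  then show ?thesis
    unfolding homeomorphic_maps_def
    by (auto simp: continuous_map_in_subtopology continuous_on_reindex)
qed

section \<open>Bonding maps, threads and their compactness\<close>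

lemma bond_self [simp]: "bond g s s = id"
  by (cases s) auto

text \<open>\<open>bond\<close> recurses on the map from the last stage; this unfolds the map into
  the first, as needed to verify the thread condition for bonding images.\<close>

lemma bond_first: "s < k \<Longrightarrow> bond g s k x = g s (bond g (Suc s) k x)"
  by (induction k arbitrary: x) (auto simp: less_Suc_eq_le le_less)

lemma bond_thread:
  assumes "\<And>j. j < k \<Longrightarrow> g j (a (Suc j)) = a j" "s \<le> k"
  shows "bond g s k (a k) = a s"
  using assms by (induction k) (auto simp: le_Suc_eq)

lemma bond_maps_to:
  assumes "\<And>j. g j ` S (Suc j) \<subseteq> S j" "s \<le> k" "x \<in> S k"
  shows "bond g s k x \<in> S s"
  using assms(2,3) 
proof (induction k arbitrary: x)
  case (Suc k)
  then show ?case using assms(1)[of k] by (auto simp: le_Suc_eq)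
qed auto

lemma continuous_on_bond:
  assumes "\<And>j. g j ` S (Suc j) \<subseteq> S j" "\<And>j. continuous_on (S (Suc j)) (g j)" "s \<le> k"
  shows "continuous_on (S k) (bond g s k)"
  using assms(3)
proof (induction k)
  case (Suc k)
  show ?case
  proof (cases "s \<le> k")
    case True
    then show ?thesis
      using Suc assms(1)[of k] assms(2)[of k]
      by (auto intro: continuous_on_compose continuous_on_subset simp del: o_apply)
  next
    case False
    with Suc.prems have "s = Suc k" by simp
    then show ?thesis by (simp add: id_def continuous_on_id)
  qed
qed (simp add: id_def continuous_on_id)

text \<open>Compactness: otherwise the nonempty sets \<open>C k - V\<close> would have a common
  point.\<close>

lemma closed_nest_subset_open:
  fixes C :: "nat \<Rightarrow> 'a set"
  assumes "compact_space X" "\<And>k. closedin X (C k)" "decseq C" "openin X V" "(\<Inter>k. C k) \<subseteq> V"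
  obtains k where "C k \<subseteq> V"
proof (rule ccontr)
  assume *: "\<not> thesis"
  have "(\<Inter>k. C k - V) \<noteq> {}"
  proof (rule compact_space_imp_nest[OF assms(1)])
    show "closedin X (C k - V)" for k using assms by (intro closedin_diff)
    show "C k - V \<noteq> {}" for k using * that by auto
    show "decseq (\<lambda>k. C k - V)" using assms(3) by (auto simp: decseq_def)
  qed
  then show False using assms(5) by auto
qed

lemma closed_equalizer:
  fixes f g :: "'a::topological_space \<Rightarrow> 'b::metric_space"
  assumes "closed B" "continuous_on B f" "continuous_on B g"
  shows "closed {x \<in> B. f x = g x}"
proof -
  have "closedin (top_of_set B) {x \<in> topspace (top_of_set B). f x = g x}"
    by (rule closedin_continuous_maps_eq[of euclidean]) (use assms in auto)
  then show ?thesis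
    using assms(1) by (simp add: closedin_closed_eq)
qed

lemma compact_PiE_UNIV:
  fixes S :: "'i \<Rightarrow> 'b::topological_space set"
  assumes "\<And>j. compact (S j)"
  shows "compact {w. \<forall>j. w j \<in> S j}"
proof -
  have "compactin (product_topology (\<lambda>v::'i. euclidean) UNIV) (\<Pi>\<^sub>E j\<in>UNIV. S j)"
    by (subst compactin_PiE) (use assms in auto)
  then show ?thesis
    by (simp add: euclidean_product_topology PiE_UNIV_domain Pi_def)
qed

text \<open>The point set of the inverse limit. The stages are a parameter so that fibres, too, can
  be written as spaces of threads, through smaller stages.\<close>

definition threads :: "(nat \<Rightarrow> 'a set) \<Rightarrow> (nat \<Rightarrow> 'a \<Rightarrow> 'a) \<Rightarrow> (nat \<Rightarrow> 'a) set"
  where "threads S g = {w. (\<forall>j. w j \<in> S j) \<and> (\<forall>j. g j (w (Suc j)) = w j)}"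

lemma compact_threads:
  fixes S :: "nat \<Rightarrow> 'a::metric_space set"
  assumes "\<And>j. compact (S j)" "\<And>j. continuous_on (S (Suc j)) (g j)"
  shows "compact (threads S g)"
proof -
  define B where "B = {w. \<forall>j. w j \<in> S j}"
  have B: "compact B" unfolding B_def by (rule compact_PiE_UNIV[OF assms(1)])
  have "closed {w \<in> B. g j (w (Suc j)) = w j}" for j
    by (rule closed_equalizer[OF compact_imp_closed[OF B] _ continuous_on_apply],
        rule continuous_on_compose2[OF assms(2) continuous_on_apply]) (auto simp: B_def)
  then have "compact (B \<inter> (\<Inter>j. {w \<in> B. g j (w (Suc j)) = w j}))"
    by (intro compact_Int_closed B closed_INT) auto
  also have "B \<inter> (\<Inter>j. {w \<in> B. g j (w (Suc j)) = w j}) = threads S g"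
    by (auto simp: threads_def B_def)
  finally show ?thesis .
qed

text \<open>Sequences that are threads up to stage \<open>k\<close>, with free later coordinates:
  compact approximations that shrink to the thread space.\<close>

lemma compact_partial_threads:
  fixes S :: "nat \<Rightarrow> 'a::metric_space set"
  assumes "\<And>j. compact (S j)" "\<And>j. continuous_on (S (Suc j)) (g j)"
    and Q: "compact Q" "\<And>j. S j \<subseteq> Q"
  shows "compact {w. (\<forall>j. w j \<in> Q) \<and> (\<forall>j\<le>k. w j \<in> S j) \<and> (\<forall>j<k. g j (w (Suc j)) = w j)}"
proof -
  define B where "B = {w. \<forall>j. w j \<in> (if j \<le> k then S j else Q)}"
  have B: "compact B" unfolding B_def by (rule compact_PiE_UNIV) (use assms in auto)
  have "closed {w \<in> B. g j (w (Suc j)) = w j}" if "j < k" for j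
    by (rule closed_equalizer[OF compact_imp_closed[OF B] _ continuous_on_apply],
        rule continuous_on_compose2[OF assms(2) continuous_on_apply]) (use that in \<open>auto simp: B_def dest: spec[of _ "Suc j"]\<close>)
  then have "compact (B \<inter> (\<Inter>j\<in>{..<k}. {w \<in> B. g j (w (Suc j)) = w j}))"
    by (intro compact_Int_closed B closed_INT) auto
  also have "B \<inter> (\<Inter>j\<in>{..<k}. {w \<in> B. g j (w (Suc j)) = w j})
      = {w. (\<forall>j. w j \<in> Q) \<and> (\<forall>j\<le>k. w j \<in> S j) \<and> (\<forall>j<k. g j (w (Suc j)) = w j)}"
    using Q(2) by (auto simp: B_def split: if_splits)
  finally show ?thesis .
qed

lemma normal_space_hcube: "normal_space (top_of_set hcube)"
  by (simp add: metrizable_imp_normal_space metrizable_space_subtopology metrizable_space_euclidean)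

text \<open>The thread space is the intersection of the compact sets \<open>M k\<close> of sequences
  that are threads up to stage \<open>k\<close>, so some coded \<open>M k\<close> lies in a given
  neighbourhood \<open>V\<close>. An element of \<open>M k\<close> is determined by its coordinate
  \<open>k\<close> and its free later coordinates, and these can be contracted linearly within
  \<open>M k\<close>.\<close>

lemma cell_like_starlike_inverse_limit:
  fixes S :: "nat \<Rightarrow> (nat \<Rightarrow> real) set"
  assumes S: "\<And>j. compact (S j)" "\<And>j. S j \<subseteq> hcube" "\<And>j. v j \<in> S j"
    "\<And>j y t. y \<in> S j \<Longrightarrow> 0 \<le> t \<Longrightarrow> t \<le> 1 \<Longrightarrow> lerp t y (v j) \<in> S j"
    and g: "\<And>j. g j ` S (Suc j) \<subseteq> S j" "\<And>j. continuous_on (S (Suc j)) (g j)"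
  shows "threads S g \<noteq> {}" "cell_like (top_of_set (threads S g))"
proof -
  let ?Q = "top_of_set hcube"
  define M where "M = (\<lambda>k. {w. (\<forall>j. w j \<in> hcube) \<and> (\<forall>j\<le>k. w j \<in> S j) \<and> (\<forall>j<k. g j (w (Suc j)) = w j)})"
  have M: "compact (M k)" for k
    unfolding M_def by (rule compact_partial_threads[of S g, OF S(1) g(2) compact_hcube S(2)])
  have bond_S: "bond g j k x \<in> S j" if "j \<le> k" "x \<in> S k" for j k x
    by (rule bond_maps_to[of g S, OF g(1)]) (use that in auto)
  \<comment> \<open>A point of \<open>S k\<close> determines the earlier coordinates by bonding; the
    later ones \<open>b\<close> are arbitrary.\<close>
  have M_mem: "(\<lambda>j. if j < k then bond g j k x else if j = k then x else b j) \<in> M k" (is "?w \<in> _")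
    if x: "x \<in> S k" and b: "\<And>j. b j \<in> hcube" for k x b
  proof -
    have w: "?w j = bond g j k x" if "j \<le> k" for j
      using that by auto
    have w_S: "?w j \<in> S j" if "j \<le> k" for j
      unfolding w[OF that] by (rule bond_S[OF that x])
    have "?w j \<in> hcube" for j
      using w_S[of j] S(2)[of j] b[of j] by (cases "j \<le> k") auto
    moreover have "g j (?w (Suc j)) = ?w j" if "j < k" for j
      unfolding w[OF Suc_leI[OF that]] w[OF less_imp_le[OF that]] by (rule bond_first[OF that, symmetric])
    ultimately show ?thesis unfolding M_def using w_S by blast
  qed
  define C where "C = (\<lambda>k. reindex ` M k)"
  define F where "F = reindex ` threads S g"
  have C_hcube: "C k \<subseteq> hcube" for k
    by (auto simp: C_def M_def intro!: reindex_hcube)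
  have C_closed: "closedin ?Q (C k)" for k
    using C_hcube compact_continuous_image[OF continuous_on_reindex M]
    by (auto simp: C_def closedin_closed_eq[OF closed_hcube] compact_imp_closed)
  have decC: "decseq C"
    by (auto simp: decseq_def C_def M_def)
  have C_Inter: "(\<Inter>k. C k) = F"
  proof
    show "F \<subseteq> (\<Inter>k. C k)"
    proof -
      have "threads S g \<subseteq> M k" for k
        using S(2) unfolding threads_def M_def by blast
      then show ?thesis unfolding F_def C_def by blast
    qed
    show "(\<Inter>k. C k) \<subseteq> F"
    proof
      fix y assume y: "y \<in> (\<Inter>k. C k)"
      have "unindex y \<in> M k" for k using y by (auto simp: C_def)
      then have "unindex y \<in> threads S g" unfolding M_def threads_def by blast
      then show "y \<in> F" unfolding F_def by (metis image_eqI reindex_unindex)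
    qed
  qed
  have cQ: "compact_space ?Q" by (simp add: compact_space_subtopology compact_hcube)
  have "C k \<noteq> {}" for k
  proof -
    have "\<exists>w. w \<in> M k" using M_mem[OF S(3), of "\<lambda>_ _. 0"] by (auto simp: hcube_def)
    then show ?thesis by (auto simp: C_def)
  qed
  then have F_ne: "F \<noteq> {}"
    using compact_space_imp_nest[OF cQ C_closed _ decC] C_Inter by metis
  then show "threads S g \<noteq> {}" by (auto simp: F_def)
  have F_hcube: "F \<subseteq> hcube" using C_hcube[of 0] C_Inter by auto
  have "same_shape F {\<lambda>_. 0}"
  proof (rule same_shape_pointI[OF F_ne F_hcube])
    fix V assume V: "openin ?Q V" "F \<subseteq> V"
    obtain k where k: "C k \<subseteq> V"
      using closed_nest_subset_open[OF cQ C_closed decC V(1)] V(2) C_Inter by metis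
    \<comment> \<open>The homotopy must be defined on the entire cube, whereas the bonding maps are
      continuous only on \<open>S k\<close>.\<close>
    have "\<exists>G. continuous_map ?Q ?Q G \<and> (\<forall>x\<in>S k. G x = bond g j k x)" if "j \<le> k" for j
    proof -
      have "closedin ?Q (S k)"
        using S(1,2) by (auto simp: closedin_closed_eq[OF closed_hcube] compact_imp_closed)
      moreover have "continuous_on (S k) (bond g j k)"
        by (rule continuous_on_bond[of g S, OF g]) (use that in auto)
      then have "continuous_map (subtopology ?Q (S k)) ?Q (bond g j k)"
        using S(2) bond_S[OF that] by (auto simp: subtopology_subtopology Int_absorb1 continuous_map_in_subtopology)
      ultimately show ?thesis
        using hcube_Tietze[OF normal_space_hcube] by metis
    qed
    then obtain G where G: "\<And>j. j \<le> k \<Longrightarrow> continuous_map ?Q ?Q (G j)"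
      "\<And>j x. j \<le> k \<Longrightarrow> x \<in> S k \<Longrightarrow> G j x = bond g j k x"
      by metis
    have Gc: "continuous_on hcube (G j)" "G j ` hcube \<subseteq> hcube" if "j \<le> k" for j
      using G(1)[OF that] by (auto simp: continuous_map_in_subtopology)
    have vh: "v k \<in> hcube" using S(2,3) by auto
    have zh: "(\<lambda>_. 0) \<in> hcube" by (auto simp: hcube_def)
    \<comment> \<open>Coordinate \<open>k\<close> moves straight to \<open>v k\<close>, the earlier
      ones follow it through \<open>G\<close>, the later ones shrink to 0. At time 1 nothing depends
      on the starting point any more.\<close>
    define c where "c = (\<lambda>z :: real \<times> (nat \<Rightarrow> real). lerp (fst z) (unindex (snd z) k) (v k))"
    define h' where "h' = (\<lambda>z j. if j < k then G j (c z) else if j = k then c z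
      else lerp (fst z) (unindex (snd z) j) (\<lambda>_. 0))"
    define h where "h = (\<lambda>z. reindex (h' z))"
    let ?D = "{0..1::real} \<times> hcube"
    have c_mem: "c z \<in> hcube" if "z \<in> ?D" for z
      using that vh unindex_hcube by (auto simp: c_def intro!: lerp_convex[OF convex_hcube])
    have contc: "continuous_on ?D c"
      unfolding c_def
      by (intro continuous_on_lerp continuous_intros continuous_on_compose2[OF continuous_on_unindex[of UNIV]]) auto
    have conth': "continuous_on ?D (\<lambda>z. h' z j)" for j
    proof -
      consider "j < k" | "j = k" | "j > k" by linarith
      then show ?thesis
      proof cases
        case 1
        then show ?thesis
          using continuous_on_compose2[OF Gc(1) contc, of j] c_mem by (auto simp: h'_def)
      next
        case 2
        then show ?thesis using contc by (simp add: h'_def)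
      next
        case 3
        have "continuous_on ?D (\<lambda>z. lerp (fst z) (unindex (snd z) j) (\<lambda>_. 0))"
          by (intro continuous_on_lerp continuous_intros continuous_on_compose2[OF continuous_on_unindex[of UNIV]]) auto
        with 3 show ?thesis by (simp add: h'_def)
      qed
    qed
    have "continuous_on ?D h'" by (rule continuous_on_coordinatewise_then_product) (rule conth')
    then have conth: "continuous_on ?D h"
      unfolding h_def by (rule continuous_on_compose2[OF continuous_on_reindex[of UNIV]]) auto
    have G_mem: "G j x \<in> hcube" if "j \<le> k" "x \<in> hcube" for j x
      using Gc(2)[OF that(1)] that(2) by blast
    have h'_mem: "h' z j \<in> hcube" if "z \<in> ?D" for z j
      using that c_mem[OF that] G_mem[of j "c z"] zh unindex_hcube
      by (auto simp: h'_def intro!: lerp_convex[OF convex_hcube])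
    have h_im: "h ` ?D \<subseteq> hcube"
      using h'_mem by (auto simp: h_def intro!: reindex_hcube)
    have h0: "h (0, y) = y" if y: "y \<in> F" for y
    proof -
      \<comment> \<open>On a thread the extended bonding maps return its own coordinates, so on
        \<open>F\<close> the homotopy starts at the identity.\<close>
      have un: "unindex y \<in> threads S g" using y by (auto simp: F_def)
      then have "G j (unindex y k) = unindex y j" if "j \<le> k" for j
        using G(2)[OF that, of "unindex y k"] bond_thread[of k g "unindex y" j] that by (auto simp: threads_def)
      then have "h' (0, y) = unindex y" by (auto simp: h'_def c_def fun_eq_iff)
      then show ?thesis by (simp add: h_def)
    qed
    have ht: "h (t, y) \<in> V" if t: "t \<in> {0..1}" and y: "y \<in> F" for t y
    proof -
      have "unindex y k \<in> S k" using y by (auto simp: F_def threads_def)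
      \<comment> \<open>Starlikeness about \<open>v k\<close> keeps coordinate \<open>k\<close> in
        \<open>S k\<close>, where \<open>G\<close> is the true bonding map; so the track stays in
        \<open>M k\<close>.\<close>
      then have cS: "c (t, y) \<in> S k" using S(4) t by (auto simp: c_def)
      have zmem: "lerp t (unindex y j) (\<lambda>_. 0) \<in> hcube" for j
        using t y F_hcube zh unindex_hcube by (intro lerp_convex[OF convex_hcube]) auto
      have "h' (t, y) = (\<lambda>j. if j < k then bond g j k (c (t, y)) else if j = k then c (t, y)
          else lerp t (unindex y j) (\<lambda>_. 0))"
        unfolding h'_def using G(2)[OF less_imp_le cS] by (intro ext) simp
      then have "h' (t, y) \<in> M k"
        using M_mem[OF cS, of "\<lambda>j. lerp t (unindex y j) (\<lambda>_. 0)", OF zmem] by simp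
      then have "h (t, y) \<in> C k" unfolding h_def C_def by (rule imageI)
      with k show ?thesis by auto
    qed
    have "h (1, y) = reindex (\<lambda>j. if j < k then G j (v k) else if j = k then v k else (\<lambda>_. 0))" for y
      unfolding h_def h'_def by (intro arg_cong[where f = reindex] ext) (simp add: c_def)
    then show "\<exists>h c. continuous_on ?D h \<and> h ` ?D \<subseteq> hcube \<and>
        (\<forall>y\<in>F. h (0, y) = y) \<and> (\<forall>t\<in>{0..1}. \<forall>y\<in>F. h (t, y) \<in> V) \<and> (\<forall>y\<in>hcube. h (1::real, y) = c)"
      using conth h_im h0 ht by blast
  qed
  moreover have "embedding_map (top_of_set (threads S g)) ?Q reindex"
  proof -
    have "subtopology ?Q F = top_of_set F"
      using F_hcube by (simp add: subtopology_subtopology Int_absorb1)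
    then show ?thesis
      using homeomorphic_maps_imp_map[OF homeomorphic_maps_reindex[of "threads S g"]]
      by (simp add: embedding_map_def F_def)
  qed
  moreover have "compact_space (top_of_set (threads S g))"
    using compact_threads[of S g] S(1) g(2) by (simp add: compact_space_subtopology)
  moreover have "metrizable_space (top_of_set (threads S g))"
    by (simp add: metrizable_space_subtopology metrizable_space_euclidean)
  ultimately show "cell_like (top_of_set (threads S g))"
    unfolding cell_like_def F_def by auto
qed

section \<open>Threads, their limits, and the fibres\<close>

text \<open>Nearby points of \<open>A\<close> have a convergent subsequence, and the given points
  follow it since the distances tend to 0.\<close>

lemma hdist_near_compact_subsequence:
  assumes A: "compact A" "A \<subseteq> hcube" and y: "\<And>k. y k \<in> hcube"
    and near: "\<And>k. \<exists>x\<in>A. hdist x (y k) \<le> c k" and c: "c \<longlonglongrightarrow> (0::real)"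
  obtains r l where "strict_mono (r :: nat \<Rightarrow> nat)" "l \<in> A" "(y \<circ> r) \<longlonglongrightarrow> l"
proof -
  obtain x where x: "\<And>k. x k \<in> A" "\<And>k. hdist (x k) (y k) \<le> c k" using near by metis
  obtain l r where l: "l \<in> A" "strict_mono (r :: nat \<Rightarrow> nat)" "(x \<circ> r) \<longlonglongrightarrow> l"
    using compact_imp_seq_compact[OF A(1)] x(1) by (metis seq_compactE)
  have "(\<lambda>k. hdist ((x \<circ> r) k) ((y \<circ> r) k)) \<longlonglongrightarrow> 0"
  proof (rule tendsto_sandwich)
    show "\<forall>\<^sub>F k in sequentially. 0 \<le> hdist ((x \<circ> r) k) ((y \<circ> r) k)"
      using A(2) x(1) y by (intro always_eventually allI) (auto intro!: hdist_nonneg)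
    show "\<forall>\<^sub>F k in sequentially. hdist ((x \<circ> r) k) ((y \<circ> r) k) \<le> (c \<circ> r) k"
      using x(2) by (intro always_eventually allI) auto
    show "(c \<circ> r) \<longlonglongrightarrow> 0" by (rule LIMSEQ_subseq_LIMSEQ[OF c l(2)])
  qed simp
  then have "(y \<circ> r) \<longlonglongrightarrow> l"
    by (rule hdist_tendsto_0_imp[rotated 2]) (use A x y l(3) in \<open>auto simp: comp_def\<close>)
  then show ?thesis using that l by blast
qed

lemma tendsto_hproj: "(a \<longlongrightarrow> x) F \<Longrightarrow> ((\<lambda>k. hproj m (a k)) \<longlongrightarrow> hproj m x) F"
  unfolding tendsto_fun_iff hproj_def by auto

lemma closed_star_lerp:
  assumes "y \<in> closed_star v S" "0 \<le> t" "t \<le> 1"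
  shows "lerp t y v \<in> closed_star (v :: nat \<Rightarrow> real) S"
proof -
  obtain \<sigma> where \<sigma>: "\<sigma> \<in> S" "v \<in> \<sigma>" "y \<in> convex hull \<sigma>"
    using assms(1) by (auto simp: closed_star_def)
  have "lerp t y v \<in> convex hull \<sigma>"
    by (rule lerp_convex[OF convex_convex_hull]) (use \<sigma> assms hull_inc in auto)
  with \<sigma> show ?thesis by (auto simp: closed_star_def)
qed

lemma inverse_limit_eq_threads:
  "inverse_limit (\<lambda>j. top_of_set (S j)) g = top_of_set (threads S g)"
proof -
  have "product_topology (\<lambda>j. top_of_set (S j)) UNIV = top_of_set {w. \<forall>j. w j \<in> S j}"
    unfolding subtopology_product_topology[symmetric] euclidean_product_topology
    by (simp add: PiE_UNIV_domain Pi_def)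
  moreover have "{w. \<forall>j. w j \<in> S j} \<inter> {a. \<forall>i. g i (a (Suc i)) = a i} = threads S g"
    by (auto simp: threads_def)
  ultimately show ?thesis
    by (simp add: inverse_limit_def subtopology_subtopology)
qed

context induced_inverse_sequence
begin

section \<open>The stages of the sequence and their bonding maps\<close>

abbreviation XX where "XX \<equiv> e ` topspace X"

lemma XX_hcube: "XX \<subseteq> hcube"
  using continuous_map_image_subset_topspace[OF homeomorphic_imp_continuous_map]
    embedding[unfolded embedding_map_def] by fastforce

lemma homeomorphic_X: "homeomorphic_map X (top_of_set XX) e"
  using embedding XX_hcube by (simp add: embedding_map_def subtopology_subtopology Int_absorb1)

lemma compact_XX:
  assumes "compact_space X"
  shows "compact XX"
proof -
  have "compactin (top_of_set XX) XX"
    by (rule image_compactin[OF _ homeomorphic_imp_continuous_map[OF homeomorphic_X]])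
      (use assms in \<open>simp add: compact_space_def\<close>)
  then show ?thesis by (simp add: compactin_subtopology)
qed

lemma P_hcube: "P j \<subseteq> hcube"
  using P_sub[of j] by (auto simp: fcube_def)

lemma finite_T: "finite (T j)" "\<sigma> \<in> T j \<Longrightarrow> finite \<sigma>"
  and finite_Tt: "finite (Tt j)" "\<sigma> \<in> Tt j \<Longrightarrow> finite \<sigma>"
  using T_triangulates[of j] Tt_triangulates[of j]
  by (auto simp: triangulates_def geom_complex_def dest: abs_complex_finite)

lemma polyhedron_T [simp]: "polyhedron_of (T j) = P j"
  using T_triangulates[of j] by (simp add: triangulates_def)

lemma hull_sub_P: "\<sigma> \<in> T j \<Longrightarrow> convex hull \<sigma> \<subseteq> P j"
  using polyhedron_T[of j] unfolding polyhedron_of_def by blast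

lemma compact_P: "compact (P j)"
  using compact_polyhedron_of[OF finite_T] by simp

text \<open>The geometric content of \<open>cond8\<close>: every simplex of \<open>T s\<close>
  containing the projected point also contains its bonding image.\<close>

lemma common_simplex:
  assumes "s < j" "x \<in> P j"
  obtains \<sigma> where "\<sigma> \<in> T s" "hproj (n s) x \<in> convex hull \<sigma>" "bond g s j x \<in> convex hull \<sigma>"
proof -
  have "hproj (n s) x \<in> P s"
    using cond8[OF assms(1)] assms(2) by (auto simp: simplicial_approx_def)
  then obtain \<sigma> where "\<sigma> \<in> T s" "hproj (n s) x \<in> convex hull \<sigma>"
    using polyhedron_T[of s] by (auto simp: polyhedron_of_def)
  moreover from this have "bond g s j x \<in> convex hull \<sigma>"
    using cond8[OF assms(1)] assms(2) by (auto simp: simplicial_approx_def modification_def)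
  ultimately show thesis by (rule that)
qed

lemma bond_P: "s \<le> j \<Longrightarrow> x \<in> P j \<Longrightarrow> bond g s j x \<in> P s"
  by (cases "s = j") (auto elim!: common_simplex[rotated] dest: hull_sub_P)

lemma continuous_on_bond_P: "s < j \<Longrightarrow> continuous_on (P j) (bond g s j)"
  using continuous_on_simplicial_map[of "T j" "T s" "bond g s j"] finite_T(1)[of j] finite_T(2) cond8[of s j]
  by (simp add: simplicial_approx_def)

lemma continuous_on_g: "continuous_on (P (Suc j)) (g j)"
  using continuous_on_bond_P[of j "Suc j"] by simp

lemma bond_near_hproj:
  assumes "s < j" "x \<in> P j"
  shows "hdist (bond g s j x) (hproj (n s) x) < \<delta> s / 2"
proof -
  obtain \<sigma> where \<sigma>: "\<sigma> \<in> T s" "hproj (n s) x \<in> convex hull \<sigma>" "bond g s j x \<in> convex hull \<sigma>"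
    using common_simplex[OF assms] .
  have "hdist (bond g s j x) (hproj (n s) x) \<le> mesh (T s)"
    by (rule hdist_le_mesh[OF finite_T(1) \<sigma>(1) _ \<sigma>(3,2)]) (use hull_sub_P[OF \<sigma>(1)] P_hcube in auto)
  with cond4[of s] show ?thesis by simp
qed

section \<open>Convergence of threads to points of the embedded space\<close>

abbreviation ZZ where "ZZ \<equiv> threads P g"

lemma ZZ_P: "w \<in> ZZ \<Longrightarrow> w j \<in> P j"
  by (simp add: threads_def)

lemma ZZ_hcube: "w \<in> ZZ \<Longrightarrow> w j \<in> hcube"
  using ZZ_P P_hcube by blast

lemma ZZ_bond: "w \<in> ZZ \<Longrightarrow> s \<le> j \<Longrightarrow> bond g s j (w j) = w s"
  by (rule bond_thread) (auto simp: threads_def)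

lemma ZZ_near_hproj: "w \<in> ZZ \<Longrightarrow> s < j \<Longrightarrow> hdist (w s) (hproj (n s) (w j)) < \<delta> s / 2"
  using bond_near_hproj[of s j "w j"] ZZ_bond[of w s j] ZZ_P by simp

lemma le_n: "s \<le> n s"
  using n_increasing by (rule strict_mono_imp_increasing)

lemma two_n_le: "2 / 2 ^ n s \<le> (2 / 2 ^ s :: real)"
  by (intro divide_left_mono power_increasing le_n) auto

text \<open>The bonding map costs \<open>\<delta> s / 2\<close>, which is below
  \<open>1 / 2 ^ n s\<close> by \<open>cond3\<close>, and cutting off the coordinates from
  \<open>n s\<close> on costs at most \<open>1 / 2 ^ n s\<close> again. The bound does not depend on
  \<open>w\<close>, which later gives continuity of the limit.\<close>

lemma ZZ_near:
  assumes "w \<in> ZZ" "s \<le> j"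
  shows "hdist (w s) (w j) \<le> 2 / 2 ^ s"
proof (cases "s = j")
  case True
  then show ?thesis by (simp add: hdist_def)
next
  case False
  then have "s < j" using assms by simp
  have "hdist (w s) (w j) \<le> hdist (w s) (hproj (n s) (w j)) + hdist (hproj (n s) (w j)) (w j)"
    by (intro hdist_triangle hproj_hcube ZZ_hcube assms)
  also have "\<dots> \<le> \<delta> s / 2 + 1 / 2 ^ n s"
    using ZZ_near_hproj[OF assms(1) \<open>s < j\<close>] hdist_hproj_self[OF ZZ_hcube[OF assms(1)], of "n s" j] by simp
  also have "\<dots> \<le> 2 / 2 ^ n s" using cond3[of s] by simp
  also have "\<dots> \<le> 2 / 2 ^ s" by (rule two_n_le)
  finally show ?thesis .
qed

lemma null_two_powers: "(\<lambda>s. c * (2 / 2 ^ s) :: real) \<longlonglongrightarrow> 0"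
proof -
  have "(\<lambda>s. (1 / 2 :: real) ^ s) \<longlonglongrightarrow> 0" by (rule LIMSEQ_power_zero) simp
  then have "(\<lambda>s. (c * 2) * (1 / 2 :: real) ^ s) \<longlonglongrightarrow> (c * 2) * 0" by (rule tendsto_mult_left)
  then show ?thesis by (simp add: power_divide)
qed

lemma ZZ_convergent:
  assumes w: "w \<in> ZZ"
  shows "convergent w"
proof -
  have "convergent (\<lambda>s. w s i)" for i
  proof -
    have bd: "\<bar>w s i - w j i\<bar> \<le> 2 ^ Suc i * (2 / 2 ^ s)" if "s \<le> j" for s j
    proof -
      have "\<bar>w s i - w j i\<bar> \<le> 2 ^ Suc i * hdist (w s) (w j)"
        by (intro coord_le_hdist ZZ_hcube w)
      also have "\<dots> \<le> 2 ^ Suc i * (2 / 2 ^ s)"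
        by (intro mult_left_mono ZZ_near w that) auto
      finally show ?thesis .
    qed
    have "Cauchy (\<lambda>s. w s i)"
    proof (rule CauchyI')
      fix r :: real assume "0 < r"
      then obtain M where M: "\<And>s. s \<ge> M \<Longrightarrow> 2 ^ Suc i * (2 / 2 ^ s) < r"
        using order_tendstoD(2)[OF null_two_powers[of "2 ^ Suc i"]] unfolding eventually_sequentially by blast
      show "\<exists>M. \<forall>m\<ge>M. \<forall>k>m. dist (w m i) (w k i) < r"
      proof (intro exI[of _ M] allI impI)
        fix m k assume "M \<le> m" "m < k"
        then show "dist (w m i) (w k i) < r"
          using bd[of m k] M[of m] unfolding dist_real_def by linarith
      qed
    qed
    then show "convergent (\<lambda>s. w s i)" by (rule real_Cauchy_convergent)
  qed
  then have "\<exists>l. \<forall>i. (\<lambda>s. w s i) \<longlonglongrightarrow> l i" unfolding convergent_def by metis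
  then show ?thesis unfolding convergent_def tendsto_fun_iff .
qed

lemma ZZ_tendsto: "w \<in> ZZ \<Longrightarrow> w \<longlonglongrightarrow> lim w"
  using ZZ_convergent convergent_LIMSEQ_iff by blast

lemma lim_hcube: "w \<in> ZZ \<Longrightarrow> lim w \<in> hcube"
  by (rule closed_sequentially[OF closed_hcube _ ZZ_tendsto]) (auto intro: ZZ_hcube)

lemma ZZ_near_lim: "w \<in> ZZ \<Longrightarrow> hdist (w s) (lim w) \<le> 2 / 2 ^ s"
  by (rule hdist_le_limit[where a = w and m = s]) (auto intro: ZZ_hcube ZZ_tendsto ZZ_near lim_hcube)

text \<open>The limit of \<open>ZZ_near_hproj\<close>. Unlike \<open>ZZ_near_lim\<close> it measures
  at the scale \<open>\<delta> s\<close> of the inner balls in \<open>cond7\<close>.\<close>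

lemma ZZ_near_hproj_lim:
  assumes "w \<in> ZZ"
  shows "hdist (w s) (hproj (n s) (lim w)) \<le> \<delta> s / 2"
proof (rule hdist_le_limit[where a = "\<lambda>k. hproj (n s) (w k)" and m = "Suc s"])
  show "hdist (w s) (hproj (n s) (w k)) \<le> \<delta> s / 2" if "Suc s \<le> k" for k
    using ZZ_near_hproj[OF assms, of s k] that by simp
qed (auto intro: assms hproj_hcube ZZ_hcube lim_hcube tendsto_hproj ZZ_tendsto)

text \<open>\<open>P_small\<close> controls only the interior of the cylinder over
  \<open>P j\<close>. By \<open>P_proj\<close>, stage \<open>Suc j\<close> lies over the interior of
  \<open>P j\<close>, hence in that interior; this accounts for the index shift.\<close>

lemma P_near_XX:
  assumes y: "y \<in> P (Suc j)"
  obtains x where "x \<in> XX" "hdist x y < 2 / real (j + 1)"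
proof -
  have yh: "y \<in> hcube" using y P_hcube by blast
  let ?U = "(top_of_set (fcube (n j))) interior_of P j"
  have "openin (top_of_set hcube) {z \<in> topspace (top_of_set hcube). hproj (n j) z \<in> ?U}"
    by (rule openin_continuous_map_preimage[where Y = "top_of_set (fcube (n j))"])
      (auto simp: continuous_map_in_subtopology continuous_on_hproj hproj_fcube)
  moreover have "y \<in> {z \<in> topspace (top_of_set hcube). hproj (n j) z \<in> ?U}"
    using P_proj[of j] y yh by auto
  moreover have "{z \<in> topspace (top_of_set hcube). hproj (n j) z \<in> ?U} \<subseteq> {z \<in> hcube. hproj (n j) z \<in> P j}"
    using interior_of_subset[of _ "P j"] by auto
  ultimately have "y \<in> (top_of_set hcube) interior_of {z \<in> hcube. hproj (n j) z \<in> P j}"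
    using interior_of_maximal by blast
  then have "y \<in> hnbhd XX (2 / real (j + 1))" using P_small[of j] by blast
  then show ?thesis using that by (auto simp: hnbhd_def)
qed

lemma null_two_over: "(\<lambda>k. 2 / real (k + m + 1)) \<longlonglongrightarrow> 0"
  using LIMSEQ_ignore_initial_segment[OF tendsto_mult_left[OF LIMSEQ_inverse_real_of_nat, of 2], of m]
  by (simp add: divide_inverse add.commute add.left_commute)

lemma lim_XX:
  assumes "compact_space X" "w \<in> ZZ"
  shows "lim w \<in> XX"
proof -
  \<comment> \<open>The radius for stage \<open>Suc k\<close> is the one attached to stage
    \<open>k\<close>; the summand 0 fits \<open>null_two_over\<close>.\<close>
  define c where "c = (\<lambda>k::nat. 2 / real (k + 0 + 1))"
  have c0: "c \<longlonglongrightarrow> 0" unfolding c_def by (rule null_two_over)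
  have near: "\<exists>x\<in>XX. hdist x (w (Suc k)) \<le> c k" for k
  proof -
    obtain x where "x \<in> XX" "hdist x (w (Suc k)) < 2 / real (k + 1)"
      by (rule P_near_XX[OF ZZ_P[OF assms(2)]])
    then show ?thesis by (intro bexI[of _ x]) (simp_all add: c_def)
  qed
  obtain r l where r: "strict_mono (r :: nat \<Rightarrow> nat)" "l \<in> XX" "((\<lambda>k. w (Suc k)) \<circ> r) \<longlonglongrightarrow> l"
    using hdist_near_compact_subsequence[OF compact_XX[OF assms(1)] XX_hcube ZZ_hcube[OF assms(2)] near c0] .
  have "((\<lambda>k. w (Suc k)) \<circ> r) \<longlonglongrightarrow> lim w"
    by (rule LIMSEQ_subseq_LIMSEQ[OF LIMSEQ_Suc[OF ZZ_tendsto[OF assms(2)]] r(1)])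
  with r show ?thesis using LIMSEQ_unique by metis
qed

text \<open>The \<open>P k\<close> need not be nested as subsets of the cube, so a sequence is used:
  points outside \<open>V\<close> in later and later stages would accumulate at a point of
  \<open>XX\<close> outside \<open>V\<close>.\<close>

lemma P_eventually_sub:
  assumes "compact_space X" "openin (top_of_set hcube) V" "XX \<subseteq> V"
  obtains k where "m \<le> k" "P k \<subseteq> V"
proof (rule ccontr)
  assume *: "\<not> thesis"
  then have "\<exists>y. y \<in> P (Suc (k + m)) \<and> y \<notin> V" for k
    using that[of "Suc (k + m)"] by auto
  then obtain y where y: "\<And>k. y k \<in> P (Suc (k + m))" "\<And>k. y k \<notin> V" by metis
  define c where "c = (\<lambda>k::nat. 2 / real (k + m + 1))"
  have c0: "c \<longlonglongrightarrow> 0" unfolding c_def by (rule null_two_over)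
  have near: "\<exists>x\<in>XX. hdist x (y k) \<le> c k" for k
  proof -
    obtain x where "x \<in> XX" "hdist x (y k) < 2 / real (k + m + 1)"
      by (rule P_near_XX[OF y(1)])
    then show ?thesis by (intro bexI[of _ x]) (simp_all add: c_def)
  qed
  have yh: "y k \<in> hcube" for k using y(1) P_hcube by blast
  obtain r l where r: "strict_mono (r :: nat \<Rightarrow> nat)" "l \<in> XX" "(y \<circ> r) \<longlonglongrightarrow> l"
    using hdist_near_compact_subsequence[OF compact_XX[OF assms(1)] XX_hcube yh near c0] .
  have "closedin (top_of_set hcube) (hcube - V)"
    using assms(2) by (metis closedin_diff closedin_topspace topspace_euclidean_subtopology)
  then have "closed (hcube - V)" by (simp add: closedin_closed_eq[OF closed_hcube])
  then have "l \<in> hcube - V"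
    by (rule closed_sequentially[OF _ _ r(3)]) (use y yh in auto)
  with r(2) assms(3) show False by blast
qed

text \<open>In each coordinate the threads converge uniformly, since the bound in
  \<open>ZZ_near_lim\<close> is independent of the thread.\<close>

lemma continuous_on_lim: "continuous_on ZZ lim"
  unfolding continuous_on_fun_iff
proof
  fix i
  have "uniform_limit ZZ (\<lambda>s w. w s i) (\<lambda>w. lim w i) sequentially"
  proof (rule uniform_limitI)
    fix r :: real assume "0 < r"
    then have "\<forall>\<^sub>F s in sequentially. 2 ^ Suc i * (2 / 2 ^ s) < r"
      by (rule order_tendstoD(2)[OF null_two_powers])
    then show "\<forall>\<^sub>F s in sequentially. \<forall>w\<in>ZZ. dist (w s i) (lim w i) < r"
    proof eventually_elim
      case (elim s)
      show ?case
      proof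
        fix w assume w: "w \<in> ZZ"
        have "\<bar>w s i - lim w i\<bar> \<le> 2 ^ Suc i * hdist (w s) (lim w)"
          by (intro coord_le_hdist ZZ_hcube lim_hcube w)
        also have "\<dots> \<le> 2 ^ Suc i * (2 / 2 ^ s)"
          by (intro mult_left_mono ZZ_near_lim w) auto
        finally show "dist (w s i) (lim w i) < r" using elim by (simp add: dist_real_def)
      qed
    qed
  qed
  moreover have "continuous_on ZZ (\<lambda>w. w s i)" for s
    using continuous_on_apply[of ZZ s] unfolding continuous_on_fun_iff ..
  ultimately show "continuous_on ZZ (\<lambda>w. lim w i)"
    by (intro uniform_limit_theorem[where F = sequentially]) (auto intro!: always_eventually)
qed

text \<open>The strict bound of the assumption \<open>cond1\<close>, in the closed form needed for closed stars; it follows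
  by moving from \<open>v\<close> slightly towards \<open>u\<close>.\<close>

lemma cond1_le:
  assumes "s < j" and u: "u \<in> hcube" and v: "v \<in> hcube" and uv: "hdist u v \<le> \<epsilon> j"
  shows "hdist (hproj (n s) u) (hproj (n s) v) \<le> \<delta> s"
proof (rule field_le_mult_one_interval)
  fix t :: real assume t: "0 < t" "t < 1"
  have "t * hdist u v \<le> t * \<epsilon> j" using uv t by simp
  also have "\<dots> < \<epsilon> j" using t \<epsilon>_pos[of j] by simp
  finally have "hdist u (lerp t u v) < \<epsilon> j" using hdist_lerp[OF u v] t by simp
  moreover have "lerp t u v \<in> hcube" using t u v by (intro lerp_convex[OF convex_hcube]) auto
  ultimately have "hdist (hproj (n s) u) (hproj (n s) (lerp t u v)) < \<delta> s"
    using cond1[OF assms(1) u] by blast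
  then show "t * hdist (hproj (n s) u) (hproj (n s) v) \<le> \<delta> s"
    using hdist_lerp[OF hproj_hcube[OF u] hproj_hcube[OF v], of t] t by (simp add: hproj_lerp)
qed

text \<open>The stars given by \<open>cond7\<close> are squeezed between balls of radii
  \<open>2 * \<delta> j\<close> and \<open>\<epsilon> j\<close>. Through \<open>cond1\<close> the
  outer radius makes bonding images of a star land in the inner ball of the earlier stage. So the
  stars form an inverse sequence, and its threads are exactly the threads converging to
  \<open>x\<close>.\<close>

lemma fibre_cell_like:
  assumes x: "x \<in> XX"
  shows "cell_like (top_of_set {w \<in> ZZ. lim w = x})"
proof -
  have xh: "x \<in> hcube" using x XX_hcube by blast
  obtain v where v: "\<And>j. v j \<in> \<Union>(Tt j)"
    "\<And>j. hcball (hproj (n j) x) (2 * \<delta> j) \<inter> P j \<subseteq> closed_star (v j) (Tt j)"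
    "\<And>j. closed_star (v j) (Tt j) \<subseteq> hcball (hproj (n j) x) (\<epsilon> j) \<inter> P j"
    using cond7[OF x] by metis
  define S where "S = (\<lambda>j. closed_star (v j) (Tt j))"
  have SP: "S j \<subseteq> P j" for j using v(3) by (auto simp: S_def)
  have comp: "compact (S j)" for j
    unfolding S_def closed_star_def
    using finite_Tt compact_convex_hull_fun by (intro compact_UN) auto
  have vS: "v j \<in> S j" for j
    using v(1)[of j] hull_inc unfolding S_def closed_star_def by fast
  \<comment> \<open>The projection of a star to stage \<open>s\<close> stays within
    \<open>\<delta> s\<close> of the projection of \<open>x\<close>, and the bonding map differs
    from it by less than \<open>\<delta> s / 2\<close>.\<close>
  have bond_near: "hdist (hproj (n s) x) (bond g s j y) < 2 * \<delta> s" if "s < j" "y \<in> S j" for s j y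
  proof -
    have yP: "y \<in> P j" using SP that by blast
    then have yh: "y \<in> hcube" using P_hcube by blast
    have bh: "bond g s j y \<in> hcube" using bond_P[of s j y] that yP P_hcube by auto
    have "n s \<le> n j" using n_increasing that(1) by (simp add: strict_mono_less_eq)
    moreover have "hdist (hproj (n j) x) y \<le> \<epsilon> j"
      using v(3)[of j] that(2) by (auto simp: S_def hcball_def)
    ultimately have "hdist (hproj (n s) x) (hproj (n s) y) \<le> \<delta> s"
      using cond1_le[OF that(1) hproj_hcube[OF xh] yh] by (metis hproj_hproj)
    moreover have "hdist (hproj (n s) y) (bond g s j y) < \<delta> s / 2"
      using bond_near_hproj[OF that(1) yP] by (simp add: hdist_commute)
    moreover have "hdist (hproj (n s) x) (bond g s j y)
        \<le> hdist (hproj (n s) x) (hproj (n s) y) + hdist (hproj (n s) y) (bond g s j y)"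
      by (intro hdist_triangle hproj_hcube xh yh bh)
    ultimately show ?thesis using \<delta>_pos[of s] by linarith
  qed
  have gS: "g j ` S (Suc j) \<subseteq> S j" for j
  proof
    fix z assume "z \<in> g j ` S (Suc j)"
    then obtain y where y: "y \<in> S (Suc j)" "z = bond g j (Suc j) y" by auto
    have zP: "z \<in> P j" unfolding y(2) by (rule bond_P) (use y SP in auto)
    moreover have "hdist (hproj (n j) x) z < 2 * \<delta> j" unfolding y(2) by (rule bond_near) (use y in auto)
    ultimately have "z \<in> hcball (hproj (n j) x) (2 * \<delta> j) \<inter> P j"
      using P_hcube by (auto simp: hcball_def)
    then show "z \<in> S j" using v(2) by (auto simp: S_def)
  qed
  have contg: "continuous_on (S (Suc j)) (g j)" for j
    using continuous_on_g SP by (rule continuous_on_subset)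
  have "{w \<in> ZZ. lim w = x} = threads S g"
  proof
    show "threads S g \<subseteq> {w \<in> ZZ. lim w = x}"
    proof
      fix w assume w: "w \<in> threads S g"
      then have wZ: "w \<in> ZZ" using SP by (auto simp: threads_def)
      have xl: "(\<lambda>s. hproj (n s) x) \<longlonglongrightarrow> x"
        unfolding tendsto_fun_iff
      proof
        fix i
        have "\<forall>\<^sub>F s in sequentially. hproj (n s) x i = x i"
          using eventually_gt_at_top[of i]
          by eventually_elim (use le_n in \<open>auto simp: hproj_def dest: less_le_trans\<close>)
        then show "(\<lambda>s. hproj (n s) x i) \<longlonglongrightarrow> x i" by (rule tendsto_eventually)
      qed
      \<comment> \<open>A thread through the stars stays within \<open>2 * \<delta> s\<close> of the
        projections of \<open>x\<close>, which converge to \<open>x\<close>.\<close>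
      have "(\<lambda>s. hdist (hproj (n s) x) (w s)) \<longlonglongrightarrow> 0"
      proof (rule tendsto_sandwich)
        show "\<forall>\<^sub>F s in sequentially. 0 \<le> hdist (hproj (n s) x) (w s)"
          by (intro always_eventually allI hdist_nonneg hproj_hcube xh ZZ_hcube wZ)
        show "\<forall>\<^sub>F s in sequentially. hdist (hproj (n s) x) (w s) \<le> 2 * (2 / 2 ^ s)"
        proof (intro always_eventually allI)
          fix s
          have "hdist (hproj (n s) x) (w s) < 2 * \<delta> s"
            using bond_near[of s "Suc s" "w (Suc s)"] w by (auto simp: threads_def)
          then show "hdist (hproj (n s) x) (w s) \<le> 2 * (2 / 2 ^ s)"
            using cond3[of s] two_n_le[of s] by linarith
        qed
      qed (rule tendsto_const, rule null_two_powers)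
      then have "w \<longlonglongrightarrow> x"
        by (rule hdist_tendsto_0_imp[rotated 2]) (auto intro: hproj_hcube xh ZZ_hcube wZ xl)
      then show "w \<in> {w \<in> ZZ. lim w = x}" using wZ by (simp add: limI)
    qed
    show "{w \<in> ZZ. lim w = x} \<subseteq> threads S g"
    proof
      fix w assume "w \<in> {w \<in> ZZ. lim w = x}"
      then have w: "w \<in> ZZ" "lim w = x" by auto
      have "w j \<in> S j" for j
      proof -
        \<comment> \<open>Conversely, a thread with limit \<open>x\<close> is within
          \<open>\<delta> j / 2\<close>, well inside the inner ball, whose part in
          \<open>P j\<close> the star contains.\<close>
        have "hdist (hproj (n j) x) (w j) \<le> \<delta> j / 2"
          using ZZ_near_hproj_lim[OF w(1), of j] w(2) by (simp add: hdist_commute)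
        then have "w j \<in> hcball (hproj (n j) x) (2 * \<delta> j) \<inter> P j"
          using ZZ_hcube[OF w(1)] ZZ_P[OF w(1)] \<delta>_pos[of j] by (auto simp: hcball_def)
        then show ?thesis using v(2) by (auto simp: S_def)
      qed
      then show "w \<in> threads S g" using w by (simp add: threads_def)
    qed
  qed
  moreover have "cell_like (top_of_set (threads S g))"
  proof (rule cell_like_starlike_inverse_limit(2)[of S v, OF comp _ vS _ gS contg])
    show "S j \<subseteq> hcube" for j using SP P_hcube by blast
    show "lerp t y (v j) \<in> S j" if "y \<in> S j" "0 \<le> t" "t \<le> 1" for j y t
      using closed_star_lerp that unfolding S_def by blast
  qed
  ultimately show ?thesis by simp
qed

lemma cell_like_map_lim:
  assumes "compact_space X"
  shows "cell_like_map (top_of_set ZZ) (top_of_set XX) lim"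
proof -
  have c: "continuous_map (top_of_set ZZ) (top_of_set XX) lim"
    using lim_XX[OF assms] by (auto simp: continuous_map_in_subtopology continuous_on_lim)
  moreover have "compact_space (top_of_set ZZ)"
    using compact_threads[of P g] compact_P continuous_on_g by (simp add: compact_space_subtopology)
  then have "proper_map (top_of_set ZZ) (top_of_set XX) lim"
    by (rule continuous_imp_proper_map) (use c in \<open>auto intro!: Hausdorff_imp_kc_space simp: Hausdorff_space_subtopology\<close>)
  moreover have "subtopology (top_of_set ZZ) {z \<in> topspace (top_of_set ZZ). lim z = x} = top_of_set {w \<in> ZZ. lim w = x}" for x
    by (simp add: subtopology_subtopology Int_absorb1)
  ultimately show ?thesis
    using fibre_cell_like by (simp add: cell_like_map_def)
qed

end

section \<open>Extending maps over the inverse limit\<close>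

lemma tau_ext_homeomorphic:
  assumes \<phi>: "homeomorphic_map X Y \<phi>" and X: "tau_ext X M"
  shows "tau_ext Y M"
proof -
  obtain \<psi> where maps: "homeomorphic_maps X Y \<phi> \<psi>"
    using \<phi> homeomorphic_map_maps by blast
  then have c: "continuous_map X Y \<phi>" "continuous_map Y X \<psi>"
    and inv: "\<And>x. x \<in> topspace X \<Longrightarrow> \<psi> (\<phi> x) = x" "\<And>y. y \<in> topspace Y \<Longrightarrow> \<phi> (\<psi> y) = y"
    by (auto simp: homeomorphic_maps_def)
  show ?thesis
    unfolding tau_ext_def
  proof (intro allI impI, elim conjE)
    fix A f assume A: "closedin Y A" and f: "continuous_map (subtopology Y A) M f"
    define B where "B = {x \<in> topspace X. \<phi> x \<in> A}"
    have B: "closedin X B"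
      unfolding B_def by (rule closedin_continuous_map_preimage[OF c(1) A])
    have "continuous_map (subtopology X B) (subtopology Y A) \<phi>"
      by (rule continuous_map_into_subtopology[OF continuous_map_from_subtopology[OF c(1)]])
        (auto simp: B_def)
    then have "continuous_map (subtopology X B) M (f \<circ> \<phi>)"
      using f by (rule continuous_map_compose)
    then obtain h where h: "continuous_map X M h" "\<And>x. x \<in> B \<Longrightarrow> h x = (f \<circ> \<phi>) x"
      using X B unfolding tau_ext_def by metis
    have "h (\<psi> y) = f y" if "y \<in> A" for y
    proof -
      have "y \<in> topspace Y" using that closedin_subset[OF A] by blast
      moreover from this have "\<psi> y \<in> topspace X"
        using continuous_map_image_subset_topspace[OF c(2)] by blast
      ultimately show ?thesis using h(2)[of "\<psi> y"] inv(2)[of y] that by (simp add: B_def)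
    qed
    then show "\<exists>h. continuous_map Y M h \<and> (\<forall>x\<in>A. h x = f x)"
      using continuous_map_compose[OF c(2) h(1)] by (intro exI[of _ "h \<circ> \<psi>"]) simp
  qed
qed

lemma continuous_map_bary_poly_mono:
  "continuous_map Y (top_of_set (bary_poly L)) f \<Longrightarrow> L \<subseteq> L' \<Longrightarrow> continuous_map Y (top_of_set (bary_poly L')) f"
  using bary_poly_mono[of L L'] by (auto simp: continuous_map_in_subtopology)

lemma subcomplex_Un: "subcomplex L K \<Longrightarrow> subcomplex L' K \<Longrightarrow> subcomplex (L \<union> L') K"
  unfolding subcomplex_def abs_complex_def by blast

lemma simplicial_nbhd_subset: "abs_complex S \<Longrightarrow> simplicial_nbhd A S \<subseteq> S"
  unfolding simplicial_nbhd_def using abs_complex_face by blast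

context induced_inverse_sequence
begin

lemma abs_complex_T: "abs_complex (T j)"
  using T_triangulates[of j] by (simp add: triangulates_def geom_complex_def)

lemma tau_ext_XX: "tau_ext (top_of_set XX) (polyhedron_top K)"
  by (rule tau_ext_homeomorphic[OF homeomorphic_X]) (use K_extdim in \<open>simp add: is_extdim_def\<close>)

text \<open>The projection pulls \<open>m\<close> back to the closed cylinder \<open>R\<close> over
  \<open>E\<close>. On \<open>XX \<inter> R\<close> the result extends over \<open>XX\<close>
  because \<open>X \<tau> |K|\<close>, and the glued map on \<open>XX \<union> R\<close> extends to
  a neighbourhood, which contains some late \<open>P k\<close>.\<close>

lemma extend_over_later_stage:
  assumes X: "compact_space X" and E: "closed E" and L: "finite L" "subcomplex L K"
    and m: "continuous_map (top_of_set E) (top_of_set (bary_poly L)) m"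
  obtains k L' G where "j < k" "finite L'" "subcomplex L' K" "L \<subseteq> L'"
    "continuous_map (top_of_set (P k)) (top_of_set (bary_poly L')) G"
    "\<And>z. z \<in> P k \<Longrightarrow> hproj (n j) z \<in> E \<Longrightarrow> G z = m (hproj (n j) z)"
proof -
  define R where "R = {z \<in> hcube. hproj (n j) z \<in> E}"
  define mp where "mp = m \<circ> hproj (n j)"
  have "R = hcube \<inter> hproj (n j) -` E" by (auto simp: R_def)
  then have clR: "closed R"
    using continuous_closed_preimage[OF continuous_on_hproj closed_hcube E] by simp
  have contmp: "continuous_map (top_of_set R) (top_of_set (bary_poly L)) mp"
    unfolding mp_def
    by (rule continuous_map_compose[OF _ m])
      (auto simp: continuous_map_in_subtopology continuous_on_hproj R_def)
  have clX: "closed XX" using compact_XX[OF X] by (rule compact_imp_closed)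
  have sub: "subtopology (top_of_set S) U = top_of_set U" if "U \<subseteq> S" for S U :: "(nat \<Rightarrow> real) set"
    using that by (simp add: subtopology_subtopology Int_absorb1)
  have sK: "continuous_map Y (polyhedron_top K) f"
    if "continuous_map Y (top_of_set (bary_poly L)) f" for Y :: "(nat \<Rightarrow> real) topology" and f
    using that continuous_map_polyhedron_top_iff[OF K_complex L(2,1)] by blast
  have "continuous_map (top_of_set (XX \<inter> R)) (top_of_set (bary_poly L)) mp"
    using contmp continuous_map_from_subtopology_mono by (metis inf_le2)
  then have "continuous_map (subtopology (top_of_set XX) (XX \<inter> R)) (polyhedron_top K) mp"
    unfolding sub[OF Int_lower1] by (rule sK)
  moreover have "closedin (top_of_set XX) (XX \<inter> R)" using clR by (rule closedin_closed_Int)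
  ultimately obtain H where H: "continuous_map (top_of_set XX) (polyhedron_top K) H"
    "\<And>z. z \<in> XX \<inter> R \<Longrightarrow> H z = mp z"
    using tau_ext_XX[unfolded tau_ext_def, rule_format, of "XX \<inter> R" mp] by auto
  have "compactin (top_of_set XX) XX" using compact_XX[OF X] by (simp add: compactin_subtopology)
  \<comment> \<open>The extension over \<open>XX\<close> may leave \<open>|L|\<close>, but by
    compactness it needs only a finite subcomplex.\<close>
  then obtain L1 where L1: "finite L1" "subcomplex L1 K" "H ` XX \<subseteq> bary_poly L1"
    using compactin_polyhedron_top_imp_finite[OF K_complex image_compactin[OF _ H(1)]] by metis
  define L' where "L' = L \<union> L1"
  have L': "finite L'" "subcomplex L' K" "L \<subseteq> L'" "L1 \<subseteq> L'"
    using L L1 subcomplex_Un by (auto simp: L'_def)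
  let ?L = "top_of_set (bary_poly L')"
  have "continuous_map (top_of_set XX) (top_of_set (bary_poly L1)) H"
    unfolding continuous_map_polyhedron_top_iff[OF K_complex L1(2,1)] using H(1) L1(3) by auto
  then have H': "continuous_map (top_of_set XX) ?L H"
    using L'(4) by (rule continuous_map_bary_poly_mono)
  have mp': "continuous_map (top_of_set R) ?L mp"
    using contmp L'(3) by (rule continuous_map_bary_poly_mono)
  \<comment> \<open>Keeping \<open>R\<close> in the domain makes the later extension agree exactly,
    and not only up to homotopy, with \<open>m\<close> composed with the projection wherever the
    latter lands in \<open>E\<close>.\<close>
  define W where "W = (\<lambda>z. if z \<in> R then mp z else H z)"
  have W: "continuous_map (top_of_set (XX \<union> R)) ?L W"
  proof (rule continuous_map_glue_closed)
    show "closedin (top_of_set (XX \<union> R)) XX" "closedin (top_of_set (XX \<union> R)) R"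
      using clX clR by (auto simp: closed_subset)
    show "topspace (top_of_set (XX \<union> R)) \<subseteq> XX \<union> R" by simp
    show "continuous_map (subtopology (top_of_set (XX \<union> R)) XX) ?L W"
      unfolding sub[OF Un_upper1] by (rule continuous_map_eq[OF H']) (auto simp: W_def H)
    show "continuous_map (subtopology (top_of_set (XX \<union> R)) R) ?L W"
      unfolding sub[OF Un_upper2] by (rule continuous_map_eq[OF mp']) (auto simp: W_def)
  qed
  have XR: "XX \<union> R \<subseteq> hcube" using XX_hcube by (auto simp: R_def)
  have "closedin (top_of_set hcube) (XX \<union> R)"
    using XR clX clR by (simp add: closed_subset closed_Un)
  moreover have "continuous_map (subtopology (top_of_set hcube) (XX \<union> R)) ?L W"
    unfolding sub[OF XR] by (rule W)
  moreover have "abs_complex L'" using L'(2) by (simp add: subcomplex_def)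
  ultimately obtain V W' where V: "openin (top_of_set hcube) V" "XX \<union> R \<subseteq> V"
    "continuous_map (subtopology (top_of_set hcube) V) ?L W'" "\<And>z. z \<in> XX \<union> R \<Longrightarrow> W' z = W z"
    using polyhedron_neighbourhood_extension[OF normal_space_hcube _ L'(1)] by metis
  obtain k where k: "Suc j \<le> k" "P k \<subseteq> V"
    using P_eventually_sub[OF X V(1)] V(2) by (metis Un_subset_iff)
  show thesis
  proof
    show "j < k" using k by simp
    have "continuous_map (subtopology (top_of_set hcube) (P k)) ?L W'"
      using V(3) k(2) by (rule continuous_map_from_subtopology_mono)
    then show "continuous_map (top_of_set (P k)) ?L W'"
      unfolding sub[OF P_hcube] .
    show "W' z = m (hproj (n j) z)" if "z \<in> P k" "hproj (n j) z \<in> E" for z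
    proof -
      have "z \<in> R" using that P_hcube by (auto simp: R_def)
      then show ?thesis using V(4)[of z] by (simp add: W_def mp_def)
    qed
  qed (use L' in auto)
qed

text \<open>The map extends over a neighbourhood of \<open>A\<close> in the full product of cubes.
  For late \<open>s\<close> this contains every sequence agreeing with a thread of \<open>A\<close>
  up to \<open>s\<close>; so the coordinates after \<open>s\<close> can be shrunk to 0 by a
  homotopy, after which the value depends on \<open>w s\<close> alone, the earlier coordinates being
  its bonding images.\<close>

lemma factor_through_stage:
  assumes A: "compact A" "A \<subseteq> ZZ" "A \<noteq> {}" and M: "finite M" "abs_complex M"
    and F: "continuous_map (top_of_set A) (top_of_set (bary_poly M)) F"
  obtains s B f' where "B \<in> \<B> (P s)" "B \<subseteq> P s" "compact B" "\<And>w. w \<in> A \<Longrightarrow> w s \<in> B"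
    "continuous_map (top_of_set B) (top_of_set (bary_poly M)) f'"
    "homotopic_with (\<lambda>_. True) (top_of_set A) (top_of_set (bary_poly M)) F (\<lambda>w. f' (w s))"
proof -
  let ?M = "top_of_set (bary_poly M)"
  define QQ where "QQ = {w :: nat \<Rightarrow> nat \<Rightarrow> real. \<forall>j. w j \<in> hcube}"
  have cQQ: "compact QQ" unfolding QQ_def by (rule compact_PiE_UNIV[OF compact_hcube])
  have clQQ: "closed QQ" using cQQ by (rule compact_imp_closed)
  have AQ: "A \<subseteq> QQ" using A(2) ZZ_hcube by (auto simp: QQ_def)
  have clA: "closed A" using A(1) by (rule compact_imp_closed)
  have nQQ: "normal_space (top_of_set QQ)"
    by (simp add: metrizable_imp_normal_space metrizable_space_subtopology metrizable_space_euclidean)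
  have subQ: "subtopology (top_of_set QQ) A = top_of_set A"
    using AQ by (simp add: subtopology_subtopology Int_absorb1)
  have "closedin (top_of_set QQ) A" using clA AQ by (simp add: closed_subset)
  then obtain V F2 where V: "openin (top_of_set QQ) V" "A \<subseteq> V"
    "continuous_map (subtopology (top_of_set QQ) V) ?M F2" "\<And>w. w \<in> A \<Longrightarrow> F2 w = F w"
    using polyhedron_neighbourhood_extension[OF nQQ _ M, of A F] F subQ by metis
  have VQ: "V \<subseteq> QQ" using openin_subset[OF V(1)] by simp
  have contF2: "continuous_map (top_of_set V) ?M F2"
    using V(3) VQ by (simp add: subtopology_subtopology Int_absorb1)
  \<comment> \<open>\<open>C s\<close> is the set of sequences that agree with an element of \<open>A\<close> up to \<open>s\<close>, written as an
    image so that it is visibly compact.\<close>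
  define mix where "mix = (\<lambda>s :: nat. \<lambda>z i. if i \<le> s then fst z i else snd z i :: nat \<Rightarrow> real)"
  define C where "C = (\<lambda>s. mix s ` (A \<times> QQ))"
  have contmix: "continuous_on S (mix s)" for s S
  proof (rule continuous_on_coordinatewise_then_product)
    fix i
    show "continuous_on S (\<lambda>z. mix s z i)"
      by (cases "i \<le> s")
        (simp_all add: mix_def continuous_on_compose2[OF continuous_on_apply[of UNIV] continuous_on_fst]
          continuous_on_compose2[OF continuous_on_apply[of UNIV] continuous_on_snd])
  qed
  have C_closed: "closedin (top_of_set QQ) (C s)" for s
  proof -
    have "compact (C s)"
      unfolding C_def by (intro compact_continuous_image contmix compact_Times A(1) cQQ)
    moreover have "C s \<subseteq> QQ" using AQ by (auto simp: C_def mix_def QQ_def)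
    ultimately show ?thesis by (simp add: closed_subset compact_imp_closed)
  qed
  have C_mem: "b \<in> C s" if "w \<in> A" "b \<in> QQ" "\<And>i. i \<le> s \<Longrightarrow> b i = w i" for b w s
  proof -
    have "b = mix s (w, b)" using that(3) by (auto simp: mix_def)
    then show ?thesis using that(1,2) unfolding C_def by blast
  qed
  have C_ex: "\<exists>w\<in>A. \<forall>i\<le>s. b i = w i" if "b \<in> C s" for b s
    using that by (auto simp: C_def mix_def)
  have C_QQ: "C s \<subseteq> QQ" for s using closedin_subset[OF C_closed] by simp
  have "decseq C"
    unfolding decseq_def
  proof (intro allI impI subsetI)
    fix s s' :: nat and b assume "s \<le> s'" "b \<in> C s'"
    moreover then obtain w where "w \<in> A" "\<forall>i\<le>s'. b i = w i" using C_ex by blast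
    ultimately show "b \<in> C s" using C_QQ by (intro C_mem[of w]) auto
  qed
  moreover have "(\<Inter>s. C s) \<subseteq> V"
  proof
    fix b assume b: "b \<in> (\<Inter>s. C s)"
    then have "\<forall>s. \<exists>w\<in>A. \<forall>i\<le>s. b i = w i" using C_ex by blast
    \<comment> \<open>A sequence that agrees to every length with some element of \<open>A\<close>
      is a limit of such elements, so it belongs to \<open>A\<close>.\<close>
    then obtain w where w: "\<And>s. w s \<in> A" "\<And>s i. i \<le> s \<Longrightarrow> b i = w s i" by metis
    have "w \<longlonglongrightarrow> b"
      unfolding tendsto_fun_iff[of w]
    proof
      fix i
      show "(\<lambda>s. w s i) \<longlonglongrightarrow> b i"
        by (rule tendsto_eventually, rule eventually_sequentiallyI[of i]) (use w(2) in auto)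
    qed
    then have "b \<in> A" using closed_sequentially[OF clA] w(1) by blast
    then show "b \<in> V" using V(2) by blast
  qed
  ultimately obtain s where s: "C s \<subseteq> V"
    using closed_nest_subset_open[of "top_of_set QQ" C V] C_closed V(1) cQQ
    by (metis compact_space_subtopology compactin_euclidean_iff)
  \<comment> \<open>Completes a point of \<open>P s\<close> to a sequence, by bonding downwards and
    zeros afterwards; on \<open>w s\<close> it gives the end of the homotopy.\<close>
  define lam where "lam = (\<lambda>y i. if i \<le> s then bond g i s y else (\<lambda>_. 0))"
  have "continuous_on (P s) (bond g i s)" if "i \<le> s" for i
    using continuous_on_bond_P[of i s] that by (cases "i = s") (auto simp: id_def)
  then have "continuous_on (P s) (\<lambda>y. lam y i)" for i
    by (cases "i \<le> s") (simp_all add: lam_def)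
  then have contlam: "continuous_on (P s) lam"
    by (rule continuous_on_coordinatewise_then_product)
  have lamQ: "lam y \<in> QQ" if "y \<in> P s" for y
    using bond_P[OF _ that] P_hcube by (auto simp: QQ_def lam_def hcube_def)
  have lam_w: "lam (w s) = (\<lambda>i. if i \<le> s then w i else (\<lambda>_. 0))" if "w \<in> A" for w
    unfolding lam_def using subsetD[OF A(2) that] by (intro ext) (simp add: ZZ_bond)
  define U where "U = {y \<in> topspace (top_of_set (P s)). lam y \<in> V}"
  have "openin (top_of_set (P s)) U"
    unfolding U_def
    by (rule openin_continuous_map_preimage[OF _ V(1)])
      (auto simp: continuous_map_in_subtopology contlam lamQ)
  define C0 where "C0 = (\<lambda>w. w s) ` A"
  have C0P: "C0 \<subseteq> P s" using A(2) ZZ_P by (auto simp: C0_def)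
  have "compact C0" unfolding C0_def by (rule compact_continuous_image[OF continuous_on_apply A(1)])
  then have "closedin (top_of_set (P s)) C0" using C0P by (simp add: closed_subset compact_imp_closed)
  moreover have "C0 \<noteq> {}" using A(3) by (simp add: C0_def)
  moreover have "C0 \<subseteq> U"
  proof
    fix y assume y: "y \<in> C0"
    then obtain w where w: "w \<in> A" "y = w s" by (auto simp: C0_def)
    have yP: "y \<in> P s" using y C0P by blast
    have "lam y \<in> C s"
      by (rule C_mem[OF w(1) lamQ[OF yP]]) (simp add: w(2) lam_w[OF w(1)])
    then show "y \<in> U" using s yP by (auto simp: U_def)
  qed
  \<comment> \<open>A member of the fixed collection is chosen around the projection of
    \<open>A\<close>, so that the enumeration \<open>q\<close> covers, up to homotopy, the maps
    defined on it.\<close>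
  ultimately obtain B where B: "B \<in> \<B> (P s)" "C0 \<subseteq> (top_of_set (P s)) interior_of B" "B \<subseteq> U"
    using \<B>[OF compact_P P_hcube, of s] \<open>openin (top_of_set (P s)) U\<close>
    unfolding nbhd_collection_def by meson
  have "closedin (top_of_set (P s)) B"
    using \<B>[OF compact_P P_hcube, of s] B(1) unfolding nbhd_collection_def by blast
  then have cB: "compact B" and BP: "B \<subseteq> P s"
    using closedin_compact[OF compact_P] closedin_subset by force+
  define f' where "f' = F2 \<circ> lam"
  have "continuous_map (top_of_set B) (top_of_set V) lam"
    using B(3) continuous_on_subset[OF contlam BP] by (auto simp: continuous_map_in_subtopology U_def)
  then have contf': "continuous_map (top_of_set B) ?M f'"
    unfolding f'_def by (rule continuous_map_compose[OF _ contF2])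
  define h where "h = (\<lambda>z. F2 (\<lambda>i. if i \<le> s then snd z i else lerp (fst z) (snd z i) (\<lambda>_. 0)))"
  have "homotopic_with (\<lambda>_. True) (top_of_set A) ?M F (\<lambda>w. f' (w s))"
  proof (subst homotopic_with, simp, intro exI[of _ h] conjI ballI)
    let ?k = "\<lambda>z :: real \<times> (nat \<Rightarrow> nat \<Rightarrow> real). \<lambda>i. if i \<le> s then snd z i else lerp (fst z) (snd z i) (\<lambda>_. 0)"
    have ci: "continuous_on ({0..1} \<times> A) (\<lambda>z. snd z i)" for i
      by (rule continuous_on_compose2[OF continuous_on_apply[of UNIV] continuous_on_snd[OF continuous_on_id]]) auto
    have "continuous_on ({0..1} \<times> A) ?k"
    proof (rule continuous_on_coordinatewise_then_product)
      fix i
      show "continuous_on ({0..1} \<times> A) (\<lambda>z. ?k z i)"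
        by (cases "i \<le> s") (simp_all add: ci continuous_on_lerp continuous_on_fst)
    qed
    moreover have "?k z \<in> V" if "z \<in> {0..1} \<times> A" for z
    proof -
      have "(\<lambda>_. 0) \<in> hcube" by (simp add: hcube_def)
      then have "?k z \<in> QQ"
        using that AQ by (auto simp: QQ_def intro!: lerp_convex[OF convex_hcube])
      then have "?k z \<in> C s" using that by (intro C_mem[of "snd z"]) auto
      then show ?thesis using s by blast
    qed
    ultimately have "continuous_map (top_of_set ({0..1} \<times> A)) (top_of_set V) ?k"
      by (auto simp: continuous_map_in_subtopology)
    then have "continuous_map (top_of_set ({0..1} \<times> A)) ?M (F2 \<circ> ?k)"
      by (rule continuous_map_compose[OF _ contF2])
    then show "continuous_map (prod_topology (top_of_set {0..1}) (top_of_set A)) ?M h"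
      by (simp add: h_def comp_def)
    show "h (0, w) = F w" if "w \<in> topspace (top_of_set A)" for w
      using V(4)[of w] that by (simp add: h_def cong: if_cong)
    show "h (1, w) = f' (w s)" if "w \<in> topspace (top_of_set A)" for w
      using lam_w[of w] that by (simp add: h_def f'_def cong: if_cong)
  qed auto
  moreover have "w s \<in> B" if "w \<in> A" for w
    using B(2) interior_of_subset that by (fastforce simp: C0_def)
  ultimately show thesis using that[of B s f'] B(1) BP cB contf' by blast
qed

lemma compact_ZZ: "compact ZZ"
  by (rule compact_threads[of P g, OF compact_P continuous_on_g])

lemma tau_ext_ZZ:
  assumes X: "compact_space X"
  shows "tau_ext (top_of_set ZZ) (polyhedron_top K)"
  unfolding tau_ext_def
proof (intro allI impI, elim conjE)
  fix A F
  assume A: "closedin (top_of_set ZZ) A"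
    and F0: "continuous_map (subtopology (top_of_set ZZ) A) (polyhedron_top K) F"
  have AZ: "A \<subseteq> ZZ" using closedin_subset[OF A] by simp
  have subA: "subtopology (top_of_set ZZ) A = top_of_set A"
    using AZ by (simp add: subtopology_subtopology Int_absorb1)
  note F = F0[unfolded subA]
  have cA: "compact A" using A compact_ZZ by (rule closedin_compact[rotated])
  show "\<exists>h. continuous_map (top_of_set ZZ) (polyhedron_top K) h \<and> (\<forall>x\<in>A. h x = F x)"
  proof (cases "A = {}")
    \<comment> \<open>\<open>factor_through_stage\<close> asks for a nonempty \<open>A\<close>, as
      the members of \<open>\<B> (P s)\<close> surround nonempty sets; here a constant map at a
      vertex will do.\<close>
    case True
    obtain \<sigma> where \<sigma>: "\<sigma> \<in> K" using K_nonempty by auto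
    then obtain v where v: "v \<in> \<sigma>" using K_complex by (auto simp: abs_complex_def)
    have "{v} \<in> K" using abs_complex_face[OF K_complex \<sigma>, of "{v}"] v by simp
    moreover have "(\<lambda>u. if u = v then 1 else 0) \<in> bary_simplex {v}" by (simp add: bary_simplex_def)
    ultimately have "(\<lambda>u. if u = v then 1 else 0) \<in> bary_poly K" unfolding bary_poly_def by blast
    then show ?thesis
      using True by (intro exI[of _ "\<lambda>_. (\<lambda>u. if u = v then 1 else 0)"]) simp
  next
    case False
    have "compactin (top_of_set A) A" using cA by (simp add: compactin_subtopology)
    then obtain L where L: "finite L" "subcomplex L K" "F ` A \<subseteq> bary_poly L"
      using compactin_polyhedron_top_imp_finite[OF K_complex image_compactin[OF _ F]] by metis
    have FL: "continuous_map (top_of_set A) (top_of_set (bary_poly L)) F"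
      unfolding continuous_map_polyhedron_top_iff[OF K_complex L(2,1)] using F L(3) by auto
    \<comment> \<open>Only complexes listed in \<open>\<F>\<close> occur in the enumeration, so the
      problem is moved from \<open>L\<close> to an isomorphic \<open>M\<close>.\<close>
    obtain M where M: "M \<in> \<F>" "simplicially_isomorphic L M"
      using \<F> L unfolding finite_subcomplex_collection_def by blast
    then have fM: "finite M" "abs_complex M"
      using \<F> unfolding finite_subcomplex_collection_def by blast+
    let ?M = "top_of_set (bary_poly M)"
    have topM: "polyhedron_top M = ?M" by (rule polyhedron_top_finite[OF fM])
    obtain i1 i2 where iso: "continuous_map (top_of_set (bary_poly L)) ?M i1"
      "continuous_map ?M (top_of_set (bary_poly L)) i2" "\<And>b. b \<in> bary_poly L \<Longrightarrow> i2 (i1 b) = b"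
      by (rule simplicially_isomorphic_maps[OF M(2)]) (rule that)
    have F1: "continuous_map (top_of_set A) ?M (i1 \<circ> F)"
      by (rule continuous_map_compose[OF FL iso(1)])
    obtain s B f' where B: "B \<in> \<B> (P s)" "B \<subseteq> P s" "compact B" "\<And>w. w \<in> A \<Longrightarrow> w s \<in> B"
      "continuous_map (top_of_set B) ?M f'"
      "homotopic_with (\<lambda>_. True) (top_of_set A) ?M (i1 \<circ> F) (\<lambda>w. f' (w s))"
      by (rule factor_through_stage[OF cA AZ False fM F1]) (rule that)
    have "homotopy_representatives (top_of_set B) ?M (\<H> B M)"
      using \<H>[OF B(3) _ fM] B(2) P_hcube topM by (metis order_trans)
    then obtain h where h: "h \<in> \<H> B M" "homotopic_with (\<lambda>_. True) (top_of_set B) ?M f' h"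
      using B(5) unfolding homotopy_representatives_def by meson
    have "(B, M, h) \<in> range (\<lambda>k. (D s k, N s k, q s k))"
      unfolding q_enum using B(1) M(1) h(1) by simp
    then obtain t where t: "D s t = B" "N s t = M" "q s t = h" by auto
    \<comment> \<open>Surjectivity of \<open>\<eta>\<close> schedules the pair \<open>(s, t)\<close>
      at some stage \<open>j\<close>, and \<open>\<eta>_le\<close> ensures that \<open>j\<close> is
      not before \<open>s\<close>.\<close>
    obtain j where j: "\<eta> j = (s, t)" using \<eta>_bij by (metis bij_pointE)
    have sj: "s \<le> j" using \<eta>_le[of j] j by simp
    define AA where "AA = {x \<in> P j. bond g s j x \<in> B}"
    define S where "S = simplicial_nbhd AA (T j)"
    define E where "E = polyhedron_of S"
    \<comment> \<open>\<open>cond5\<close> extends the listed map, pulled back to stage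
      \<open>j\<close>, from \<open>AA\<close> over all simplexes meeting \<open>AA\<close>. This
      room is needed because the projection to stage \<open>j\<close> need not land in
      \<open>AA\<close>.\<close>
    obtain hE where hE: "continuous_map (top_of_set E) ?M hE" "\<And>x. x \<in> AA \<Longrightarrow> hE x = h (bond g s j x)"
      using cond5[OF j, of AA] by (auto simp: t AA_def E_def S_def topM)
    have "S \<subseteq> T j" unfolding S_def by (rule simplicial_nbhd_subset[OF abs_complex_T])
    then have "compact E"
      unfolding E_def using finite_T(2) finite_subset[OF _ finite_T(1)]
      by (intro compact_polyhedron_of) auto
    then have clE: "closed E" by (rule compact_imp_closed)
    have m: "continuous_map (top_of_set E) (top_of_set (bary_poly L)) (i2 \<circ> hE)"
      by (rule continuous_map_compose[OF hE(1) iso(2)])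
    obtain k L' G where G: "j < k" "finite L'" "subcomplex L' K" "L \<subseteq> L'"
      "continuous_map (top_of_set (P k)) (top_of_set (bary_poly L')) G"
      "\<And>z. z \<in> P k \<Longrightarrow> hproj (n j) z \<in> E \<Longrightarrow> G z = (i2 \<circ> hE) (hproj (n j) z)"
      by (rule extend_over_later_stage[OF X clE L(1,2) m]) (rule that)
    let ?L = "top_of_set (bary_poly L')"
    have wAA: "w j \<in> AA" if "w \<in> A" for w
      using that AZ B(4) ZZ_P ZZ_bond[OF _ sj] by (auto simp: AA_def)
    \<comment> \<open>\<open>w j\<close> and \<open>hproj (n j) (w k)\<close> lie in a common simplex, which belongs to \<open>E\<close> because \<open>w j\<close> does.\<close>
    have seg: "lerp \<theta> (hproj (n j) (w k)) (w j) \<in> E" if w: "w \<in> A" and \<theta>: "0 \<le> \<theta>" "\<theta> \<le> 1" for w \<theta>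
    proof -
      have wZ: "w \<in> ZZ" using w AZ by blast
      obtain \<sigma> where \<sigma>: "\<sigma> \<in> T j" "hproj (n j) (w k) \<in> convex hull \<sigma>" "bond g j k (w k) \<in> convex hull \<sigma>"
        using common_simplex[OF G(1) ZZ_P[OF wZ]] .
      have wj: "w j \<in> convex hull \<sigma>" using \<sigma>(3) ZZ_bond[OF wZ less_imp_le[OF G(1)]] by simp
      then have "\<sigma> \<in> S"
        using \<sigma>(1) wAA[OF w] abs_complex_T[of j] unfolding S_def simplicial_nbhd_def abs_complex_def by blast
      moreover have "lerp \<theta> (hproj (n j) (w k)) (w j) \<in> convex hull \<sigma>"
        by (rule lerp_convex[OF convex_convex_hull \<sigma>(2) wj \<theta>])
      ultimately show ?thesis unfolding E_def polyhedron_of_def by blast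
    qed
    have segE: "hproj (n j) (w k) \<in> E" if "w \<in> A" for w
      using seg[OF that, of 0] by simp
    have c_apply: "continuous_map (top_of_set A) (top_of_set B) (\<lambda>w. w s)"
      using B(4) by (auto simp: continuous_map_in_subtopology continuous_on_apply)
    have h1: "homotopic_with (\<lambda>_. True) (top_of_set A) ?M (\<lambda>w. f' (w s)) (\<lambda>w. h (w s))"
      using homotopic_with_compose_continuous_map_right[OF h(2) c_apply] by (simp add: comp_def)
    \<comment> \<open>The segment ends at \<open>w j\<close> in \<open>AA\<close>, where
      \<open>hE\<close> is \<open>h\<close> after bonding to stage \<open>s\<close>, that is,
      \<open>h (w s)\<close>.\<close>
    have h2: "homotopic_with (\<lambda>_. True) (top_of_set A) ?M (\<lambda>w. hE (hproj (n j) (w k))) (\<lambda>w. h (w s))"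
    proof (subst homotopic_with, simp, intro exI conjI ballI)
      let ?l = "\<lambda>z. lerp (fst z) (hproj (n j) (snd z k)) (snd z j)"
      have ci: "continuous_on ({0..1::real} \<times> A) (\<lambda>z. snd z i)" for i
        by (rule continuous_on_compose2[OF continuous_on_apply[of UNIV] continuous_on_snd[OF continuous_on_id]]) auto
      have "continuous_on ({0..1} \<times> A) ?l"
        by (intro continuous_on_lerp continuous_on_fst continuous_on_id ci
            continuous_on_compose2[OF continuous_on_hproj[of UNIV] ci]) auto
      then have "continuous_map (top_of_set ({0..1} \<times> A)) (top_of_set E) ?l"
        using seg by (auto simp: continuous_map_in_subtopology)
      then have "continuous_map (top_of_set ({0..1} \<times> A)) ?M (hE \<circ> ?l)"
        by (rule continuous_map_compose[OF _ hE(1)])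
      then show "continuous_map (prod_topology (top_of_set {0..1}) (top_of_set A)) ?M (hE \<circ> ?l)"
        by simp
      show "(hE \<circ> ?l) (0, w) = hE (hproj (n j) (w k))" for w by simp
      show "(hE \<circ> ?l) (1, w) = h (w s)" if "w \<in> topspace (top_of_set A)" for w
        using that hE(2)[OF wAA, of w] ZZ_bond[OF _ sj, of w] AZ by auto
    qed auto
    \<comment> \<open>The chain runs through \<open>h (w s)\<close> and \<open>f' (w s)\<close>;
      composing with \<open>i2\<close> then undoes \<open>i1\<close> and turns the first map into
      \<open>G (w k)\<close>.\<close>
    have "homotopic_with (\<lambda>_. True) (top_of_set A) ?M (\<lambda>w. hE (hproj (n j) (w k))) (i1 \<circ> F)"
      using homotopic_with_trans[OF h2 homotopic_with_symD[OF homotopic_with_trans[OF B(6) h1]]] .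
    then have "homotopic_with (\<lambda>_. True) (top_of_set A) ?L
        (i2 \<circ> (\<lambda>w. hE (hproj (n j) (w k)))) (i2 \<circ> (i1 \<circ> F))"
      by (rule homotopic_with_compose_continuous_map_left[OF _ continuous_map_bary_poly_mono[OF iso(2) G(4)]]) simp
    then have hom: "homotopic_with (\<lambda>_. True) (top_of_set A) ?L (\<lambda>w. G (w k)) F"
    proof (rule homotopic_with_eq)
      show "G (w k) = (i2 \<circ> (\<lambda>w. hE (hproj (n j) (w k)))) w" if "w \<in> topspace (top_of_set A)" for w
        using G(6)[of "w k"] ZZ_P[of w k] segE[of w] AZ that by auto
      show "F w = (i2 \<circ> (i1 \<circ> F)) w" if "w \<in> topspace (top_of_set A)" for w
        using that iso(3)[of "F w"] L(3) by auto
    qed simp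
    have "continuous_map (top_of_set ZZ) (top_of_set (P k)) (\<lambda>w. w k)"
      by (auto simp: continuous_map_in_subtopology continuous_on_apply ZZ_P)
    from continuous_map_compose[OF this G(5)]
    have contG: "continuous_map (top_of_set ZZ) ?L (\<lambda>w. G (w k))"
      by (simp only: comp_def)
    \<comment> \<open>\<open>G (w k)\<close> is defined for all threads and homotopic to
      \<open>F\<close> on \<open>A\<close>, so homotopy extension replaces it by an extension of
      \<open>F\<close> itself.\<close>
    have "compact_space (top_of_set ZZ)" "Hausdorff_space (top_of_set ZZ)"
      using compact_ZZ by (simp_all add: compact_space_subtopology Hausdorff_space_subtopology)
    moreover have "abs_complex L'" using G(3) by (simp add: subcomplex_def)
    ultimately obtain F' where F': "continuous_map (top_of_set ZZ) ?L F'" "\<And>w. w \<in> A \<Longrightarrow> F' w = F w"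
      using polyhedron_homotopy_extension[OF _ _ A G(2) _ contG] hom subA by metis
    then show ?thesis
      using continuous_map_polyhedron_top_iff[OF K_complex G(3,2)] by blast
  qed
qed

text \<open>\<open>ext_le\<close> speaks of compacta in \<open>nat => real\<close>, so the thread
  space is moved there by \<open>reindex\<close> and the conclusion is brought back.\<close>

lemma tau_ext_ZZ_CW:
  fixes K\<^sub>0 :: "'c topology"
  assumes X: "compact_space X" and K\<^sub>0: "CW_complex K\<^sub>0" "tau_ext X K\<^sub>0"
  shows "tau_ext (top_of_set ZZ) K\<^sub>0"
proof -
  let ?Y = "top_of_set (reindex ` ZZ)"
  note maps = homeomorphic_maps_reindex[of ZZ]
  have "tau_ext ?Y (polyhedron_top K)"
    by (rule tau_ext_homeomorphic[OF homeomorphic_maps_imp_map[OF maps] tau_ext_ZZ[OF X]])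
  moreover have "compact_space ?Y" "metrizable_space ?Y"
    using compact_continuous_image[OF continuous_on_reindex compact_ZZ]
    by (simp_all add: compact_space_subtopology metrizable_space_subtopology metrizable_space_euclidean)
  moreover have "ext_le (polyhedron_top K) K\<^sub>0"
    using K_extdim K\<^sub>0 by (simp add: is_extdim_def)
  ultimately have "tau_ext ?Y K\<^sub>0" unfolding ext_le_def by blast
  then show ?thesis
    by (rule tau_ext_homeomorphic[OF homeomorphic_maps_imp_map[OF homeomorphic_maps_sym[THEN iffD1, OF maps]]])
qed

end

theorem theorem8p5:
  fixes X :: "'x topology"
    and e :: "'x \<Rightarrow> nat \<Rightarrow> real"
    and K :: "'v set set"
    and \<B> :: "(nat \<Rightarrow> real) set \<Rightarrow> (nat \<Rightarrow> real) set set"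
    and \<H> :: "(nat \<Rightarrow> real) set \<Rightarrow> 'w set set \<Rightarrow> ((nat \<Rightarrow> real) \<Rightarrow> 'w \<Rightarrow> real) set"
    and \<F> :: "'w set set set"
    and \<eta> :: "nat \<Rightarrow> nat \<times> nat"
    and n :: "nat \<Rightarrow> nat"
    and P :: "nat \<Rightarrow> (nat \<Rightarrow> real) set"
    and \<epsilon> \<delta> :: "nat \<Rightarrow> real"
    and Tt T :: "nat \<Rightarrow> (nat \<Rightarrow> real) set set"
    and f \<phi> g :: "nat \<Rightarrow> (nat \<Rightarrow> real) \<Rightarrow> nat \<Rightarrow> real"
    and D :: "nat \<Rightarrow> nat \<Rightarrow> (nat \<Rightarrow> real) set"
    and N :: "nat \<Rightarrow> nat \<Rightarrow> 'w set set"
    and q :: "nat \<Rightarrow> nat \<Rightarrow> (nat \<Rightarrow> real) \<Rightarrow> 'w \<Rightarrow> real"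
    and Z :: "(nat \<Rightarrow> nat \<Rightarrow> real) topology"
  assumes "compact_space X" and "metrizable_space X" and "topspace X \<noteq> {}"
    and "induced_inverse_sequence TYPE('c) X e K \<B> \<H> \<F> \<eta> n P \<epsilon> Tt f \<delta> T \<phi> g D N q"
    and "Z = inverse_limit (\<lambda>j. top_of_set (polyhedron_of (T j))) g"
  shows "(\<forall>w \<in> topspace Z. \<exists>x \<in> e ` topspace X. w \<longlonglongrightarrow> x) \<and>
    compact_space Z \<and> metrizable_space Z \<and>
    cell_like_map Z (top_of_set (e ` topspace X)) (\<lambda>w. lim w) \<and>
    (\<forall>K\<^sub>0 :: 'c topology. CW_complex K\<^sub>0 \<and> tau_ext X K\<^sub>0 \<longrightarrow> tau_ext Z K\<^sub>0)"
proof -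
  interpret induced_inverse_sequence "TYPE('c)" X e K \<B> \<H> \<F> \<eta> n P \<epsilon> Tt f \<delta> T \<phi> g D N q
    by fact
  have Z: "Z = top_of_set ZZ"
    using assms(5) by (simp add: inverse_limit_eq_threads)
  have "\<exists>x\<in>e ` topspace X. w \<longlonglongrightarrow> x" if "w \<in> topspace Z" for w
    using that Z lim_XX[OF assms(1), of w] ZZ_tendsto[of w] by auto
  moreover have "compact_space Z" "metrizable_space Z"
    using compact_ZZ
    by (simp_all add: Z compact_space_subtopology metrizable_space_subtopology metrizable_space_euclidean)
  moreover have "cell_like_map Z (top_of_set (e ` topspace X)) (\<lambda>w. lim w)"
    using cell_like_map_lim[OF assms(1)] by (simp add: Z)
  moreover have "tau_ext Z K\<^sub>0" if "CW_complex K\<^sub>0" "tau_ext X K\<^sub>0" for K\<^sub>0 :: "'c topology"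
    unfolding Z by (rule tau_ext_ZZ_CW[OF assms(1) that])
  ultimately show ?thesis by blast
qed

end
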